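(* Let $R$ be an associative ring with unit, $\mathfrak{F}$ a perfect Gabriel filter on $R$, $\delta$ a derivation on $R$, $M$ a right $R$-module and $d_M$ a $\delta$-derivation on $M$. Then the unique $\delta$-derivation $d_{M_{\mathfrak{F}}}$ on the right $R$-module $M_{\mathfrak{F}}$ extending $d_M$ (that is, satisfying $d_{M_{\mathfrak{F}}}\phi_M=\phi_M d_M$) is given by $$d_{M_{\mathfrak{F}}}(x)=\Phi_M\Big(\sum_i \Big( d_M(m_i)\otimes q_i+m_i\otimes \sum_j \big(\phi_R(\delta(a_{ij}))\,q_{ij}-q_i\,\phi_R(\delta(r_{ij}))\,q_{ij}\big)\Big)\Big),\qquad x\in M_{\mathfrak{F}},$$ where $m_i\in M$ and $q_i\in R_{\mathfrak{F}}$ (finitely many) are such that $\Phi_M(\sum_i m_i\otimes q_i)=x$, and, for each $i$, the finitely many elements $r_{ij},a_{ij}\in R$ and $q_{ij}\in R_{\mathfrak{F}}$ are such that $q_i\phi_R(r_{ij})=\phi_R(a_{ij})$ for all $j$ and $\sum_j \phi_R(r_{ij})q_{ij}=1$.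
   Context: Modules are right modules unless stated otherwise. A derivation on $R$ is an additive map $\delta:R\to R$ with $\delta(rs)=\delta(r)s+r\delta(s)$ for all $r,s\in R$. A $\delta$-derivation on a right $R$-module $M$ is an additive map $d:M\to M$ with $d(xr)=d(x)r+x\delta(r)$ for all $x\in M$, $r\in R$. For a right ideal $I$ and $r\in R$ put $(I:r)=\{s\in R : rs\in I\}$; for $m$ in a right module put $\mathrm{ann}(m)=\{r\in R: mr=0\}$. A Gabriel filter $\mathfrak{F}$ on $R$ is a nonempty collection of right ideals such that (1) if $I\in\mathfrak{F}$ and $r\in R$ then $(I:r)\in\mathfrak{F}$; (2) if $I\in\mathfrak{F}$ and $J$ is a right ideal with $(J:r)\in\mathfrak{F}$ for all $r\in I$, then $J\in\mathfrak{F}$. A module $M$ is torsion if $\mathrm{ann}(m)\in\mathfrak{F}$ for all $m\in M$; the torsion submodule of $M$ is $\mathcal{T}M=\{m\in M:\mathrm{ann}(m)\in\mathfrak{F}\}$. The module of quotients $M_{\mathfrak{F}}$ is the largest submodule $N$ of the injective envelope $E(M/\mathcal{T}M)$ containing $M/\mathcal{T}M$ such that $N/(M/\mathcal{T}M)$ is torsion, and $\phi_M:M\to M_{\mathfrak{F}}$ is the composite $M\to M/\mathcal{T}M\hookrightarrow M_{\mathfrak{F}}$. $R_{\mathfrak{F}}$ carries a natural ring structure (the right ring of quotients) such that $\phi_R:R\to R_{\mathfrak{F}}$ is a ring homomorphism, and $M_{\mathfrak{F}}$ is naturally a right $R_{\mathfrak{F}}$-module extending its $R$-module structure. Let $i_M:M\to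 M\otimes_R R_{\mathfrak{F}}$, $i_M(m)=m\otimes1$. There is a unique right $R_{\mathfrak{F}}$-module map $\Phi_M:M\otimes_R R_{\mathfrak{F}}\to M_{\mathfrak{F}}$ with $\phi_M=\Phi_M i_M$. The Gabriel filter $\mathfrak{F}$ is perfect if $\phi_R:R\to R_{\mathfrak{F}}$ is an epimorphism in the category of rings, $R_{\mathfrak{F}}$ is flat as a left $R$-module, and $\mathfrak{F}$ is exactly the set of right ideals $I$ of $R$ with $\phi_R(I)R_{\mathfrak{F}}=R_{\mathfrak{F}}$. In this case $\Phi_M$ is an isomorphism for every $M$, and for every $q\in R_{\mathfrak{F}}$ there are finitely many $r_j\in R$, $q_j\in R_{\mathfrak{F}}$ with $q\phi_R(r_j)\in\phi_R(R)$ and $\sum_j\phi_R(r_j)q_j=1$. *)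

theory Defs
  imports "HOL-Algebra.Algebra" "HOL-Algebra.Free_Abelian_Groups"
begin

section \<open>Right modules over a noncommutative ring\<close>

text \<open>
  As with the modules of HOL-Algebra, the record extends that of rings only in order to
  reuse the additive part; the fields \<open>mult\<close> and \<open>one\<close> are irrelevant for modules and are
  left undefined where a module is constructed that is not a ring.
\<close>

record ('r, 'm) rmodule = "'m ring" +
  ract :: "['m, 'r] \<Rightarrow> 'm"  (infixl "\<cdot>\<index>" 70)

locale right_module = R?: ring R + M?: abelian_group M
  for R :: "('r, 'x) ring_scheme" (structure) and M :: "('r, 'm, 'y) rmodule_scheme" (structure) +
  assumes ract_closed: "\<lbrakk>x \<in> carrier M; r \<in> carrier R\<rbrakk> \<Longrightarrow> x \<cdot>\<^bsub>M\<^esub> r \<in> carrier M"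
    and ract_add_left: "\<lbrakk>x \<in> carrier M; y \<in> carrier M; r \<in> carrier R\<rbrakk>
          \<Longrightarrow> (x \<oplus>\<^bsub>M\<^esub> y) \<cdot>\<^bsub>M\<^esub> r = x \<cdot>\<^bsub>M\<^esub> r \<oplus>\<^bsub>M\<^esub> y \<cdot>\<^bsub>M\<^esub> r"
    and ract_add_right: "\<lbrakk>x \<in> carrier M; r \<in> carrier R; s \<in> carrier R\<rbrakk>
          \<Longrightarrow> x \<cdot>\<^bsub>M\<^esub> (r \<oplus>\<^bsub>R\<^esub> s) = x \<cdot>\<^bsub>M\<^esub> r \<oplus>\<^bsub>M\<^esub> x \<cdot>\<^bsub>M\<^esub> s"
    and ract_mult: "\<lbrakk>x \<in> carrier M; r \<in> carrier R; s \<in> carrier R\<rbrakk>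
          \<Longrightarrow> x \<cdot>\<^bsub>M\<^esub> (r \<otimes>\<^bsub>R\<^esub> s) = (x \<cdot>\<^bsub>M\<^esub> r) \<cdot>\<^bsub>M\<^esub> s"
    and ract_one: "x \<in> carrier M \<Longrightarrow> x \<cdot>\<^bsub>M\<^esub> \<one>\<^bsub>R\<^esub> = x"

definition regular_rmodule :: "('r, 'x) ring_scheme \<Rightarrow> ('r, 'r) rmodule" where
  "regular_rmodule R = \<lparr>carrier = carrier R, monoid.mult = monoid.mult R, one = one R,
     ring.zero = \<zero>\<^bsub>R\<^esub>, add = add R, ract = monoid.mult R\<rparr>"

definition right_submodule ::
  "('r, 'x) ring_scheme \<Rightarrow> 'm set \<Rightarrow> ('r, 'm, 'y) rmodule_scheme \<Rightarrow> bool" where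
  "right_submodule R N M \<longleftrightarrow> additive_subgroup N M \<and> (\<forall>x\<in>N. \<forall>r\<in>carrier R. x \<cdot>\<^bsub>M\<^esub> r \<in> N)"

definition quotient_rmodule :: "('r, 'm, 'y) rmodule_scheme \<Rightarrow> 'm set \<Rightarrow> ('r, 'm set) rmodule" where
  "quotient_rmodule M N = \<lparr>carrier = a_rcosets\<^bsub>M\<^esub> N, monoid.mult = undefined, one = undefined,
     ring.zero = N, add = set_add M, ract = (\<lambda>C r. \<Union>x\<in>C. N +>\<^bsub>M\<^esub> (x \<cdot>\<^bsub>M\<^esub> r))\<rparr>"

definition rmodule_hom ::
  "('r, 'x) ring_scheme \<Rightarrow> ('r, 'm, 'y) rmodule_scheme \<Rightarrow> ('r, 'n, 'z) rmodule_scheme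
     \<Rightarrow> ('m \<Rightarrow> 'n) set" where
  "rmodule_hom R M N = {f \<in> carrier M \<rightarrow> carrier N.
     (\<forall>x\<in>carrier M. \<forall>y\<in>carrier M. f (x \<oplus>\<^bsub>M\<^esub> y) = f x \<oplus>\<^bsub>N\<^esub> f y) \<and>
     (\<forall>x\<in>carrier M. \<forall>r\<in>carrier R. f (x \<cdot>\<^bsub>M\<^esub> r) = f x \<cdot>\<^bsub>N\<^esub> r)}"


section \<open>Derivations\<close>

definition derivation :: "('r, 'x) ring_scheme \<Rightarrow> ('r \<Rightarrow> 'r) \<Rightarrow> bool" where
  "derivation R \<delta> \<longleftrightarrow> \<delta> \<in> carrier R \<rightarrow> carrier R \<and>
     (\<forall>r\<in>carrier R. \<forall>s\<in>carrier R. \<delta> (r \<oplus>\<^bsub>R\<^esub> s) = \<delta> r \<oplus>\<^bsub>R\<^esub> \<delta> s) \<and>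
     (\<forall>r\<in>carrier R. \<forall>s\<in>carrier R. \<delta> (r \<otimes>\<^bsub>R\<^esub> s) = \<delta> r \<otimes>\<^bsub>R\<^esub> s \<oplus>\<^bsub>R\<^esub> r \<otimes>\<^bsub>R\<^esub> \<delta> s)"

definition module_derivation ::
  "('r, 'x) ring_scheme \<Rightarrow> ('r \<Rightarrow> 'r) \<Rightarrow> ('r, 'm, 'y) rmodule_scheme \<Rightarrow> ('m \<Rightarrow> 'm) \<Rightarrow> bool" where
  "module_derivation R \<delta> M d \<longleftrightarrow> d \<in> carrier M \<rightarrow> carrier M \<and>
     (\<forall>x\<in>carrier M. \<forall>y\<in>carrier M. d (x \<oplus>\<^bsub>M\<^esub> y) = d x \<oplus>\<^bsub>M\<^esub> d y) \<and>
     (\<forall>x\<in>carrier M. \<forall>r\<in>carrier R. d (x \<cdot>\<^bsub>M\<^esub> r) = d x \<cdot>\<^bsub>M\<^esub> r \<oplus>\<^bsub>M\<^esub> x \<cdot>\<^bsub>M\<^esub> \<delta> r)"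


section \<open>Gabriel filters and torsion\<close>

definition right_ideal :: "('r, 'x) ring_scheme \<Rightarrow> 'r set \<Rightarrow> bool" where
  "right_ideal R I \<longleftrightarrow> additive_subgroup I R \<and> (\<forall>a\<in>I. \<forall>r\<in>carrier R. a \<otimes>\<^bsub>R\<^esub> r \<in> I)"

definition colon :: "('r, 'x) ring_scheme \<Rightarrow> 'r set \<Rightarrow> 'r \<Rightarrow> 'r set" where
  "colon R I r = {s \<in> carrier R. r \<otimes>\<^bsub>R\<^esub> s \<in> I}"

definition annihilator ::
  "('r, 'x) ring_scheme \<Rightarrow> ('r, 'm, 'y) rmodule_scheme \<Rightarrow> 'm \<Rightarrow> 'r set" where
  "annihilator R M m = {r \<in> carrier R. m \<cdot>\<^bsub>M\<^esub> r = \<zero>\<^bsub>M\<^esub>}"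

definition gabriel_filter :: "('r, 'x) ring_scheme \<Rightarrow> 'r set set \<Rightarrow> bool" where
  "gabriel_filter R F \<longleftrightarrow> F \<noteq> {} \<and> (\<forall>I\<in>F. right_ideal R I) \<and>
     (\<forall>I\<in>F. \<forall>r\<in>carrier R. colon R I r \<in> F) \<and>
     (\<forall>I\<in>F. \<forall>J. right_ideal R J \<and> (\<forall>r\<in>I. colon R J r \<in> F) \<longrightarrow> J \<in> F)"

definition torsion_module ::
  "('r, 'x) ring_scheme \<Rightarrow> 'r set set \<Rightarrow> ('r, 'm, 'y) rmodule_scheme \<Rightarrow> bool" where
  "torsion_module R F M \<longleftrightarrow> (\<forall>m\<in>carrier M. annihilator R M m \<in> F)"

definition torsion_part ::
  "('r, 'x) ring_scheme \<Rightarrow> 'r set set \<Rightarrow> ('r, 'm, 'y) rmodule_scheme \<Rightarrow> 'm set" where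
  "torsion_part R F M = {m \<in> carrier M. annihilator R M m \<in> F}"

definition torsion_quotient ::
  "('r, 'x) ring_scheme \<Rightarrow> 'r set set \<Rightarrow> ('r, 'm, 'y) rmodule_scheme \<Rightarrow> ('r, 'm set) rmodule" where
  "torsion_quotient R F M = quotient_rmodule M (torsion_part R F M)"


section \<open>Injective envelopes\<close>

text \<open>
  HOL cannot quantify over all types inside a definition, so the test modules \<open>A\<close> and \<open>B\<close> are
  taken with carriers in the type of elements of \<open>R\<close>. These include all right ideals of \<open>R\<close> and
  \<open>R\<close> itself; by Baer's criterion injectivity with respect to them is injectivity with respect
  to right modules carried by any type.
\<close>

definition injective_rmodule ::
  "('r, 'x) ring_scheme \<Rightarrow> ('r, 'e, 'y) rmodule_scheme \<Rightarrow> bool" where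
  "injective_rmodule R E \<longleftrightarrow> right_module R E \<and>
     (\<forall>(A :: ('r, 'r) rmodule) (B :: ('r, 'r) rmodule) f g.
        right_module R A \<and> right_module R B \<and>
        f \<in> rmodule_hom R A B \<and> inj_on f (carrier A) \<and> g \<in> rmodule_hom R A E \<longrightarrow>
        (\<exists>h \<in> rmodule_hom R B E. \<forall>a\<in>carrier A. h (f a) = g a))"

definition essential_submodule ::
  "('r, 'x) ring_scheme \<Rightarrow> 'e set \<Rightarrow> ('r, 'e, 'y) rmodule_scheme \<Rightarrow> bool" where
  "essential_submodule R N E \<longleftrightarrow> right_submodule R N E \<and>
     (\<forall>K. right_submodule R K E \<and> K \<noteq> {\<zero>\<^bsub>E\<^esub>} \<longrightarrow> K \<inter> N \<noteq> {\<zero>\<^bsub>E\<^esub>})"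

definition injective_envelope ::
  "('r, 'x) ring_scheme \<Rightarrow> ('r, 'm, 'y) rmodule_scheme \<Rightarrow> ('r, 'e, 'z) rmodule_scheme
     \<Rightarrow> ('m \<Rightarrow> 'e) \<Rightarrow> bool" where
  "injective_envelope R M E \<iota> \<longleftrightarrow> injective_rmodule R E \<and> \<iota> \<in> rmodule_hom R M E \<and>
     inj_on \<iota> (carrier M) \<and> essential_submodule R (\<iota> ` carrier M) E"


section \<open>Modules of quotients and the ring of quotients\<close>

text \<open>
  Injective envelopes are unique only up to isomorphism, so \<open>E\<close> and the embedding \<open>\<iota>\<close> of
  \<open>torsion_quotient R F M\<close> into \<open>E\<close> are parameters of the constructions below.
\<close>

definition torsion_extension ::
  "('r, 'x) ring_scheme \<Rightarrow> 'r set set \<Rightarrow> ('r, 'm, 'y) rmodule_scheme \<Rightarrow>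
   ('r, 'e) rmodule \<Rightarrow> ('m set \<Rightarrow> 'e) \<Rightarrow> 'e set \<Rightarrow> bool" where
  "torsion_extension R F M E \<iota> N \<longleftrightarrow> right_submodule R N E \<and>
     \<iota> ` carrier (torsion_quotient R F M) \<subseteq> N \<and>
     torsion_module R F
       (quotient_rmodule (E\<lparr>carrier := N\<rparr>) (\<iota> ` carrier (torsion_quotient R F M)))"

definition module_of_quotients ::
  "('r, 'x) ring_scheme \<Rightarrow> 'r set set \<Rightarrow> ('r, 'm, 'y) rmodule_scheme \<Rightarrow>
   ('r, 'e) rmodule \<Rightarrow> ('m set \<Rightarrow> 'e) \<Rightarrow> ('r, 'e) rmodule" where
  "module_of_quotients R F M E \<iota> =
     E\<lparr>carrier := (THE N. torsion_extension R F M E \<iota> N \<and>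
                          (\<forall>N'. torsion_extension R F M E \<iota> N' \<longrightarrow> N' \<subseteq> N))\<rparr>"

definition quotients_map ::
  "('r, 'x) ring_scheme \<Rightarrow> 'r set set \<Rightarrow> ('r, 'm, 'y) rmodule_scheme \<Rightarrow>
   ('m set \<Rightarrow> 'e) \<Rightarrow> 'm \<Rightarrow> 'e" where
  "quotients_map R F M \<iota> m = \<iota> (torsion_part R F M +>\<^bsub>M\<^esub> m)"

text \<open>
  In the following, \<open>(E\<^sub>0, \<iota>\<^sub>0)\<close> is an injective envelope of \<open>R\<close> modulo its torsion. For \<open>x\<close> in the
  module of quotients of \<open>M\<close> and \<open>q\<close> in that of \<open>R\<close>, the product \<open>x q\<close> is the element \<open>y\<close> such that
  \<open>y r = x a\<close> whenever \<open>q r\<close> is the image of \<open>a\<close>. It is unique, because these \<open>r\<close> form a member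
  of the Gabriel filter and modules of quotients are torsion-free.
\<close>

definition quotients_action ::
  "('r, 'x) ring_scheme \<Rightarrow> 'r set set \<Rightarrow> ('r, 'm, 'y) rmodule_scheme \<Rightarrow>
   ('r, 'e) rmodule \<Rightarrow> ('m set \<Rightarrow> 'e) \<Rightarrow> ('r, 'q) rmodule \<Rightarrow> ('r set \<Rightarrow> 'q) \<Rightarrow> 'e \<Rightarrow> 'q \<Rightarrow> 'e" where
  "quotients_action R F M E \<iota> E\<^sub>0 \<iota>\<^sub>0 x q =
     (THE y. y \<in> carrier (module_of_quotients R F M E \<iota>) \<and>
        (\<forall>r\<in>carrier R. \<forall>a\<in>carrier R.
           q \<cdot>\<^bsub>E\<^sub>0\<^esub> r = quotients_map R F (regular_rmodule R) \<iota>\<^sub>0 a \<longrightarrow> y \<cdot>\<^bsub>E\<^esub> r = x \<cdot>\<^bsub>E\<^esub> a))"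

definition ring_of_quotients ::
  "('r, 'x) ring_scheme \<Rightarrow> 'r set set \<Rightarrow> ('r, 'q) rmodule \<Rightarrow> ('r set \<Rightarrow> 'q) \<Rightarrow> 'q ring" where
  "ring_of_quotients R F E\<^sub>0 \<iota>\<^sub>0 =
     \<lparr>carrier = carrier (module_of_quotients R F (regular_rmodule R) E\<^sub>0 \<iota>\<^sub>0),
      monoid.mult = quotients_action R F (regular_rmodule R) E\<^sub>0 \<iota>\<^sub>0 E\<^sub>0 \<iota>\<^sub>0,
      one = quotients_map R F (regular_rmodule R) \<iota>\<^sub>0 \<one>\<^bsub>R\<^esub>,
      ring.zero = \<zero>\<^bsub>E\<^sub>0\<^esub>, add = add E\<^sub>0\<rparr>"

definition module_over_quotients ::
  "('r, 'x) ring_scheme \<Rightarrow> 'r set set \<Rightarrow> ('r, 'm, 'y) rmodule_scheme \<Rightarrow>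
   ('r, 'e) rmodule \<Rightarrow> ('m set \<Rightarrow> 'e) \<Rightarrow> ('r, 'q) rmodule \<Rightarrow> ('r set \<Rightarrow> 'q) \<Rightarrow> ('q, 'e) rmodule" where
  "module_over_quotients R F M E \<iota> E\<^sub>0 \<iota>\<^sub>0 =
     \<lparr>carrier = carrier (module_of_quotients R F M E \<iota>), monoid.mult = undefined, one = undefined,
      ring.zero = \<zero>\<^bsub>E\<^esub>, add = add E, ract = quotients_action R F M E \<iota> E\<^sub>0 \<iota>\<^sub>0\<rparr>"


section \<open>Tensor products\<close>

text \<open>
  A left module \<open>N\<close> is given by a record of type \<open>module\<close>; a ring homomorphism \<open>\<phi>\<close> from \<open>R\<close> to \<open>S\<close>
  makes \<open>S\<close> a left \<open>R\<close>-module. The tensor product is the free abelian group on the pairs modulo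
  the subgroup generated by the usual relations.
\<close>

definition left_module_via :: "('s, 'y) ring_scheme \<Rightarrow> ('r \<Rightarrow> 's) \<Rightarrow> ('r, 's) module" where
  "left_module_via S \<phi> = \<lparr>carrier = carrier S, monoid.mult = monoid.mult S, one = one S,
     ring.zero = \<zero>\<^bsub>S\<^esub>, add = add S, smult = (\<lambda>r s. \<phi> r \<otimes>\<^bsub>S\<^esub> s)\<rparr>"

definition tensor_relations ::
  "('r, 'x) ring_scheme \<Rightarrow> ('r, 'm, 'y) rmodule_scheme \<Rightarrow> ('r, 'n, 'z) module_scheme
     \<Rightarrow> (('m \<times> 'n) \<Rightarrow>\<^sub>0 int) set" where
  "tensor_relations R M N =
     {frag_of (x \<oplus>\<^bsub>M\<^esub> y, n) - frag_of (x, n) - frag_of (y, n) | x y n.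
        x \<in> carrier M \<and> y \<in> carrier M \<and> n \<in> carrier N} \<union>
     {frag_of (x, n \<oplus>\<^bsub>N\<^esub> k) - frag_of (x, n) - frag_of (x, k) | x n k.
        x \<in> carrier M \<and> n \<in> carrier N \<and> k \<in> carrier N} \<union>
     {frag_of (x \<cdot>\<^bsub>M\<^esub> r, n) - frag_of (x, r \<odot>\<^bsub>N\<^esub> n) | x r n.
        x \<in> carrier M \<and> r \<in> carrier R \<and> n \<in> carrier N}"

definition tensor_null ::
  "('r, 'x) ring_scheme \<Rightarrow> ('r, 'm, 'y) rmodule_scheme \<Rightarrow> ('r, 'n, 'z) module_scheme
     \<Rightarrow> (('m \<times> 'n) \<Rightarrow>\<^sub>0 int) set" where
  "tensor_null R M N =
     generate (free_Abelian_group (carrier M \<times> carrier N)) (tensor_relations R M N)"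

definition tensor_class ::
  "('r, 'x) ring_scheme \<Rightarrow> ('r, 'm, 'y) rmodule_scheme \<Rightarrow> ('r, 'n, 'z) module_scheme
     \<Rightarrow> (('m \<times> 'n) \<Rightarrow>\<^sub>0 int) \<Rightarrow> (('m \<times> 'n) \<Rightarrow>\<^sub>0 int) set" where
  "tensor_class R M N c =
     tensor_null R M N #>\<^bsub>free_Abelian_group (carrier M \<times> carrier N)\<^esub> c"

definition tensor ::
  "('r, 'x) ring_scheme \<Rightarrow> ('r, 'm, 'y) rmodule_scheme \<Rightarrow> ('r, 'n, 'z) module_scheme
     \<Rightarrow> 'm \<Rightarrow> 'n \<Rightarrow> (('m \<times> 'n) \<Rightarrow>\<^sub>0 int) set" where
  "tensor R M N m n = tensor_class R M N (frag_of (m, n))"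

definition tensor_group ::
  "('r, 'x) ring_scheme \<Rightarrow> ('r, 'm, 'y) rmodule_scheme \<Rightarrow> ('r, 'n, 'z) module_scheme
     \<Rightarrow> (('m \<times> 'n) \<Rightarrow>\<^sub>0 int) set monoid" where
  "tensor_group R M N = free_Abelian_group (carrier M \<times> carrier N) Mod tensor_null R M N"

definition tensor_map ::
  "('r, 'x) ring_scheme \<Rightarrow> ('r, 'b, 'y) rmodule_scheme \<Rightarrow> ('r, 'n, 'z) module_scheme
     \<Rightarrow> ('a \<Rightarrow> 'b) \<Rightarrow> (('a \<times> 'n) \<Rightarrow>\<^sub>0 int) set \<Rightarrow> (('b \<times> 'n) \<Rightarrow>\<^sub>0 int) set" where
  "tensor_map R B N f C =
     (\<Union>c\<in>C. tensor_class R B N (frag_extend (\<lambda>(a, n). frag_of (f a, n)) c))"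

text \<open>
  If the left \<open>R\<close>-module \<open>N\<close> is a ring whose multiplication commutes with the left action, then
  \<open>M \<otimes> N\<close> is a right \<open>N\<close>-module with \<open>(m \<otimes> q) s = m \<otimes> (q s)\<close>.
\<close>

definition tensor_rmodule ::
  "('r, 'x) ring_scheme \<Rightarrow> ('r, 'm, 'y) rmodule_scheme \<Rightarrow> ('r, 'n, 'z) module_scheme
     \<Rightarrow> ('n, (('m \<times> 'n) \<Rightarrow>\<^sub>0 int) set) rmodule" where
  "tensor_rmodule R M N =
     \<lparr>carrier = carrier (tensor_group R M N), monoid.mult = undefined, one = undefined,
      ring.zero = one (tensor_group R M N), add = monoid.mult (tensor_group R M N),
      ract = (\<lambda>C s. \<Union>c\<in>C. tensor_class R M N
                (frag_extend (\<lambda>(m, q). frag_of (m, q \<otimes>\<^bsub>N\<^esub> s)) c))\<rparr>"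


section \<open>Perfect filters\<close>

text \<open>
  Flatness of a left module: tensoring preserves monomorphisms of right modules. The test modules
  are again carried by the type of elements of \<open>R\<close>, which suffices because flatness can be tested
  on the inclusions of right ideals into \<open>R\<close>.
\<close>

definition flat_left_module ::
  "('r, 'x) ring_scheme \<Rightarrow> ('r, 'n, 'z) module_scheme \<Rightarrow> bool" where
  "flat_left_module R N \<longleftrightarrow>
     (\<forall>(A :: ('r, 'r) rmodule) (B :: ('r, 'r) rmodule) f.
        right_module R A \<and> right_module R B \<and>
        f \<in> rmodule_hom R A B \<and> inj_on f (carrier A) \<longrightarrow>
        inj_on (tensor_map R B N f) (carrier (tensor_group R A N)))"

text \<open>
  Epimorphisms in the category of rings. For homomorphisms \<open>g\<close>, \<open>h\<close> out of \<open>S\<close>, the subring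
  generated by both images has at most \<open>max |S| \<aleph>\<^sub>0\<close> elements, so that it is enough to consider
  target rings carried by the type \<open>'s \<times> nat\<close>.
\<close>

definition ring_epimorphism ::
  "('r, 'x) ring_scheme \<Rightarrow> ('s, 'y) ring_scheme \<Rightarrow> ('r \<Rightarrow> 's) \<Rightarrow> bool" where
  "ring_epimorphism R S \<phi> \<longleftrightarrow> \<phi> \<in> ring_hom R S \<and>
     (\<forall>(T :: ('s \<times> nat) ring) g h.
        ring T \<and> g \<in> ring_hom S T \<and> h \<in> ring_hom S T \<and>
        (\<forall>r\<in>carrier R. g (\<phi> r) = h (\<phi> r)) \<longrightarrow> (\<forall>s\<in>carrier S. g s = h s))"

definition extended_right_ideal :: "('s, 'y) ring_scheme \<Rightarrow> ('r \<Rightarrow> 's) \<Rightarrow> 'r set \<Rightarrow> 's set" where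
  "extended_right_ideal S \<phi> I =
     {\<Oplus>\<^bsub>S\<^esub>j\<in>{..<n}. \<phi> (a j) \<otimes>\<^bsub>S\<^esub> q j | (n :: nat) a q.
        a \<in> {..<n} \<rightarrow> I \<and> q \<in> {..<n} \<rightarrow> carrier S}"

definition perfect_filter ::
  "('r, 'x) ring_scheme \<Rightarrow> 'r set set \<Rightarrow> ('r, 'q) rmodule \<Rightarrow> ('r set \<Rightarrow> 'q) \<Rightarrow> bool" where
  "perfect_filter R F E\<^sub>0 \<iota>\<^sub>0 \<longleftrightarrow>
     (let S = ring_of_quotients R F E\<^sub>0 \<iota>\<^sub>0; \<phi> = quotients_map R F (regular_rmodule R) \<iota>\<^sub>0 in
        ring_epimorphism R S \<phi> \<and>
        flat_left_module R (left_module_via S \<phi>) \<and>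
        F = {I. right_ideal R I \<and> extended_right_ideal S \<phi> I = carrier S})"


section \<open>The canonical map from the tensor product\<close>

definition quotients_tensor ::
  "('r, 'x) ring_scheme \<Rightarrow> 'r set set \<Rightarrow> ('r, 'q) rmodule \<Rightarrow> ('r set \<Rightarrow> 'q) \<Rightarrow>
   ('r, 'm, 'y) rmodule_scheme \<Rightarrow> 'm \<Rightarrow> 'q \<Rightarrow> (('m \<times> 'q) \<Rightarrow>\<^sub>0 int) set" where
  "quotients_tensor R F E\<^sub>0 \<iota>\<^sub>0 M =
     tensor R M (left_module_via (ring_of_quotients R F E\<^sub>0 \<iota>\<^sub>0)
       (quotients_map R F (regular_rmodule R) \<iota>\<^sub>0))"

definition quotients_tensor_module ::
  "('r, 'x) ring_scheme \<Rightarrow> 'r set set \<Rightarrow> ('r, 'q) rmodule \<Rightarrow> ('r set \<Rightarrow> 'q) \<Rightarrow>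
   ('r, 'm, 'y) rmodule_scheme \<Rightarrow> ('q, (('m \<times> 'q) \<Rightarrow>\<^sub>0 int) set) rmodule" where
  "quotients_tensor_module R F E\<^sub>0 \<iota>\<^sub>0 M =
     tensor_rmodule R M (left_module_via (ring_of_quotients R F E\<^sub>0 \<iota>\<^sub>0)
       (quotients_map R F (regular_rmodule R) \<iota>\<^sub>0))"

text \<open>Extensionality only fixes the values outside the carrier, so that \<open>THE\<close> applies.\<close>

definition canonical_map ::
  "('r, 'x) ring_scheme \<Rightarrow> 'r set set \<Rightarrow> ('r, 'q) rmodule \<Rightarrow> ('r set \<Rightarrow> 'q) \<Rightarrow>
   ('r, 'm, 'y) rmodule_scheme \<Rightarrow> ('r, 'e) rmodule \<Rightarrow> ('m set \<Rightarrow> 'e) \<Rightarrow>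
   (('m \<times> 'q) \<Rightarrow>\<^sub>0 int) set \<Rightarrow> 'e" where
  "canonical_map R F E\<^sub>0 \<iota>\<^sub>0 M E \<iota> =
     (THE \<Phi>. \<Phi> \<in> extensional (carrier (quotients_tensor_module R F E\<^sub>0 \<iota>\<^sub>0 M)) \<and>
        \<Phi> \<in> rmodule_hom (ring_of_quotients R F E\<^sub>0 \<iota>\<^sub>0) (quotients_tensor_module R F E\<^sub>0 \<iota>\<^sub>0 M)
              (module_over_quotients R F M E \<iota> E\<^sub>0 \<iota>\<^sub>0) \<and>
        (\<forall>m\<in>carrier M. quotients_map R F M \<iota> m =
           \<Phi> (quotients_tensor R F E\<^sub>0 \<iota>\<^sub>0 M m \<one>\<^bsub>ring_of_quotients R F E\<^sub>0 \<iota>\<^sub>0\<^esub>)))"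

end

theory Submission
  imports Defs
begin

text \<open>
  Let \<open>Q\<close> be the module of quotients of \<open>M\<close> with its map \<open>\<phi>\<close> from \<open>M\<close>, and let \<open>A\<close> be that of \<open>R\<close>
  with its map \<open>\<alpha>\<close> from \<open>R\<close>. The module \<open>Q\<close> is torsion-free, and every homomorphism into \<open>Q\<close> from a
  right ideal \<open>I\<close> of the filter is multiplication \<open>r \<mapsto> x r\<close> by an element \<open>x\<close> of \<open>Q\<close>. An element of
  \<open>Q\<close> is therefore determined by its products with the members of some \<open>I\<close> in the filter, and it may
  be constructed by prescribing them. As the cokernel of \<open>\<phi>\<close> is torsion, for each \<open>x\<close> in \<open>Q\<close> the
  \<open>r\<close> such that \<open>x r\<close> lies in the image of \<open>\<phi>\<close> form a member of the filter.

  The product \<open>x q\<close> with \<open>q\<close> in \<open>A\<close> is prescribed by \<open>(x q) r = x a\<close> whenever \<open>q r = \<alpha> a\<close>. The extended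
  derivation is prescribed by \<open>d x r = \<phi> (d m) - x (\<delta> r)\<close> whenever \<open>x r = \<phi> m\<close>, which is what the
  Leibniz rule requires; this gives existence and uniqueness together. The right hand side does not
  depend on \<open>m\<close>, because \<open>d\<close> preserves torsion, and that rests on \<open>filter_derivation\<close>: each \<open>I\<close> in the
  filter contains some \<open>J\<close> in the filter with \<open>\<delta> J \<subseteq> I\<close>.

  Applied to \<open>R\<close> itself, the construction extends \<open>\<delta>\<close> to \<open>A\<close>, and comparing products shows the Leibniz
  rule \<open>d (x q) = d x q + x \<delta> q\<close> over the ring of quotients (\<open>extension_act\<close>). Since the canonical map
  sends the tensor of \<open>m\<close> and \<open>q\<close> to \<open>\<phi> m q\<close>, it remains to compute \<open>\<delta> q\<close>. Differentiating
  \<open>q \<alpha> r\<^sub>j = \<alpha> a\<^sub>j\<close> gives \<open>\<delta> q \<alpha> r\<^sub>j = \<alpha> (\<delta> a\<^sub>j) - q \<alpha> (\<delta> r\<^sub>j)\<close>; multiplying by \<open>p\<^sub>j\<close> and summing with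
  \<open>\<Sum> \<alpha> r\<^sub>j p\<^sub>j = 1\<close> yields the formula (\<open>extension_formula\<close>).

  Perfection supplies such decompositions of \<open>1\<close> with all \<open>r\<^sub>j\<close> in any prescribed member of the filter.
  For the \<open>r\<close> with \<open>q r\<close> in the image of \<open>\<alpha>\<close> they are the data required for \<open>q\<close>; for the \<open>r\<close> with \<open>x r\<close>
  in the image of \<open>\<phi>\<close>, the equation \<open>x = \<Sum> x r\<^sub>j p\<^sub>j\<close> shows that the canonical map is onto.
\<close>

text \<open>The product of ideals is written with the same symbol as the action on a right module.\<close>

no_notation ideal_prod (infixl \<open>\<cdot>\<index>\<close> 80)


section \<open>Additive maps between abelian groups\<close>

lemma abelian_group_cong:
  assumes "abelian_group G" "carrier H = carrier G" "add H = add G" "\<zero>\<^bsub>H\<^esub> = \<zero>\<^bsub>G\<^esub>"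
  shows "abelian_group H"
proof -
  interpret abelian_group G by fact
  show ?thesis
  proof (rule abelian_groupI)
    fix x assume "x \<in> carrier H"
    then show "\<exists>y\<in>carrier H. y \<oplus>\<^bsub>H\<^esub> x = \<zero>\<^bsub>H\<^esub>"
      using assms by (intro bexI[of _ "\<ominus>\<^bsub>G\<^esub> x"]) (simp_all add: l_neg)
  qed (simp_all add: assms(2-) a_assoc, simp add: a_comm)
qed

lemma additive_minus:
  assumes G: "abelian_group G" and H: "abelian_group H" and f: "f \<in> carrier G \<rightarrow> carrier H"
    and add: "\<And>x y. \<lbrakk>x \<in> carrier G; y \<in> carrier G\<rbrakk> \<Longrightarrow> f (x \<oplus>\<^bsub>G\<^esub> y) = f x \<oplus>\<^bsub>H\<^esub> f y"
    and x: "x \<in> carrier G" and y: "y \<in> carrier G"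
  shows "f (x \<ominus>\<^bsub>G\<^esub> y) = f x \<ominus>\<^bsub>H\<^esub> f y"
proof -
  interpret G: abelian_group G by (rule G)
  interpret H: abelian_group H by (rule H)
  have "f x = f (x \<ominus>\<^bsub>G\<^esub> y \<oplus>\<^bsub>G\<^esub> y)"
    using x y by (simp add: G.minus_eq G.a_assoc G.l_neg)
  also have "\<dots> = f (x \<ominus>\<^bsub>G\<^esub> y) \<oplus>\<^bsub>H\<^esub> f y"
    by (rule add[OF G.minus_closed[OF x y] y])
  finally show ?thesis
    using Pi_mem[OF f y] Pi_mem[OF f G.minus_closed[OF x y]]
    by (simp add: H.minus_eq H.a_assoc H.r_neg)
qed

lemma additive_zero:
  assumes G: "abelian_group G" and H: "abelian_group H" and f: "f \<in> carrier G \<rightarrow> carrier H"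
    and add: "\<And>x y. \<lbrakk>x \<in> carrier G; y \<in> carrier G\<rbrakk> \<Longrightarrow> f (x \<oplus>\<^bsub>G\<^esub> y) = f x \<oplus>\<^bsub>H\<^esub> f y"
  shows "f \<zero>\<^bsub>G\<^esub> = \<zero>\<^bsub>H\<^esub>"
proof -
  interpret G: abelian_group G by (rule G)
  interpret H: abelian_group H by (rule H)
  have "f \<zero>\<^bsub>G\<^esub> \<oplus>\<^bsub>H\<^esub> f \<zero>\<^bsub>G\<^esub> = f \<zero>\<^bsub>G\<^esub>"
    using add[of "\<zero>\<^bsub>G\<^esub>" "\<zero>\<^bsub>G\<^esub>"] by simp
  then show ?thesis
    using Pi_mem[OF f G.zero_closed] H.add.l_cancel_one[of "f \<zero>\<^bsub>G\<^esub>" "f \<zero>\<^bsub>G\<^esub>"] by simp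
qed

lemma additive_finsum:
  assumes G: "abelian_group G" and H: "abelian_group H" and f: "f \<in> carrier G \<rightarrow> carrier H"
    and add: "\<And>x y. \<lbrakk>x \<in> carrier G; y \<in> carrier G\<rbrakk> \<Longrightarrow> f (x \<oplus>\<^bsub>G\<^esub> y) = f x \<oplus>\<^bsub>H\<^esub> f y"
    and I: "finite I" and g: "g \<in> I \<rightarrow> carrier G"
  shows "f (\<Oplus>\<^bsub>G\<^esub>i\<in>I. g i) = (\<Oplus>\<^bsub>H\<^esub>i\<in>I. f (g i))"
proof -
  interpret G: abelian_group G by (rule G)
  interpret H: abelian_group H by (rule H)
  show ?thesis
    using I g
  proof (induction I rule: finite_induct)
    case empty
    then show ?case
      using additive_zero[OF G H f add] by simp
  next
    case (insert i I)
    then have "(\<lambda>i. f (g i)) \<in> I \<rightarrow> carrier H" "g \<in> I \<rightarrow> carrier G" "g i \<in> carrier G"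
      using f by auto
    then show ?case
      using insert f by (simp add: add Pi_mem[OF f])
  qed
qed


section \<open>Right modules and conductors\<close>

text \<open>
  Annihilators are the conductors of the zero submodule, and colon ideals are the conductors in the
  regular module, so that facts about conductors serve for both.
\<close>

definition conductor ::
  "('r, 'x) ring_scheme \<Rightarrow> ('r, 'm, 'y) rmodule_scheme \<Rightarrow> 'm set \<Rightarrow> 'm \<Rightarrow> 'r set" where
  "conductor R M N x = {r \<in> carrier R. x \<cdot>\<^bsub>M\<^esub> r \<in> N}"

lemma annihilator_eq_conductor: "annihilator R M x = conductor R M {\<zero>\<^bsub>M\<^esub>} x"
  by (simp add: annihilator_def conductor_def)

context right_module
begin

lemma zero_ract [simp]: "r \<in> carrier R \<Longrightarrow> \<zero>\<^bsub>M\<^esub> \<cdot>\<^bsub>M\<^esub> r = \<zero>\<^bsub>M\<^esub>"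
  using ract_add_left[of "\<zero>\<^bsub>M\<^esub>" "\<zero>\<^bsub>M\<^esub>" r] ract_closed[of "\<zero>\<^bsub>M\<^esub>" r] M.add.l_cancel_one'
  by auto

lemma ract_zero [simp]: "x \<in> carrier M \<Longrightarrow> x \<cdot>\<^bsub>M\<^esub> \<zero> = \<zero>\<^bsub>M\<^esub>"
  using ract_add_right[of x "\<zero>" "\<zero>"] ract_closed[of x "\<zero>"] M.add.l_cancel_one'
  by auto

lemma ract_minus_left:
  assumes "x \<in> carrier M" "r \<in> carrier R"
  shows "(\<ominus>\<^bsub>M\<^esub> x) \<cdot>\<^bsub>M\<^esub> r = \<ominus>\<^bsub>M\<^esub> (x \<cdot>\<^bsub>M\<^esub> r)"
proof -
  have "(\<ominus>\<^bsub>M\<^esub> x) \<cdot>\<^bsub>M\<^esub> r \<oplus>\<^bsub>M\<^esub> x \<cdot>\<^bsub>M\<^esub> r = \<zero>\<^bsub>M\<^esub>"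
    using assms by (simp add: ract_add_left[symmetric] M.l_neg)
  then show ?thesis
    using assms M.minus_equality ract_closed by force
qed

lemma ract_minus_right:
  assumes "x \<in> carrier M" "r \<in> carrier R"
  shows "x \<cdot>\<^bsub>M\<^esub> (\<ominus> r) = \<ominus>\<^bsub>M\<^esub> (x \<cdot>\<^bsub>M\<^esub> r)"
proof -
  have "x \<cdot>\<^bsub>M\<^esub> (\<ominus> r) \<oplus>\<^bsub>M\<^esub> x \<cdot>\<^bsub>M\<^esub> r = \<zero>\<^bsub>M\<^esub>"
    using assms by (simp add: ract_add_right[symmetric] R.l_neg)
  then show ?thesis
    using assms M.minus_equality ract_closed by force
qed

lemma right_submoduleI:
  assumes "N \<subseteq> carrier M" "\<zero>\<^bsub>M\<^esub> \<in> N"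
    and "\<And>x y. \<lbrakk>x \<in> N; y \<in> N\<rbrakk> \<Longrightarrow> x \<oplus>\<^bsub>M\<^esub> y \<in> N"
    and "\<And>x r. \<lbrakk>x \<in> N; r \<in> carrier R\<rbrakk> \<Longrightarrow> x \<cdot>\<^bsub>M\<^esub> r \<in> N"
  shows "right_submodule R N M"
proof -
  \<comment> \<open>Negation is the action of \<open>- 1\<close>.\<close>
  have "\<ominus>\<^bsub>M\<^esub> x \<in> N" if "x \<in> N" for x
    using assms(4)[OF that, of "\<ominus> \<one>"] assms(1) that
    by (auto simp: ract_minus_right ract_one)
  then have "subgroup N (add_monoid M)"
    using assms by (intro subgroup.intro) (auto simp: a_inv_def)
  then show ?thesis
    using assms by (simp add: right_submodule_def additive_subgroup_def)
qed

lemma right_submoduleD: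
  assumes "right_submodule R N M"
  shows "N \<subseteq> carrier M" "\<zero>\<^bsub>M\<^esub> \<in> N"
    and "\<lbrakk>x \<in> N; y \<in> N\<rbrakk> \<Longrightarrow> x \<oplus>\<^bsub>M\<^esub> y \<in> N"
    and "x \<in> N \<Longrightarrow> \<ominus>\<^bsub>M\<^esub> x \<in> N"
    and "\<lbrakk>x \<in> N; r \<in> carrier R\<rbrakk> \<Longrightarrow> x \<cdot>\<^bsub>M\<^esub> r \<in> N"
proof -
  interpret N: additive_subgroup N M
    using assms by (simp add: right_submodule_def)
  show "N \<subseteq> carrier M" "\<zero>\<^bsub>M\<^esub> \<in> N" "\<lbrakk>x \<in> N; y \<in> N\<rbrakk> \<Longrightarrow> x \<oplus>\<^bsub>M\<^esub> y \<in> N"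
    "x \<in> N \<Longrightarrow> \<ominus>\<^bsub>M\<^esub> x \<in> N"
    using N.a_subset by simp_all
  show "\<lbrakk>x \<in> N; r \<in> carrier R\<rbrakk> \<Longrightarrow> x \<cdot>\<^bsub>M\<^esub> r \<in> N"
    using assms by (simp add: right_submodule_def)
qed

lemma zero_submodule: "right_submodule R {\<zero>\<^bsub>M\<^esub>} M"
  by (rule right_submoduleI) auto

lemma submodule_right_module:
  assumes N: "right_submodule R N M"
  shows "right_module R (M\<lparr>carrier := N\<rparr>)"
proof -
  note sub = right_submoduleD[OF N]
  have [simp]: "x \<in> N \<Longrightarrow> x \<in> carrier M" for x
    using sub(1) by blast
  have "abelian_group (M\<lparr>carrier := N\<rparr>)"
  proof (rule abelian_groupI)
    fix x assume "x \<in> carrier (M\<lparr>carrier := N\<rparr>)"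
    then show "\<exists>y\<in>carrier (M\<lparr>carrier := N\<rparr>). y \<oplus>\<^bsub>M\<lparr>carrier := N\<rparr>\<^esub> x = \<zero>\<^bsub>M\<lparr>carrier := N\<rparr>\<^esub>"
      by (intro bexI[of _ "\<ominus>\<^bsub>M\<^esub> x"]) (simp_all add: M.l_neg sub(4))
  qed (simp_all add: sub(2,3) M.a_assoc, simp add: M.a_comm)
  then show ?thesis
    by (intro right_module.intro right_module_axioms.intro R.ring_axioms)
      (simp_all add: sub(5) ract_add_left ract_add_right ract_mult ract_one)
qed

end

lemma regular_rmodule_simps [simp]:
  "carrier (regular_rmodule R) = carrier R" "add (regular_rmodule R) = add R"
  "\<zero>\<^bsub>regular_rmodule R\<^esub> = \<zero>\<^bsub>R\<^esub>" "ract (regular_rmodule R) = monoid.mult R"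
  by (simp_all add: regular_rmodule_def)

context ring
begin

lemma regular_right_module: "right_module R (regular_rmodule R)"
proof -
  have "abelian_group (regular_rmodule R)"
  proof (rule abelian_groupI)
    fix x assume "x \<in> carrier (regular_rmodule R)"
    then show "\<exists>y\<in>carrier (regular_rmodule R). y \<oplus>\<^bsub>regular_rmodule R\<^esub> x = \<zero>\<^bsub>regular_rmodule R\<^esub>"
      by (intro bexI[of _ "\<ominus> x"]) (simp_all add: regular_rmodule_def l_neg)
  qed (simp_all add: regular_rmodule_def a_assoc, simp add: a_comm)
  then show ?thesis
    by (intro right_module.intro right_module_axioms.intro ring_axioms)
      (simp_all add: regular_rmodule_def l_distr r_distr m_assoc)
qed

lemma right_ideal_iff_submodule: "right_ideal R I \<longleftrightarrow> right_submodule R I (regular_rmodule R)"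
  by (simp add: right_ideal_def right_submodule_def additive_subgroup_def regular_rmodule_def
      subgroup_def m_inv_def)

lemma right_idealI:
  assumes "I \<subseteq> carrier R" "\<zero> \<in> I"
    and "\<And>x y. \<lbrakk>x \<in> I; y \<in> I\<rbrakk> \<Longrightarrow> x \<oplus> y \<in> I"
    and "\<And>x r. \<lbrakk>x \<in> I; r \<in> carrier R\<rbrakk> \<Longrightarrow> x \<otimes> r \<in> I"
  shows "right_ideal R I"
  using right_module.right_submoduleI[OF regular_right_module, of I] assms
  by (simp add: right_ideal_iff_submodule regular_rmodule_def)

lemma right_idealD:
  assumes "right_ideal R I"
  shows "I \<subseteq> carrier R" "\<zero> \<in> I"
    and "\<lbrakk>x \<in> I; y \<in> I\<rbrakk> \<Longrightarrow> x \<oplus> y \<in> I"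
    and "\<lbrakk>x \<in> I; r \<in> carrier R\<rbrakk> \<Longrightarrow> x \<otimes> r \<in> I"
  using right_module.right_submoduleD[OF regular_right_module, of I] assms
  by (simp_all add: right_ideal_iff_submodule regular_rmodule_def)

lemma colon_right_ideal:
  assumes I: "right_ideal R I" and r: "r \<in> carrier R"
  shows "right_ideal R (colon R I r)"
  by (rule right_idealI)
    (use right_idealD[OF I] r in \<open>auto simp: colon_def r_distr m_assoc[symmetric]\<close>)

end

context right_module
begin

lemma conductor_right_ideal:
  assumes N: "right_submodule R N M" and "x \<in> carrier M"
  shows "right_ideal R (conductor R M N x)"
  by (rule R.right_idealI)
    (use right_submoduleD[OF N] assms(2) in \<open>auto simp: conductor_def ract_add_right ract_mult\<close>)

lemma colon_conductor:
  assumes "x \<in> carrier M" "r \<in> carrier R"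
  shows "colon R (conductor R M N x) r = conductor R M N (x \<cdot>\<^bsub>M\<^esub> r)"
  using assms by (auto simp: colon_def conductor_def ract_mult)

lemma annihilator_right_ideal: "x \<in> carrier M \<Longrightarrow> right_ideal R (annihilator R M x)"
  by (simp add: annihilator_eq_conductor conductor_right_ideal zero_submodule)

end


section \<open>Gabriel filters\<close>

locale gabriel_ring = ring R
  for R :: "('r, 'x) ring_scheme" (structure) +
  fixes F :: "'r set set"
  assumes gabriel: "gabriel_filter R F"
begin

lemma filter_right_ideal: "I \<in> F \<Longrightarrow> right_ideal R I"
  using gabriel unfolding gabriel_filter_def by blast

lemma filter_colon: "\<lbrakk>I \<in> F; r \<in> carrier R\<rbrakk> \<Longrightarrow> colon R I r \<in> F"
  using gabriel unfolding gabriel_filter_def by blast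

lemma filter_local:
  "\<lbrakk>I \<in> F; right_ideal R J; \<And>r. r \<in> I \<Longrightarrow> colon R J r \<in> F\<rbrakk> \<Longrightarrow> J \<in> F"
  using gabriel unfolding gabriel_filter_def by blast

lemma carrier_in_filter: "carrier R \<in> F"
proof -
  obtain I where "I \<in> F"
    using gabriel unfolding gabriel_filter_def by blast
  moreover have "colon R I \<zero> = carrier R"
    using right_idealD(2)[OF filter_right_ideal] \<open>I \<in> F\<close> by (auto simp: colon_def)
  ultimately show ?thesis
    using filter_colon[of I \<zero>] by simp
qed

lemma filter_mono:
  assumes "I \<in> F" "right_ideal R J" "I \<subseteq> J"
  shows "J \<in> F"
proof (rule filter_local[OF assms(1,2)])
  fix r assume "r \<in> I"
  then have "colon R J r = carrier R"
    using right_idealD(4)[OF assms(2)] assms(3) by (auto simp: colon_def)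
  then show "colon R J r \<in> F"
    by (simp add: carrier_in_filter)
qed

text \<open>
  For \<open>r \<in> I\<close> the colon ideals of \<open>I \<inter> J\<close> and of \<open>J\<close> at \<open>r\<close> coincide.
\<close>

lemma filter_Int:
  assumes I: "I \<in> F" and J: "J \<in> F"
  shows "I \<inter> J \<in> F"
proof (rule filter_local[OF I])
  note ideals = right_idealD[OF filter_right_ideal[OF I]] right_idealD[OF filter_right_ideal[OF J]]
  show "right_ideal R (I \<inter> J)"
    by (rule right_idealI) (use ideals in auto)
  fix r assume "r \<in> I"
  then have "colon R (I \<inter> J) r = colon R J r"
    using ideals by (auto simp: colon_def)
  then show "colon R (I \<inter> J) r \<in> F"
    using filter_colon[OF J, of r] ideals(1) \<open>r \<in> I\<close> by auto
qed

text \<open>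
  Every Gabriel filter is compatible with every derivation. For \<open>r \<in> I\<close> the Leibniz rule gives
  \<open>\<delta> (r s) \<in> I\<close> as soon as \<open>\<delta> r s \<in> I\<close>, because \<open>r \<delta> s\<close> lies in \<open>I\<close> anyway; the set of such \<open>s\<close>
  is the colon ideal of \<open>I\<close> at \<open>\<delta> r\<close>.
\<close>

lemma filter_derivation:
  assumes \<delta>: "derivation R \<delta>" and I: "I \<in> F"
  shows "{r \<in> I. \<delta> r \<in> I} \<in> F"
proof (rule filter_local[OF I])
  note ideal = right_idealD[OF filter_right_ideal[OF I]]
  have [simp]: "r \<in> I \<Longrightarrow> r \<in> carrier R" for r
    using ideal(1) by blast
  have \<delta>_closed [simp]: "r \<in> carrier R \<Longrightarrow> \<delta> r \<in> carrier R" for r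
    using \<delta> by (auto simp: derivation_def)
  have \<delta>_add: "\<delta> (r \<oplus> s) = \<delta> r \<oplus> \<delta> s" and \<delta>_mult: "\<delta> (r \<otimes> s) = \<delta> r \<otimes> s \<oplus> r \<otimes> \<delta> s"
    if "r \<in> carrier R" "s \<in> carrier R" for r s
    using \<delta> that by (auto simp: derivation_def)
  have "\<delta> \<zero> = \<zero>"
    using \<delta>_add[of \<zero> \<zero>] \<delta>_closed[of \<zero>] add.l_cancel_one' by auto
  then show "right_ideal R {r \<in> I. \<delta> r \<in> I}"
    by (intro right_idealI) (use ideal in \<open>auto simp: \<delta>_add \<delta>_mult\<close>)
  fix r assume r: "r \<in> I"
  have "colon R I (\<delta> r) \<subseteq> colon R {r \<in> I. \<delta> r \<in> I} r"
    using r ideal by (auto simp: colon_def \<delta>_mult)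
  moreover have "right_ideal R (colon R {r \<in> I. \<delta> r \<in> I} r)"
    using r \<open>right_ideal R {r \<in> I. \<delta> r \<in> I}\<close> by (simp add: colon_right_ideal)
  ultimately show "colon R {r \<in> I. \<delta> r \<in> I} r \<in> F"
    using filter_mono[of "colon R I (\<delta> r)"] filter_colon[OF I, of "\<delta> r"] r by simp
qed

end


section \<open>The universal property of modules of quotients\<close>

text \<open>
  The assumptions characterise \<open>Q\<close> and \<open>\<phi>\<close> up to isomorphism, without reference to an injective
  envelope: \<open>\<phi>\<close> is an isomorphism modulo torsion, \<open>Q\<close> is torsion-free, and \<open>extend\<close> says that \<open>Q\<close> is
  injective with respect to the inclusions of the members of the filter into \<open>R\<close>.
\<close>

locale quotient_module = gabriel_ring R F + M: right_module R M + Q: right_module R Q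
  for R :: "('r, 'x) ring_scheme" (structure) and F :: "'r set set"
    and M :: "('r, 'm, 'y) rmodule_scheme" and Q :: "('r, 'e, 'z) rmodule_scheme" +
  fixes \<phi> :: "'m \<Rightarrow> 'e"
  assumes hom: "\<phi> \<in> rmodule_hom R M Q"
    and torsion_free: "\<lbrakk>x \<in> carrier Q; annihilator R Q x \<in> F\<rbrakk> \<Longrightarrow> x = \<zero>\<^bsub>Q\<^esub>"
    and kernel_torsion: "\<lbrakk>m \<in> carrier M; \<phi> m = \<zero>\<^bsub>Q\<^esub>\<rbrakk> \<Longrightarrow> annihilator R M m \<in> F"
    and cokernel_torsion: "x \<in> carrier Q \<Longrightarrow> conductor R Q (\<phi> ` carrier M) x \<in> F"
    and extend: "\<lbrakk>I \<in> F; f \<in> I \<rightarrow> carrier Q;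
        \<And>r s. \<lbrakk>r \<in> I; s \<in> I\<rbrakk> \<Longrightarrow> f (r \<oplus> s) = f r \<oplus>\<^bsub>Q\<^esub> f s;
        \<And>r s. \<lbrakk>r \<in> I; s \<in> carrier R\<rbrakk> \<Longrightarrow> f (r \<otimes> s) = f r \<cdot>\<^bsub>Q\<^esub> s\<rbrakk>
      \<Longrightarrow> \<exists>x\<in>carrier Q. \<forall>r\<in>I. f r = x \<cdot>\<^bsub>Q\<^esub> r"
begin

lemma \<phi>_closed [simp]: "m \<in> carrier M \<Longrightarrow> \<phi> m \<in> carrier Q"
  and \<phi>_add: "\<lbrakk>m \<in> carrier M; n \<in> carrier M\<rbrakk> \<Longrightarrow> \<phi> (m \<oplus>\<^bsub>M\<^esub> n) = \<phi> m \<oplus>\<^bsub>Q\<^esub> \<phi> n"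
  and \<phi>_ract: "\<lbrakk>m \<in> carrier M; r \<in> carrier R\<rbrakk> \<Longrightarrow> \<phi> (m \<cdot>\<^bsub>M\<^esub> r) = \<phi> m \<cdot>\<^bsub>Q\<^esub> r"
  using hom by (auto simp: rmodule_hom_def)

declare M.ract_closed [simp] Q.ract_closed [simp]

lemma \<phi>_minus_eq_zero:
  assumes "m \<in> carrier M" "n \<in> carrier M" "\<phi> m = \<phi> n"
  shows "\<phi> (m \<ominus>\<^bsub>M\<^esub> n) = \<zero>\<^bsub>Q\<^esub>"
proof -
  have "\<phi> (m \<ominus>\<^bsub>M\<^esub> n) \<oplus>\<^bsub>Q\<^esub> \<phi> n = \<phi> m"
    using assms by (simp add: \<phi>_add[symmetric] M.M.minus_eq M.M.a_assoc M.M.l_neg)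
  then show ?thesis
    using assms Q.M.add.r_cancel_one[of "\<phi> n" "\<phi> (m \<ominus>\<^bsub>M\<^esub> n)"] by simp
qed

text \<open>
  Torsion-freeness in the form of a test for equality: the annihilator of the difference contains \<open>I\<close>.
\<close>

lemma eqI_filter:
  assumes "I \<in> F" "x \<in> carrier Q" "y \<in> carrier Q"
    and eq: "\<And>r. r \<in> I \<Longrightarrow> x \<cdot>\<^bsub>Q\<^esub> r = y \<cdot>\<^bsub>Q\<^esub> r"
  shows "x = y"
proof -
  have "I \<subseteq> annihilator R Q (x \<ominus>\<^bsub>Q\<^esub> y)"
    using assms right_idealD(1)[OF filter_right_ideal[OF \<open>I \<in> F\<close>]]
    by (auto simp: annihilator_def Q.M.minus_eq Q.ract_add_left Q.ract_minus_left Q.M.r_neg)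
  then have "x \<ominus>\<^bsub>Q\<^esub> y = \<zero>\<^bsub>Q\<^esub>"
    using assms by (intro torsion_free filter_mono[OF \<open>I \<in> F\<close>] Q.annihilator_right_ideal) auto
  moreover have "x = (x \<ominus>\<^bsub>Q\<^esub> y) \<oplus>\<^bsub>Q\<^esub> y"
    using assms by (simp add: Q.M.minus_eq Q.M.a_assoc Q.M.l_neg)
  ultimately show ?thesis
    using assms by simp
qed

text \<open>
  Elements of \<open>Q\<close> will be specified by relations \<open>P r y\<close>, read as a prescription \<open>x r = y\<close>, in which \<open>y\<close>
  is described through the choice of a preimage under \<open>\<phi>\<close>. When \<open>P\<close> is the graph of a homomorphism on a
  member of the filter, \<open>extend\<close> provides the element.
\<close>

lemma glue_relation:
  assumes I: "I \<in> F"
    and total: "\<And>r. r \<in> I \<Longrightarrow> \<exists>y\<in>carrier Q. P r y"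
    and functional: "\<And>r y z. \<lbrakk>r \<in> I; y \<in> carrier Q; z \<in> carrier Q; P r y; P r z\<rbrakk> \<Longrightarrow> y = z"
    and add: "\<And>r s y z. \<lbrakk>r \<in> I; s \<in> I; y \<in> carrier Q; z \<in> carrier Q; P r y; P s z\<rbrakk>
      \<Longrightarrow> P (r \<oplus> s) (y \<oplus>\<^bsub>Q\<^esub> z)"
    and mult: "\<And>r s y. \<lbrakk>r \<in> I; s \<in> carrier R; y \<in> carrier Q; P r y\<rbrakk> \<Longrightarrow> P (r \<otimes> s) (y \<cdot>\<^bsub>Q\<^esub> s)"
  obtains x where "x \<in> carrier Q" "\<And>r. r \<in> I \<Longrightarrow> P r (x \<cdot>\<^bsub>Q\<^esub> r)"
proof -
  note ideal = right_idealD[OF filter_right_ideal[OF I]]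
  obtain f where f: "\<And>r. r \<in> I \<Longrightarrow> f r \<in> carrier Q" "\<And>r. r \<in> I \<Longrightarrow> P r (f r)"
    using total by metis
  have "\<exists>x\<in>carrier Q. \<forall>r\<in>I. f r = x \<cdot>\<^bsub>Q\<^esub> r"
  proof (rule extend[OF I])
    fix r s assume "r \<in> I" "s \<in> I"
    then show "f (r \<oplus> s) = f r \<oplus>\<^bsub>Q\<^esub> f s"
      by (intro functional[of "r \<oplus> s"]) (simp_all add: f ideal add)
  next
    fix r s assume "r \<in> I" "s \<in> carrier R"
    then show "f (r \<otimes> s) = f r \<cdot>\<^bsub>Q\<^esub> s"
      by (intro functional[of "r \<otimes> s"]) (simp_all add: f ideal mult)
  qed (simp add: f)
  then show thesis
    using f(2) that by auto
qed

end


section \<open>Extension of derivations\<close>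

text \<open>
  A derivation \<open>D\<close> extending \<open>d\<close> satisfies \<open>D (x r) = D x r + x (\<delta> r)\<close>, and \<open>D (x r) = \<phi> (d m)\<close> if
  \<open>x r = \<phi> m\<close>. These equations determine \<open>D x\<close>.
\<close>

definition extended_derivation ::
  "('r, 'x) ring_scheme \<Rightarrow> ('r \<Rightarrow> 'r) \<Rightarrow> ('r, 'm, 'y) rmodule_scheme \<Rightarrow> ('m \<Rightarrow> 'm) \<Rightarrow>
   ('r, 'e, 'z) rmodule_scheme \<Rightarrow> ('m \<Rightarrow> 'e) \<Rightarrow> 'e \<Rightarrow> 'e" where
  "extended_derivation R \<delta> M d Q \<phi> x =
     (THE y. y \<in> carrier Q \<and> (\<forall>r\<in>carrier R. \<forall>m\<in>carrier M.
        x \<cdot>\<^bsub>Q\<^esub> r = \<phi> m \<longrightarrow> y \<cdot>\<^bsub>Q\<^esub> r \<oplus>\<^bsub>Q\<^esub> x \<cdot>\<^bsub>Q\<^esub> \<delta> r = \<phi> (d m)))"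

locale quotient_module_derivation = quotient_module R F M Q \<phi>
  for R :: "('r, 'x) ring_scheme" (structure) and F :: "'r set set"
    and M :: "('r, 'm, 'y) rmodule_scheme" and Q :: "('r, 'e, 'z) rmodule_scheme"
    and \<phi> :: "'m \<Rightarrow> 'e" +
  fixes \<delta> :: "'r \<Rightarrow> 'r" and d :: "'m \<Rightarrow> 'm"
  assumes ring_derivation: "derivation R \<delta>"
    and module_derivation: "module_derivation R \<delta> M d"
begin

lemma \<delta>_closed [simp]: "r \<in> carrier R \<Longrightarrow> \<delta> r \<in> carrier R"
  and \<delta>_add: "\<lbrakk>r \<in> carrier R; s \<in> carrier R\<rbrakk> \<Longrightarrow> \<delta> (r \<oplus> s) = \<delta> r \<oplus> \<delta> s"
  and \<delta>_mult: "\<lbrakk>r \<in> carrier R; s \<in> carrier R\<rbrakk> \<Longrightarrow> \<delta> (r \<otimes> s) = \<delta> r \<otimes> s \<oplus> r \<otimes> \<delta> s"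
  using ring_derivation by (auto simp: derivation_def)

lemma d_closed [simp]: "m \<in> carrier M \<Longrightarrow> d m \<in> carrier M"
  and d_add: "\<lbrakk>m \<in> carrier M; n \<in> carrier M\<rbrakk> \<Longrightarrow> d (m \<oplus>\<^bsub>M\<^esub> n) = d m \<oplus>\<^bsub>M\<^esub> d n"
  and d_ract: "\<lbrakk>m \<in> carrier M; r \<in> carrier R\<rbrakk>
      \<Longrightarrow> d (m \<cdot>\<^bsub>M\<^esub> r) = d m \<cdot>\<^bsub>M\<^esub> r \<oplus>\<^bsub>M\<^esub> m \<cdot>\<^bsub>M\<^esub> \<delta> r"
  using module_derivation by (auto simp: module_derivation_def)

lemma \<phi>_zero [simp]: "\<phi> \<zero>\<^bsub>M\<^esub> = \<zero>\<^bsub>Q\<^esub>"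
  using \<phi>_ract[of "\<zero>\<^bsub>M\<^esub>" "\<zero>"] by simp

lemma d_zero [simp]: "d \<zero>\<^bsub>M\<^esub> = \<zero>\<^bsub>M\<^esub>"
  using d_add[of "\<zero>\<^bsub>M\<^esub>" "\<zero>\<^bsub>M\<^esub>"] d_closed[of "\<zero>\<^bsub>M\<^esub>"] M.M.add.l_cancel_one' by auto

text \<open>
  Derivations preserve torsion. If \<open>I\<close> is the annihilator of \<open>m\<close> and both \<open>r\<close> and \<open>\<delta> r\<close> lie in \<open>I\<close>, then
  \<open>d m r = d (m r) - m (\<delta> r) = 0\<close>; such \<open>r\<close> form a member of the filter.
\<close>

lemma \<phi>_d_kernel:
  assumes m: "m \<in> carrier M" and "\<phi> m = \<zero>\<^bsub>Q\<^esub>"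
  shows "\<phi> (d m) = \<zero>\<^bsub>Q\<^esub>"
proof (rule eqI_filter)
  let ?I = "annihilator R M m"
  show "{r \<in> ?I. \<delta> r \<in> ?I} \<in> F"
    using assms by (intro filter_derivation ring_derivation kernel_torsion)
  fix r assume r: "r \<in> {r \<in> ?I. \<delta> r \<in> ?I}"
  then have "d m \<cdot>\<^bsub>M\<^esub> r = d (m \<cdot>\<^bsub>M\<^esub> r)"
    using m d_ract[of m r] by (simp add: annihilator_def del: d_zero)
  then show "\<phi> (d m) \<cdot>\<^bsub>Q\<^esub> r = \<zero>\<^bsub>Q\<^esub> \<cdot>\<^bsub>Q\<^esub> r"
    using r m by (simp add: annihilator_def \<phi>_ract[symmetric])
qed (use m in simp_all)

lemma \<phi>_d_cong:
  assumes "m \<in> carrier M" "n \<in> carrier M" "\<phi> m = \<phi> n"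
  shows "\<phi> (d m) = \<phi> (d n)"
proof -
  have "\<phi> (d (m \<ominus>\<^bsub>M\<^esub> n)) = \<zero>\<^bsub>Q\<^esub>"
    using assms by (intro \<phi>_d_kernel \<phi>_minus_eq_zero) auto
  moreover have "d m = d (m \<ominus>\<^bsub>M\<^esub> n) \<oplus>\<^bsub>M\<^esub> d n"
    using assms by (simp add: d_add[symmetric] M.M.minus_eq M.M.a_assoc M.M.l_neg)
  ultimately show ?thesis
    using assms by (simp add: \<phi>_add)
qed

abbreviation extension :: "'e \<Rightarrow> 'e" where
  "extension \<equiv> extended_derivation R \<delta> M d Q \<phi>"

text \<open>
  It is enough to know the defining equations for the \<open>r\<close> in some member \<open>I\<close> of the filter. The freedom
  to shrink \<open>I\<close> is what makes sums manageable: \<open>I\<close> can be chosen such that \<open>x r\<close> and \<open>y r\<close> both have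
  preimages.
\<close>

lemma extension_unique:
  assumes x: "x \<in> carrier Q" and "y \<in> carrier Q" "z \<in> carrier Q" and I: "I \<in> F"
    and y: "\<And>r m. \<lbrakk>r \<in> I; m \<in> carrier M; x \<cdot>\<^bsub>Q\<^esub> r = \<phi> m\<rbrakk>
        \<Longrightarrow> y \<cdot>\<^bsub>Q\<^esub> r \<oplus>\<^bsub>Q\<^esub> x \<cdot>\<^bsub>Q\<^esub> \<delta> r = \<phi> (d m)"
    and z: "\<And>r m. \<lbrakk>r \<in> I; m \<in> carrier M; x \<cdot>\<^bsub>Q\<^esub> r = \<phi> m\<rbrakk>
        \<Longrightarrow> z \<cdot>\<^bsub>Q\<^esub> r \<oplus>\<^bsub>Q\<^esub> x \<cdot>\<^bsub>Q\<^esub> \<delta> r = \<phi> (d m)"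
  shows "y = z"
proof (rule eqI_filter)
  show "I \<inter> conductor R Q (\<phi> ` carrier M) x \<in> F"
    by (intro filter_Int I cokernel_torsion x)
  fix r assume "r \<in> I \<inter> conductor R Q (\<phi> ` carrier M) x"
  then obtain m where r: "r \<in> I" "r \<in> carrier R" and m: "m \<in> carrier M" "x \<cdot>\<^bsub>Q\<^esub> r = \<phi> m"
    by (auto simp: conductor_def)
  have "y \<cdot>\<^bsub>Q\<^esub> r \<oplus>\<^bsub>Q\<^esub> x \<cdot>\<^bsub>Q\<^esub> \<delta> r = z \<cdot>\<^bsub>Q\<^esub> r \<oplus>\<^bsub>Q\<^esub> x \<cdot>\<^bsub>Q\<^esub> \<delta> r"
    using y[OF r(1) m] z[OF r(1) m] by simp
  then show "y \<cdot>\<^bsub>Q\<^esub> r = z \<cdot>\<^bsub>Q\<^esub> r"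
    using assms r by simp
qed (use assms in simp_all)

text \<open>
  The prescription \<open>y + x (\<delta> r) = \<phi> (d m)\<close> for \<open>x r = \<phi> m\<close> respects sums, and it respects products with
  \<open>s\<close> in \<open>R\<close> because the terms \<open>x r (\<delta> s)\<close> and \<open>\<phi> (m (\<delta> s))\<close> from the two Leibniz rules agree.
\<close>

lemma extension_exists:
  assumes x: "x \<in> carrier Q"
  shows "\<exists>y\<in>carrier Q. \<forall>r\<in>carrier R. \<forall>m\<in>carrier M.
    x \<cdot>\<^bsub>Q\<^esub> r = \<phi> m \<longrightarrow> y \<cdot>\<^bsub>Q\<^esub> r \<oplus>\<^bsub>Q\<^esub> x \<cdot>\<^bsub>Q\<^esub> \<delta> r = \<phi> (d m)"
proof -
  let ?I = "conductor R Q (\<phi> ` carrier M) x"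
  let ?P = "\<lambda>r y. \<exists>m\<in>carrier M. x \<cdot>\<^bsub>Q\<^esub> r = \<phi> m \<and> y \<oplus>\<^bsub>Q\<^esub> x \<cdot>\<^bsub>Q\<^esub> \<delta> r = \<phi> (d m)"
  have R: "r \<in> carrier R" if "r \<in> ?I" for r
    using that by (simp add: conductor_def)
  obtain y where y: "y \<in> carrier Q" "\<And>r. r \<in> ?I \<Longrightarrow> ?P r (y \<cdot>\<^bsub>Q\<^esub> r)"
  proof (rule glue_relation[of ?I ?P])
    show "?I \<in> F"
      by (rule cokernel_torsion[OF x])
    fix r assume r: "r \<in> ?I"
    then obtain m where m: "m \<in> carrier M" "x \<cdot>\<^bsub>Q\<^esub> r = \<phi> m"
      by (auto simp: conductor_def)
    show "\<exists>y\<in>carrier Q. ?P r y"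
      using m R[OF r] x
      by (intro bexI[of _ "\<phi> (d m) \<ominus>\<^bsub>Q\<^esub> x \<cdot>\<^bsub>Q\<^esub> \<delta> r"] bexI[of _ m])
        (simp_all add: Q.M.minus_eq Q.M.a_assoc Q.M.l_neg)
  next
    fix r y z assume "r \<in> ?I" "y \<in> carrier Q" "z \<in> carrier Q"
    moreover assume "?P r y" "?P r z"
    then obtain m n where "m \<in> carrier M" "x \<cdot>\<^bsub>Q\<^esub> r = \<phi> m" "y \<oplus>\<^bsub>Q\<^esub> x \<cdot>\<^bsub>Q\<^esub> \<delta> r = \<phi> (d m)"
      "n \<in> carrier M" "x \<cdot>\<^bsub>Q\<^esub> r = \<phi> n" "z \<oplus>\<^bsub>Q\<^esub> x \<cdot>\<^bsub>Q\<^esub> \<delta> r = \<phi> (d n)"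
      by blast
    then have "y \<oplus>\<^bsub>Q\<^esub> x \<cdot>\<^bsub>Q\<^esub> \<delta> r = z \<oplus>\<^bsub>Q\<^esub> x \<cdot>\<^bsub>Q\<^esub> \<delta> r"
      using \<phi>_d_cong[of m n] by simp
    ultimately show "y = z"
      using x R by simp
  next
    fix r s y z assume r: "r \<in> ?I" "s \<in> ?I" and y: "y \<in> carrier Q" "z \<in> carrier Q"
    assume "?P r y" "?P s z"
    then obtain m n where m: "m \<in> carrier M" "x \<cdot>\<^bsub>Q\<^esub> r = \<phi> m"
      "y \<oplus>\<^bsub>Q\<^esub> x \<cdot>\<^bsub>Q\<^esub> \<delta> r = \<phi> (d m)"
      "n \<in> carrier M" "x \<cdot>\<^bsub>Q\<^esub> s = \<phi> n" "z \<oplus>\<^bsub>Q\<^esub> x \<cdot>\<^bsub>Q\<^esub> \<delta> s = \<phi> (d n)"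
      by blast
    have "(y \<oplus>\<^bsub>Q\<^esub> z) \<oplus>\<^bsub>Q\<^esub> x \<cdot>\<^bsub>Q\<^esub> \<delta> (r \<oplus> s)
        = (y \<oplus>\<^bsub>Q\<^esub> x \<cdot>\<^bsub>Q\<^esub> \<delta> r) \<oplus>\<^bsub>Q\<^esub> (z \<oplus>\<^bsub>Q\<^esub> x \<cdot>\<^bsub>Q\<^esub> \<delta> s)"
      using R[OF r(1)] R[OF r(2)] x y by (simp add: \<delta>_add Q.ract_add_right Q.M.a_ac)
    then show "?P (r \<oplus> s) (y \<oplus>\<^bsub>Q\<^esub> z)"
      using m x R[OF r(1)] R[OF r(2)]
      by (intro bexI[of _ "m \<oplus>\<^bsub>M\<^esub> n"]) (simp_all add: \<phi>_add d_add Q.ract_add_right)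
  next
    fix r s y assume r: "r \<in> ?I" "s \<in> carrier R" and y: "y \<in> carrier Q"
    assume "?P r y"
    then obtain m where m: "m \<in> carrier M" "x \<cdot>\<^bsub>Q\<^esub> r = \<phi> m" "y \<oplus>\<^bsub>Q\<^esub> x \<cdot>\<^bsub>Q\<^esub> \<delta> r = \<phi> (d m)"
      by blast
    have "y \<cdot>\<^bsub>Q\<^esub> s \<oplus>\<^bsub>Q\<^esub> x \<cdot>\<^bsub>Q\<^esub> \<delta> (r \<otimes> s)
        = (y \<oplus>\<^bsub>Q\<^esub> x \<cdot>\<^bsub>Q\<^esub> \<delta> r) \<cdot>\<^bsub>Q\<^esub> s \<oplus>\<^bsub>Q\<^esub> (x \<cdot>\<^bsub>Q\<^esub> r) \<cdot>\<^bsub>Q\<^esub> \<delta> s"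
      using R[OF r(1)] r(2) x y
      by (simp add: \<delta>_mult Q.ract_add_right Q.ract_add_left Q.ract_mult Q.M.a_assoc)
    then show "?P (r \<otimes> s) (y \<cdot>\<^bsub>Q\<^esub> s)"
      using m x R[OF r(1)] r(2)
      by (intro bexI[of _ "m \<cdot>\<^bsub>M\<^esub> s"]) (simp_all add: \<phi>_add d_ract \<phi>_ract Q.ract_mult)
  qed blast
  have "y \<cdot>\<^bsub>Q\<^esub> r \<oplus>\<^bsub>Q\<^esub> x \<cdot>\<^bsub>Q\<^esub> \<delta> r = \<phi> (d m)"
    if "r \<in> carrier R" "m \<in> carrier M" "x \<cdot>\<^bsub>Q\<^esub> r = \<phi> m" for r m
  proof -
    have "r \<in> ?I"
      using that by (auto simp: conductor_def)
    then obtain n where "n \<in> carrier M" "x \<cdot>\<^bsub>Q\<^esub> r = \<phi> n"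
      "y \<cdot>\<^bsub>Q\<^esub> r \<oplus>\<^bsub>Q\<^esub> x \<cdot>\<^bsub>Q\<^esub> \<delta> r = \<phi> (d n)"
      using y(2) by blast
    then show ?thesis
      using that \<phi>_d_cong[of m n] by simp
  qed
  then show ?thesis
    using y(1) by blast
qed

lemma extension_spec:
  assumes x: "x \<in> carrier Q"
  shows "extension x \<in> carrier Q \<and> (\<forall>r\<in>carrier R. \<forall>m\<in>carrier M.
    x \<cdot>\<^bsub>Q\<^esub> r = \<phi> m \<longrightarrow> extension x \<cdot>\<^bsub>Q\<^esub> r \<oplus>\<^bsub>Q\<^esub> x \<cdot>\<^bsub>Q\<^esub> \<delta> r = \<phi> (d m))"
  unfolding extended_derivation_def
proof (rule theI', rule ex_ex1I)
  show "\<exists>y. y \<in> carrier Q \<and> (\<forall>r\<in>carrier R. \<forall>m\<in>carrier M.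
    x \<cdot>\<^bsub>Q\<^esub> r = \<phi> m \<longrightarrow> y \<cdot>\<^bsub>Q\<^esub> r \<oplus>\<^bsub>Q\<^esub> x \<cdot>\<^bsub>Q\<^esub> \<delta> r = \<phi> (d m))"
    using extension_exists[OF x] by (simp only: Bex_def)
qed (rule extension_unique[OF x _ _ carrier_in_filter], simp_all)

lemma extension_closed [simp]: "x \<in> carrier Q \<Longrightarrow> extension x \<in> carrier Q"
  using extension_spec by blast

lemma extension_ract:
  "\<lbrakk>x \<in> carrier Q; r \<in> carrier R; m \<in> carrier M; x \<cdot>\<^bsub>Q\<^esub> r = \<phi> m\<rbrakk>
    \<Longrightarrow> extension x \<cdot>\<^bsub>Q\<^esub> r \<oplus>\<^bsub>Q\<^esub> x \<cdot>\<^bsub>Q\<^esub> \<delta> r = \<phi> (d m)"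
  using extension_spec by blast

lemma extension_eqI:
  assumes "x \<in> carrier Q" "y \<in> carrier Q" "I \<in> F"
    and "\<And>r m. \<lbrakk>r \<in> I; m \<in> carrier M; x \<cdot>\<^bsub>Q\<^esub> r = \<phi> m\<rbrakk>
        \<Longrightarrow> y \<cdot>\<^bsub>Q\<^esub> r \<oplus>\<^bsub>Q\<^esub> x \<cdot>\<^bsub>Q\<^esub> \<delta> r = \<phi> (d m)"
  shows "extension x = y"
  using assms right_idealD(1)[OF filter_right_ideal[OF \<open>I \<in> F\<close>]]
  by (intro extension_unique[of x _ y I] extension_ract) auto

lemma extension_\<phi>:
  assumes m: "m \<in> carrier M"
  shows "extension (\<phi> m) = \<phi> (d m)"
proof (rule extension_eqI[OF _ _ carrier_in_filter])
  fix r n assume r: "r \<in> carrier R" "n \<in> carrier M" "\<phi> m \<cdot>\<^bsub>Q\<^esub> r = \<phi> n"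
  then have "\<phi> (d n) = \<phi> (d (m \<cdot>\<^bsub>M\<^esub> r))"
    using m by (intro \<phi>_d_cong) (simp_all add: \<phi>_ract)
  then show "\<phi> (d m) \<cdot>\<^bsub>Q\<^esub> r \<oplus>\<^bsub>Q\<^esub> \<phi> m \<cdot>\<^bsub>Q\<^esub> \<delta> r = \<phi> (d n)"
    using r m by (simp add: d_ract \<phi>_add \<phi>_ract)
qed (use m in simp_all)

lemma extension_add:
  assumes x: "x \<in> carrier Q" and y: "y \<in> carrier Q"
  shows "extension (x \<oplus>\<^bsub>Q\<^esub> y) = extension x \<oplus>\<^bsub>Q\<^esub> extension y"
proof (rule extension_eqI)
  show "conductor R Q (\<phi> ` carrier M) x \<inter> conductor R Q (\<phi> ` carrier M) y \<in> F"
    using assms by (intro filter_Int cokernel_torsion)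
  fix r m assume "r \<in> conductor R Q (\<phi> ` carrier M) x \<inter> conductor R Q (\<phi> ` carrier M) y"
    and m: "m \<in> carrier M" "(x \<oplus>\<^bsub>Q\<^esub> y) \<cdot>\<^bsub>Q\<^esub> r = \<phi> m"
  then obtain a b where r: "r \<in> carrier R" and a: "a \<in> carrier M" "x \<cdot>\<^bsub>Q\<^esub> r = \<phi> a"
    and b: "b \<in> carrier M" "y \<cdot>\<^bsub>Q\<^esub> r = \<phi> b"
    by (auto simp: conductor_def)
  have "(extension x \<oplus>\<^bsub>Q\<^esub> extension y) \<cdot>\<^bsub>Q\<^esub> r \<oplus>\<^bsub>Q\<^esub> (x \<oplus>\<^bsub>Q\<^esub> y) \<cdot>\<^bsub>Q\<^esub> \<delta> r
      = (extension x \<cdot>\<^bsub>Q\<^esub> r \<oplus>\<^bsub>Q\<^esub> x \<cdot>\<^bsub>Q\<^esub> \<delta> r) \<oplus>\<^bsub>Q\<^esub> (extension y \<cdot>\<^bsub>Q\<^esub> r \<oplus>\<^bsub>Q\<^esub> y \<cdot>\<^bsub>Q\<^esub> \<delta> r)"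
    using x y r by (simp add: Q.ract_add_left Q.M.a_ac)
  also have "\<dots> = \<phi> (d (a \<oplus>\<^bsub>M\<^esub> b))"
    using a b by (simp add: extension_ract[OF x r a] extension_ract[OF y r b] d_add \<phi>_add)
  also have "\<dots> = \<phi> (d m)"
    using a b m r x y by (intro \<phi>_d_cong) (simp_all add: \<phi>_add Q.ract_add_left)
  finally show "(extension x \<oplus>\<^bsub>Q\<^esub> extension y) \<cdot>\<^bsub>Q\<^esub> r \<oplus>\<^bsub>Q\<^esub> (x \<oplus>\<^bsub>Q\<^esub> y) \<cdot>\<^bsub>Q\<^esub> \<delta> r = \<phi> (d m)" .
qed (use assms in simp_all)

lemma extension_Leibniz:
  assumes x: "x \<in> carrier Q" and s: "s \<in> carrier R"
  shows "extension (x \<cdot>\<^bsub>Q\<^esub> s) = extension x \<cdot>\<^bsub>Q\<^esub> s \<oplus>\<^bsub>Q\<^esub> x \<cdot>\<^bsub>Q\<^esub> \<delta> s"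
proof (rule extension_eqI[OF _ _ carrier_in_filter])
  fix r m assume r: "r \<in> carrier R" and m: "m \<in> carrier M" "(x \<cdot>\<^bsub>Q\<^esub> s) \<cdot>\<^bsub>Q\<^esub> r = \<phi> m"
  have "(extension x \<cdot>\<^bsub>Q\<^esub> s \<oplus>\<^bsub>Q\<^esub> x \<cdot>\<^bsub>Q\<^esub> \<delta> s) \<cdot>\<^bsub>Q\<^esub> r \<oplus>\<^bsub>Q\<^esub> (x \<cdot>\<^bsub>Q\<^esub> s) \<cdot>\<^bsub>Q\<^esub> \<delta> r
      = extension x \<cdot>\<^bsub>Q\<^esub> (s \<otimes> r) \<oplus>\<^bsub>Q\<^esub> x \<cdot>\<^bsub>Q\<^esub> \<delta> (s \<otimes> r)"
    using x s r by (simp add: Q.ract_add_left Q.ract_add_right Q.ract_mult \<delta>_mult Q.M.a_assoc)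
  also have "\<dots> = \<phi> (d m)"
    using x s r m by (intro extension_ract) (simp_all add: Q.ract_mult)
  finally show "(extension x \<cdot>\<^bsub>Q\<^esub> s \<oplus>\<^bsub>Q\<^esub> x \<cdot>\<^bsub>Q\<^esub> \<delta> s) \<cdot>\<^bsub>Q\<^esub> r \<oplus>\<^bsub>Q\<^esub> (x \<cdot>\<^bsub>Q\<^esub> s) \<cdot>\<^bsub>Q\<^esub> \<delta> r = \<phi> (d m)" .
qed (use assms in simp_all)

lemma extension_module_derivation: "module_derivation R \<delta> Q extension"
  by (simp add: module_derivation_def extension_add extension_Leibniz)

lemma derivation_eq_extension:
  assumes d': "module_derivation R \<delta> Q d'" "\<And>m. m \<in> carrier M \<Longrightarrow> d' (\<phi> m) = \<phi> (d m)"
    and x: "x \<in> carrier Q"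
  shows "d' x = extension x"
proof (rule sym, rule extension_eqI[OF x _ carrier_in_filter])
  show "d' x \<in> carrier Q"
    using d'(1) x by (auto simp: module_derivation_def)
  fix r m assume r: "r \<in> carrier R" "m \<in> carrier M" "x \<cdot>\<^bsub>Q\<^esub> r = \<phi> m"
  have "d' (x \<cdot>\<^bsub>Q\<^esub> r) = d' x \<cdot>\<^bsub>Q\<^esub> r \<oplus>\<^bsub>Q\<^esub> x \<cdot>\<^bsub>Q\<^esub> \<delta> r"
    using d'(1) x r(1) by (simp add: module_derivation_def)
  then show "d' x \<cdot>\<^bsub>Q\<^esub> r \<oplus>\<^bsub>Q\<^esub> x \<cdot>\<^bsub>Q\<^esub> \<delta> r = \<phi> (d m)"
    using d'(2) r by simp
qed

end


section \<open>The action of the ring of quotients\<close>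

text \<open>
  For \<open>Q = A\<close> this is the multiplication of the ring of quotients, in general its action on \<open>Q\<close>.
\<close>

definition scalar_action ::
  "('r, 'x) ring_scheme \<Rightarrow> ('r, 'e, 'z) rmodule_scheme \<Rightarrow> ('r, 'q, 'w) rmodule_scheme \<Rightarrow>
   ('r \<Rightarrow> 'q) \<Rightarrow> 'e \<Rightarrow> 'q \<Rightarrow> 'e" where
  "scalar_action R Q A \<alpha> x q =
     (THE y. y \<in> carrier Q \<and> (\<forall>r\<in>carrier R. \<forall>a\<in>carrier R.
        q \<cdot>\<^bsub>A\<^esub> r = \<alpha> a \<longrightarrow> y \<cdot>\<^bsub>Q\<^esub> r = x \<cdot>\<^bsub>Q\<^esub> a))"

definition quotient_ring ::
  "('r, 'x) ring_scheme \<Rightarrow> ('r, 'q, 'w) rmodule_scheme \<Rightarrow> ('r \<Rightarrow> 'q) \<Rightarrow> 'q ring" where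
  "quotient_ring R A \<alpha> = \<lparr>carrier = carrier A, monoid.mult = scalar_action R A A \<alpha>,
     one = \<alpha> \<one>\<^bsub>R\<^esub>, ring.zero = \<zero>\<^bsub>A\<^esub>, add = add A\<rparr>"

definition over_quotient_ring ::
  "('r, 'x) ring_scheme \<Rightarrow> ('r, 'e, 'z) rmodule_scheme \<Rightarrow> ('r, 'q, 'w) rmodule_scheme \<Rightarrow>
   ('r \<Rightarrow> 'q) \<Rightarrow> ('q, 'e) rmodule" where
  "over_quotient_ring R Q A \<alpha> = \<lparr>carrier = carrier Q, monoid.mult = undefined,
     one = undefined, ring.zero = \<zero>\<^bsub>Q\<^esub>, add = add Q, ract = scalar_action R Q A \<alpha>\<rparr>"

lemma quotient_ring_simps [simp]:
  "carrier (quotient_ring R A \<alpha>) = carrier A" "add (quotient_ring R A \<alpha>) = add A"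
  "\<zero>\<^bsub>quotient_ring R A \<alpha>\<^esub> = \<zero>\<^bsub>A\<^esub>" "\<one>\<^bsub>quotient_ring R A \<alpha>\<^esub> = \<alpha> \<one>\<^bsub>R\<^esub>"
  "monoid.mult (quotient_ring R A \<alpha>) = scalar_action R A A \<alpha>"
  by (simp_all add: quotient_ring_def)

lemma over_quotient_ring_simps [simp]:
  "carrier (over_quotient_ring R Q A \<alpha>) = carrier Q"
  "add (over_quotient_ring R Q A \<alpha>) = add Q"
  "\<zero>\<^bsub>over_quotient_ring R Q A \<alpha>\<^esub> = \<zero>\<^bsub>Q\<^esub>"
  "ract (over_quotient_ring R Q A \<alpha>) = scalar_action R Q A \<alpha>"
  by (simp_all add: over_quotient_ring_def)

locale quotient_action = quotient_module R F M Q \<phi>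
    + A: quotient_module R F "regular_rmodule R" A \<alpha>
  for R :: "('r, 'x) ring_scheme" (structure) and F :: "'r set set"
    and M :: "('r, 'm, 'y) rmodule_scheme" and Q :: "('r, 'e, 'z) rmodule_scheme"
    and \<phi> :: "'m \<Rightarrow> 'e" and A :: "('r, 'q, 'w) rmodule_scheme" and \<alpha> :: "'r \<Rightarrow> 'q"
begin

lemma \<alpha>_closed [simp]: "r \<in> carrier R \<Longrightarrow> \<alpha> r \<in> carrier A"
  and \<alpha>_add: "\<lbrakk>r \<in> carrier R; s \<in> carrier R\<rbrakk> \<Longrightarrow> \<alpha> (r \<oplus> s) = \<alpha> r \<oplus>\<^bsub>A\<^esub> \<alpha> s"
  and \<alpha>_mult: "\<lbrakk>r \<in> carrier R; s \<in> carrier R\<rbrakk> \<Longrightarrow> \<alpha> (r \<otimes> s) = \<alpha> r \<cdot>\<^bsub>A\<^esub> s"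
  using A.\<phi>_closed[of r] A.\<phi>_add[of r s] A.\<phi>_ract[of r s] by simp_all

abbreviation fractional :: "'q \<Rightarrow> 'r set" where
  "fractional q \<equiv> conductor R A (\<alpha> ` carrier R) q"

lemma fractional_filter: "q \<in> carrier A \<Longrightarrow> fractional q \<in> F"
  using A.cokernel_torsion by simp

text \<open>
  Torsion elements of \<open>R\<close> act as zero on \<open>Q\<close>, since their products with \<open>x\<close> are torsion. Hence \<open>x a\<close>
  depends only on \<open>\<alpha> a\<close>, so that the prescription \<open>(x q) r = x a\<close> for \<open>q r = \<alpha> a\<close> is consistent.
\<close>

lemma ract_kernel:
  assumes x: "x \<in> carrier Q" and a: "a \<in> carrier R" "\<alpha> a = \<zero>\<^bsub>A\<^esub>"
  shows "x \<cdot>\<^bsub>Q\<^esub> a = \<zero>\<^bsub>Q\<^esub>"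
proof (rule torsion_free)
  have "annihilator R (regular_rmodule R) a \<subseteq> annihilator R Q (x \<cdot>\<^bsub>Q\<^esub> a)"
    using x a by (auto simp: annihilator_def Q.ract_mult[symmetric])
  then show "annihilator R Q (x \<cdot>\<^bsub>Q\<^esub> a) \<in> F"
    using A.kernel_torsion[of a] x a Q.annihilator_right_ideal[of "x \<cdot>\<^bsub>Q\<^esub> a"]
    by (simp add: filter_mono)
qed (use x a in simp)

lemma ract_cong:
  assumes x: "x \<in> carrier Q" and ab: "a \<in> carrier R" "b \<in> carrier R" "\<alpha> a = \<alpha> b"
  shows "x \<cdot>\<^bsub>Q\<^esub> a = x \<cdot>\<^bsub>Q\<^esub> b"
proof -
  have "\<alpha> (a \<ominus> b) \<oplus>\<^bsub>A\<^esub> \<alpha> b = \<alpha> a"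
    using ab by (simp add: \<alpha>_add[symmetric] minus_eq a_assoc l_neg)
  then have "\<alpha> (a \<ominus> b) = \<zero>\<^bsub>A\<^esub>"
    using ab A.Q.M.add.r_cancel_one[of "\<alpha> b" "\<alpha> (a \<ominus> b)"] by simp
  then have "x \<cdot>\<^bsub>Q\<^esub> (a \<ominus> b) = \<zero>\<^bsub>Q\<^esub>"
    using x ab by (intro ract_kernel) auto
  moreover have "x \<cdot>\<^bsub>Q\<^esub> a = x \<cdot>\<^bsub>Q\<^esub> (a \<ominus> b) \<oplus>\<^bsub>Q\<^esub> x \<cdot>\<^bsub>Q\<^esub> b"
    using x ab by (simp add: Q.ract_add_right[symmetric] minus_eq a_assoc l_neg)
  ultimately show ?thesis
    using x ab by simp
qed

abbreviation act :: "'e \<Rightarrow> 'q \<Rightarrow> 'e" where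
  "act \<equiv> scalar_action R Q A \<alpha>"

lemma act_unique:
  assumes q: "q \<in> carrier A" and y: "y \<in> carrier Q" "z \<in> carrier Q" and I: "I \<in> F"
    and "\<And>r a. \<lbrakk>r \<in> I; a \<in> carrier R; q \<cdot>\<^bsub>A\<^esub> r = \<alpha> a\<rbrakk> \<Longrightarrow> y \<cdot>\<^bsub>Q\<^esub> r = x \<cdot>\<^bsub>Q\<^esub> a"
    and "\<And>r a. \<lbrakk>r \<in> I; a \<in> carrier R; q \<cdot>\<^bsub>A\<^esub> r = \<alpha> a\<rbrakk> \<Longrightarrow> z \<cdot>\<^bsub>Q\<^esub> r = x \<cdot>\<^bsub>Q\<^esub> a"
  shows "y = z"
proof (rule eqI_filter)
  show "I \<inter> fractional q \<in> F"
    by (intro filter_Int I fractional_filter q)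
qed (use assms in \<open>auto simp: conductor_def\<close>)

lemma act_exists:
  assumes x: "x \<in> carrier Q" and q: "q \<in> carrier A"
  shows "\<exists>y\<in>carrier Q. \<forall>r\<in>carrier R. \<forall>a\<in>carrier R.
    q \<cdot>\<^bsub>A\<^esub> r = \<alpha> a \<longrightarrow> y \<cdot>\<^bsub>Q\<^esub> r = x \<cdot>\<^bsub>Q\<^esub> a"
proof -
  let ?P = "\<lambda>r y. \<exists>a\<in>carrier R. q \<cdot>\<^bsub>A\<^esub> r = \<alpha> a \<and> y = x \<cdot>\<^bsub>Q\<^esub> a"
  have R: "r \<in> carrier R" if "r \<in> fractional q" for r
    using that by (simp add: conductor_def)
  obtain y where y: "y \<in> carrier Q" "\<And>r. r \<in> fractional q \<Longrightarrow> ?P r (y \<cdot>\<^bsub>Q\<^esub> r)"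
  proof (rule glue_relation[of "fractional q" ?P])
    show "fractional q \<in> F"
      by (rule fractional_filter[OF q])
    fix r assume r: "r \<in> fractional q"
    then show "\<exists>y\<in>carrier Q. ?P r y"
      using x by (auto simp: conductor_def)
  next
    fix r y z assume "?P r y" "?P r z"
    then show "y = z"
      using ract_cong[OF x] by metis
  next
    fix r s y z assume r: "r \<in> fractional q" "s \<in> fractional q" and "?P r y" "?P s z"
    then obtain a b where "a \<in> carrier R" "q \<cdot>\<^bsub>A\<^esub> r = \<alpha> a" "y = x \<cdot>\<^bsub>Q\<^esub> a"
      "b \<in> carrier R" "q \<cdot>\<^bsub>A\<^esub> s = \<alpha> b" "z = x \<cdot>\<^bsub>Q\<^esub> b"
      by blast
    then show "?P (r \<oplus> s) (y \<oplus>\<^bsub>Q\<^esub> z)"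
      using x q R[OF r(1)] R[OF r(2)]
      by (intro bexI[of _ "a \<oplus> b"]) (simp_all add: A.Q.ract_add_right Q.ract_add_right \<alpha>_add)
  next
    fix r s y assume r: "r \<in> fractional q" and s: "s \<in> carrier R" and "?P r y"
    then obtain a where "a \<in> carrier R" "q \<cdot>\<^bsub>A\<^esub> r = \<alpha> a" "y = x \<cdot>\<^bsub>Q\<^esub> a"
      by blast
    then show "?P (r \<otimes> s) (y \<cdot>\<^bsub>Q\<^esub> s)"
      using x q s R[OF r]
      by (intro bexI[of _ "a \<otimes> s"]) (simp_all add: A.Q.ract_mult Q.ract_mult \<alpha>_mult)
  qed blast
  have "y \<cdot>\<^bsub>Q\<^esub> r = x \<cdot>\<^bsub>Q\<^esub> a" if "r \<in> carrier R" "a \<in> carrier R" "q \<cdot>\<^bsub>A\<^esub> r = \<alpha> a" for r a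
  proof -
    have "r \<in> fractional q"
      using that by (auto simp: conductor_def)
    then obtain b where "b \<in> carrier R" "q \<cdot>\<^bsub>A\<^esub> r = \<alpha> b" "y \<cdot>\<^bsub>Q\<^esub> r = x \<cdot>\<^bsub>Q\<^esub> b"
      using y(2) by blast
    then show ?thesis
      using that ract_cong[OF x, of b a] by simp
  qed
  then show ?thesis
    using y(1) by blast
qed

lemma act_spec:
  assumes x: "x \<in> carrier Q" and q: "q \<in> carrier A"
  shows "act x q \<in> carrier Q \<and> (\<forall>r\<in>carrier R. \<forall>a\<in>carrier R.
    q \<cdot>\<^bsub>A\<^esub> r = \<alpha> a \<longrightarrow> act x q \<cdot>\<^bsub>Q\<^esub> r = x \<cdot>\<^bsub>Q\<^esub> a)"
  unfolding scalar_action_def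
proof (rule theI', rule ex_ex1I)
  show "\<exists>y. y \<in> carrier Q \<and> (\<forall>r\<in>carrier R. \<forall>a\<in>carrier R.
    q \<cdot>\<^bsub>A\<^esub> r = \<alpha> a \<longrightarrow> y \<cdot>\<^bsub>Q\<^esub> r = x \<cdot>\<^bsub>Q\<^esub> a)"
    using act_exists[OF x q] by (simp only: Bex_def)
qed (rule act_unique[OF q _ _ carrier_in_filter, of _ _ x], simp_all)

lemma act_closed [simp]: "\<lbrakk>x \<in> carrier Q; q \<in> carrier A\<rbrakk> \<Longrightarrow> act x q \<in> carrier Q"
  using act_spec by blast

lemma act_ract:
  "\<lbrakk>x \<in> carrier Q; q \<in> carrier A; r \<in> carrier R; a \<in> carrier R; q \<cdot>\<^bsub>A\<^esub> r = \<alpha> a\<rbrakk>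
    \<Longrightarrow> act x q \<cdot>\<^bsub>Q\<^esub> r = x \<cdot>\<^bsub>Q\<^esub> a"
  using act_spec by blast

lemma act_eqI:
  assumes "x \<in> carrier Q" "q \<in> carrier A" "y \<in> carrier Q" "I \<in> F"
    and "\<And>r a. \<lbrakk>r \<in> I; a \<in> carrier R; q \<cdot>\<^bsub>A\<^esub> r = \<alpha> a\<rbrakk> \<Longrightarrow> y \<cdot>\<^bsub>Q\<^esub> r = x \<cdot>\<^bsub>Q\<^esub> a"
  shows "act x q = y"
  using assms right_idealD(1)[OF filter_right_ideal[OF \<open>I \<in> F\<close>]]
  by (intro act_unique[of q _ y I x] act_ract) auto

lemma act_add_left:
  assumes "x \<in> carrier Q" "y \<in> carrier Q" "q \<in> carrier A"
  shows "act (x \<oplus>\<^bsub>Q\<^esub> y) q = act x q \<oplus>\<^bsub>Q\<^esub> act y q"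
proof (rule act_eqI[OF _ _ _ carrier_in_filter])
  fix r a assume "r \<in> carrier R" "a \<in> carrier R" "q \<cdot>\<^bsub>A\<^esub> r = \<alpha> a"
  then show "(act x q \<oplus>\<^bsub>Q\<^esub> act y q) \<cdot>\<^bsub>Q\<^esub> r = (x \<oplus>\<^bsub>Q\<^esub> y) \<cdot>\<^bsub>Q\<^esub> a"
    using assms by (simp add: Q.ract_add_left act_ract)
qed (use assms in simp_all)

text \<open>
  The equation is compared on those \<open>r\<close> for which \<open>p r\<close> and \<open>q r\<close> both come from \<open>R\<close>, with preimages
  \<open>b\<close> and \<open>c\<close>; a given preimage \<open>a\<close> of \<open>(p + q) r\<close> may differ from \<open>b + c\<close> by torsion.
\<close>

lemma act_add_right:
  assumes x: "x \<in> carrier Q" and p: "p \<in> carrier A" and q: "q \<in> carrier A"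
  shows "act x (p \<oplus>\<^bsub>A\<^esub> q) = act x p \<oplus>\<^bsub>Q\<^esub> act x q"
proof (rule act_eqI)
  show "fractional p \<inter> fractional q \<in> F"
    using p q by (intro filter_Int fractional_filter)
  fix r a assume "r \<in> fractional p \<inter> fractional q"
    and a: "a \<in> carrier R" "(p \<oplus>\<^bsub>A\<^esub> q) \<cdot>\<^bsub>A\<^esub> r = \<alpha> a"
  then obtain b c where r: "r \<in> carrier R" and b: "b \<in> carrier R" "p \<cdot>\<^bsub>A\<^esub> r = \<alpha> b"
    and c: "c \<in> carrier R" "q \<cdot>\<^bsub>A\<^esub> r = \<alpha> c"
    by (auto simp: conductor_def)
  have "(act x p \<oplus>\<^bsub>Q\<^esub> act x q) \<cdot>\<^bsub>Q\<^esub> r = x \<cdot>\<^bsub>Q\<^esub> (b \<oplus> c)"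
    using x p q r b c by (simp add: Q.ract_add_left Q.ract_add_right act_ract)
  also have "\<dots> = x \<cdot>\<^bsub>Q\<^esub> a"
    using x p q r a b c by (intro ract_cong) (simp_all add: \<alpha>_add A.Q.ract_add_left)
  finally show "(act x p \<oplus>\<^bsub>Q\<^esub> act x q) \<cdot>\<^bsub>Q\<^esub> r = x \<cdot>\<^bsub>Q\<^esub> a" .
qed (use assms in simp_all)

lemma act_\<alpha>:
  assumes x: "x \<in> carrier Q" and b: "b \<in> carrier R"
  shows "act x (\<alpha> b) = x \<cdot>\<^bsub>Q\<^esub> b"
proof (rule act_eqI[OF _ _ _ carrier_in_filter])
  fix r a assume r: "r \<in> carrier R" "a \<in> carrier R" "\<alpha> b \<cdot>\<^bsub>A\<^esub> r = \<alpha> a"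
  then have "x \<cdot>\<^bsub>Q\<^esub> (b \<otimes> r) = x \<cdot>\<^bsub>Q\<^esub> a"
    using x b by (intro ract_cong) (simp_all add: \<alpha>_mult)
  then show "(x \<cdot>\<^bsub>Q\<^esub> b) \<cdot>\<^bsub>Q\<^esub> r = x \<cdot>\<^bsub>Q\<^esub> a"
    using x b r by (simp add: Q.ract_mult)
qed (use assms in simp_all)

lemma act_one: "x \<in> carrier Q \<Longrightarrow> act x (\<alpha> \<one>) = x"
  by (simp add: act_\<alpha> Q.ract_one)

lemma act_ract_assoc:
  assumes x: "x \<in> carrier Q" and q: "q \<in> carrier A" and r: "r \<in> carrier R"
  shows "act x (q \<cdot>\<^bsub>A\<^esub> r) = act x q \<cdot>\<^bsub>Q\<^esub> r"
proof (rule act_eqI[OF _ _ _ carrier_in_filter])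
  fix s a assume s: "s \<in> carrier R" "a \<in> carrier R" "(q \<cdot>\<^bsub>A\<^esub> r) \<cdot>\<^bsub>A\<^esub> s = \<alpha> a"
  then have "act x q \<cdot>\<^bsub>Q\<^esub> (r \<otimes> s) = x \<cdot>\<^bsub>Q\<^esub> a"
    using x q r by (intro act_ract) (simp_all add: A.Q.ract_mult)
  then show "(act x q \<cdot>\<^bsub>Q\<^esub> r) \<cdot>\<^bsub>Q\<^esub> s = x \<cdot>\<^bsub>Q\<^esub> a"
    using x q r s by (simp add: Q.ract_mult)
qed (use assms in simp_all)

end

text \<open>
  The case \<open>M = R\<close>, so that the facts on the action also describe the multiplication in the ring of
  quotients.
\<close>

sublocale quotient_action \<subseteq> A: quotient_action R F "regular_rmodule R" A \<alpha> A \<alpha>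
  by unfold_locales

context quotient_action
begin

text \<open>
  If \<open>q r = \<alpha> a\<close>, then both sides multiplied by \<open>r\<close> are equal to \<open>x (p a)\<close>.
\<close>

lemma act_assoc:
  assumes x: "x \<in> carrier Q" and p: "p \<in> carrier A" and q: "q \<in> carrier A"
  shows "act x (scalar_action R A A \<alpha> p q) = act (act x p) q"
proof (rule sym, rule act_eqI[OF _ _ _ carrier_in_filter])
  fix r a assume r: "r \<in> carrier R" "a \<in> carrier R" "q \<cdot>\<^bsub>A\<^esub> r = \<alpha> a"
  have "act x (scalar_action R A A \<alpha> p q) \<cdot>\<^bsub>Q\<^esub> r = act x (scalar_action R A A \<alpha> p q \<cdot>\<^bsub>A\<^esub> r)"
    using x p q r by (simp add: act_ract_assoc)
  also have "\<dots> = act x p \<cdot>\<^bsub>Q\<^esub> a"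
    using x p q r by (simp add: A.act_ract act_ract_assoc)
  finally show "act x (scalar_action R A A \<alpha> p q) \<cdot>\<^bsub>Q\<^esub> r = act x p \<cdot>\<^bsub>Q\<^esub> a" .
qed (use assms in simp_all)

end

text \<open>The context is reopened to make \<open>act_assoc\<close> available for \<open>A\<close> in place of \<open>Q\<close>.\<close>

context quotient_action
begin

abbreviation S :: "'q ring" where
  "S \<equiv> quotient_ring R A \<alpha>"

lemma one_act:
  assumes q: "q \<in> carrier A"
  shows "scalar_action R A A \<alpha> (\<alpha> \<one>) q = q"
proof (rule A.act_eqI[OF _ _ _ carrier_in_filter])
  fix r a assume r: "r \<in> carrier R" "a \<in> carrier R" "q \<cdot>\<^bsub>A\<^esub> r = \<alpha> a"
  then show "q \<cdot>\<^bsub>A\<^esub> r = \<alpha> \<one> \<cdot>\<^bsub>A\<^esub> a"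
    by (simp add: \<alpha>_mult[symmetric])
qed (use q in simp_all)

lemma quotient_ring: "ring S"
proof (rule ringI)
  show "abelian_group S"
    by (rule abelian_group_cong[OF A.Q.M.abelian_group_axioms]) simp_all
  show "monoid S"
    by (rule monoidI) (simp_all add: A.act_one one_act A.act_assoc)
qed (simp_all add: A.act_add_left A.act_add_right)

lemma over_quotient_ring: "right_module S (over_quotient_ring R Q A \<alpha>)"
proof (intro right_module.intro right_module_axioms.intro quotient_ring)
  show "abelian_group (over_quotient_ring R Q A \<alpha>)"
    by (rule abelian_group_cong[OF Q.M.abelian_group_axioms]) simp_all
qed (simp_all add: act_one act_assoc act_add_left act_add_right)

lemma \<alpha>_ring_hom: "\<alpha> \<in> ring_hom R S"
  by (rule ring_hom_memI) (simp_all add: \<alpha>_add \<alpha>_mult A.act_\<alpha>)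

end

section \<open>The Leibniz rule over the ring of quotients\<close>

locale quotient_action_derivation = quotient_action R F M Q \<phi> A \<alpha>
    + quotient_module_derivation R F M Q \<phi> \<delta> d
  for R :: "('r, 'x) ring_scheme" (structure) and F :: "'r set set"
    and M :: "('r, 'm, 'y) rmodule_scheme" and Q :: "('r, 'e, 'z) rmodule_scheme"
    and \<phi> :: "'m \<Rightarrow> 'e" and A :: "('r, 'q, 'w) rmodule_scheme" and \<alpha> :: "'r \<Rightarrow> 'q"
    and \<delta> :: "'r \<Rightarrow> 'r" and d :: "'m \<Rightarrow> 'm"

sublocale quotient_action_derivation \<subseteq>
  A: quotient_module_derivation R F "regular_rmodule R" A \<alpha> \<delta> \<delta>
  using ring_derivation
  by unfold_locales (auto simp: derivation_def module_derivation_def)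

context quotient_action_derivation
begin

text \<open>
  For \<open>q r = \<alpha> a\<close> and \<open>x a = \<phi> m\<close>, multiplying the right hand side by \<open>r\<close> and adding \<open>x (q (\<delta> r))\<close> gives
  \<open>d x a + x (\<delta> q r + q (\<delta> r)) = d x a + x (\<delta> a) = \<phi> (d m)\<close>, which is the equation that determines
  \<open>d (x q)\<close>.
\<close>

lemma extension_act:
  assumes x: "x \<in> carrier Q" and q: "q \<in> carrier A"
  shows "extension (act x q) = act (extension x) q \<oplus>\<^bsub>Q\<^esub> act x (A.extension q)"
proof (rule extension_eqI)
  show "fractional q \<in> F"
    by (rule fractional_filter[OF q])
  fix r m assume "r \<in> fractional q" and m: "m \<in> carrier M" "act x q \<cdot>\<^bsub>Q\<^esub> r = \<phi> m"
  then obtain a where r: "r \<in> carrier R" and a: "a \<in> carrier R" "q \<cdot>\<^bsub>A\<^esub> r = \<alpha> a"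
    by (auto simp: conductor_def)
  have xa: "x \<cdot>\<^bsub>Q\<^esub> a = \<phi> m"
    using act_ract[OF x q r a] m by simp
  have \<alpha>\<delta>: "A.extension q \<cdot>\<^bsub>A\<^esub> r \<oplus>\<^bsub>A\<^esub> q \<cdot>\<^bsub>A\<^esub> \<delta> r = \<alpha> (\<delta> a)"
    using A.extension_ract[OF q r _ a(2)] a by simp
  have "(act (extension x) q \<oplus>\<^bsub>Q\<^esub> act x (A.extension q)) \<cdot>\<^bsub>Q\<^esub> r \<oplus>\<^bsub>Q\<^esub> act x q \<cdot>\<^bsub>Q\<^esub> \<delta> r
      = extension x \<cdot>\<^bsub>Q\<^esub> a \<oplus>\<^bsub>Q\<^esub> act x (A.extension q \<cdot>\<^bsub>A\<^esub> r \<oplus>\<^bsub>A\<^esub> q \<cdot>\<^bsub>A\<^esub> \<delta> r)"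
    using x q r a by (simp add: Q.ract_add_left act_ract act_add_right act_ract_assoc Q.M.a_assoc)
  also have "\<dots> = extension x \<cdot>\<^bsub>Q\<^esub> a \<oplus>\<^bsub>Q\<^esub> x \<cdot>\<^bsub>Q\<^esub> \<delta> a"
    using x a by (simp add: \<alpha>\<delta> act_\<alpha>)
  also have "\<dots> = \<phi> (d m)"
    by (rule extension_ract[OF x a(1) m(1) xa])
  finally show "(act (extension x) q \<oplus>\<^bsub>Q\<^esub> act x (A.extension q)) \<cdot>\<^bsub>Q\<^esub> r
      \<oplus>\<^bsub>Q\<^esub> act x q \<cdot>\<^bsub>Q\<^esub> \<delta> r = \<phi> (d m)" .
qed (use x q in simp_all)

text \<open>
  Each summand is \<open>\<delta> q (\<alpha> r\<^sub>j p\<^sub>j)\<close>, because \<open>\<delta> q r\<^sub>j + q (\<delta> r\<^sub>j) = \<alpha> (\<delta> a\<^sub>j)\<close>.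
\<close>

lemma extension_formula:
  assumes q: "q \<in> carrier A"
    and closed: "\<And>j. j < k \<Longrightarrow> r j \<in> carrier R" "\<And>j. j < k \<Longrightarrow> a j \<in> carrier R"
      "\<And>j. j < k \<Longrightarrow> p j \<in> carrier A"
    and fractions: "\<And>j. j < k \<Longrightarrow> q \<otimes>\<^bsub>S\<^esub> \<alpha> (r j) = \<alpha> (a j)"
    and unit: "(\<Oplus>\<^bsub>S\<^esub>j\<in>{..<k}. \<alpha> (r j) \<otimes>\<^bsub>S\<^esub> p j) = \<one>\<^bsub>S\<^esub>"
  shows "A.extension q = (\<Oplus>\<^bsub>S\<^esub>j\<in>{..<k::nat}. \<alpha> (\<delta> (a j)) \<otimes>\<^bsub>S\<^esub> p j \<ominus>\<^bsub>S\<^esub>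
    q \<otimes>\<^bsub>S\<^esub> \<alpha> (\<delta> (r j)) \<otimes>\<^bsub>S\<^esub> p j)"
proof -
  interpret S: ring S
    by (rule quotient_ring)
  \<comment> \<open>Ring laws of \<open>S\<close> are used below, so its operations must stay folded.\<close>
  note [simp del] = quotient_ring_simps
  have [simp]: "add A = add S"
    by (simp add: quotient_ring_simps)
  have carrier_A: "carrier A = carrier S"
    by (simp add: quotient_ring_simps)
  have \<alpha>S [simp]: "\<alpha> s \<in> carrier S" if "s \<in> carrier R" for s
    using that \<alpha>_closed[of s] unfolding carrier_A by simp
  have mult_\<alpha>: "u \<otimes>\<^bsub>S\<^esub> \<alpha> s = u \<cdot>\<^bsub>A\<^esub> s" if "u \<in> carrier A" "s \<in> carrier R" for u s
    using that A.act_\<alpha>[of u s] by (simp add: quotient_ring_simps)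
  let ?D = "A.extension q"
  have D: "?D \<in> carrier S"
    using A.extension_closed[OF q] unfolding carrier_A .
  have summand: "?D \<otimes>\<^bsub>S\<^esub> (\<alpha> (r j) \<otimes>\<^bsub>S\<^esub> p j)
      = \<alpha> (\<delta> (a j)) \<otimes>\<^bsub>S\<^esub> p j \<ominus>\<^bsub>S\<^esub> q \<otimes>\<^bsub>S\<^esub> \<alpha> (\<delta> (r j)) \<otimes>\<^bsub>S\<^esub> p j" if j: "j < k" for j
  proof -
    have mem: "r j \<in> carrier R" "a j \<in> carrier R" "p j \<in> carrier S" "q \<in> carrier S"
      "\<alpha> (r j) \<in> carrier S" "\<alpha> (\<delta> (r j)) \<in> carrier S"
      using closed[OF j] q by (simp_all add: carrier_A)
    have "q \<cdot>\<^bsub>A\<^esub> r j = \<alpha> (a j)"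
      using fractions[OF j] mult_\<alpha>[OF q mem(1)] by simp
    then have "?D \<cdot>\<^bsub>A\<^esub> r j \<oplus>\<^bsub>A\<^esub> q \<cdot>\<^bsub>A\<^esub> \<delta> (r j) = \<alpha> (\<delta> (a j))"
      using A.extension_ract[OF q mem(1)] mem(2) by simp
    then have "\<alpha> (\<delta> (a j)) = ?D \<otimes>\<^bsub>S\<^esub> \<alpha> (r j) \<oplus>\<^bsub>S\<^esub> q \<otimes>\<^bsub>S\<^esub> \<alpha> (\<delta> (r j))"
      using mem q A.extension_closed[OF q] by (simp add: mult_\<alpha>)
    then show ?thesis
      using mem(3-) D
      by (simp only: S.l_distr S.m_assoc S.minus_eq S.a_assoc S.m_closed S.a_closed S.r_neg
          S.a_inv_closed S.r_zero)
  qed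
  have "?D = ?D \<otimes>\<^bsub>S\<^esub> (\<Oplus>\<^bsub>S\<^esub>j\<in>{..<k}. \<alpha> (r j) \<otimes>\<^bsub>S\<^esub> p j)"
    using D unit by simp
  also have "\<dots> = (\<Oplus>\<^bsub>S\<^esub>j\<in>{..<k}. ?D \<otimes>\<^bsub>S\<^esub> (\<alpha> (r j) \<otimes>\<^bsub>S\<^esub> p j))"
    using closed D by (intro S.finsum_rdistr) (auto simp: carrier_A)
  also have "\<dots> = (\<Oplus>\<^bsub>S\<^esub>j\<in>{..<k}. \<alpha> (\<delta> (a j)) \<otimes>\<^bsub>S\<^esub> p j \<ominus>\<^bsub>S\<^esub>
      q \<otimes>\<^bsub>S\<^esub> \<alpha> (\<delta> (r j)) \<otimes>\<^bsub>S\<^esub> p j)"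
  proof (rule S.finsum_cong')
    have "\<alpha> (\<delta> (a j)) \<otimes>\<^bsub>S\<^esub> p j \<ominus>\<^bsub>S\<^esub> q \<otimes>\<^bsub>S\<^esub> \<alpha> (\<delta> (r j)) \<otimes>\<^bsub>S\<^esub> p j \<in> carrier S" if "j < k" for j
      using closed[OF that] q by (simp add: carrier_A)
    then show "(\<lambda>j. \<alpha> (\<delta> (a j)) \<otimes>\<^bsub>S\<^esub> p j \<ominus>\<^bsub>S\<^esub> q \<otimes>\<^bsub>S\<^esub> \<alpha> (\<delta> (r j)) \<otimes>\<^bsub>S\<^esub> p j)
        \<in> {..<k} \<rightarrow> carrier S"
      by blast
  qed (use summand in auto)
  finally show ?thesis .
qed

end


section \<open>Tensor products with a ring\<close>

text \<open>
  The ring \<open>S\<close>, viewed as a left \<open>R\<close>-module through \<open>\<alpha>\<close>, acts on \<open>M \<otimes> S\<close> from the right.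
\<close>

locale tensor_ring = M: right_module R M + S: ring S
  for R :: "('r, 'x) ring_scheme" and M :: "('r, 'm, 'y) rmodule_scheme"
    and S :: "('s, 'z) ring_scheme" +
  fixes \<alpha> :: "'r \<Rightarrow> 's"
  assumes \<alpha>: "\<alpha> \<in> ring_hom R S"
begin

abbreviation N :: "('r, 's) module" where
  "N \<equiv> left_module_via S \<alpha>"

abbreviation T where
  "T \<equiv> tensor_rmodule R M N"

abbreviation G where
  "G \<equiv> free_Abelian_group (carrier M \<times> carrier S)"

abbreviation null where
  "null \<equiv> tensor_null R M N"

abbreviation cls where
  "cls \<equiv> tensor_class R M N"

abbreviation tens where
  "tens \<equiv> tensor R M N"

lemma N_simps [simp]:
  "carrier N = carrier S" "monoid.mult N = monoid.mult S" "one N = one S"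
  "add N = add S" "smult N = (\<lambda>r s. \<alpha> r \<otimes>\<^bsub>S\<^esub> s)"
  by (simp_all add: left_module_via_def)

lemma \<alpha>_closed [simp]: "r \<in> carrier R \<Longrightarrow> \<alpha> r \<in> carrier S"
  using \<alpha> by (rule ring_hom_closed)

declare carrier_free_Abelian_group_iff [simp del]

lemma G_add_closed: "\<lbrakk>a \<in> carrier G; b \<in> carrier G\<rbrakk> \<Longrightarrow> a + b \<in> carrier G"
  using keys_add[of a b] by (auto simp: carrier_free_Abelian_group_iff)

lemma G_diff_closed: "\<lbrakk>a \<in> carrier G; b \<in> carrier G\<rbrakk> \<Longrightarrow> a - b \<in> carrier G"
  using keys_diff[of a b] by (auto simp: carrier_free_Abelian_group_iff)

lemma relations_closed: "tensor_relations R M N \<subseteq> carrier G"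
  by (auto simp: tensor_relations_def M.ract_closed intro!: G_diff_closed)

lemma null_subgroup: "subgroup null G"
  unfolding tensor_null_def N_simps
  by (rule group.generate_is_subgroup[OF group_free_Abelian_group relations_closed])

lemma null_normal: "null \<lhd> G"
  by (rule comm_group.subgroup_imp_normal[OF abelian_free_Abelian_group null_subgroup])

lemma relation_in_null: "c \<in> tensor_relations R M N \<Longrightarrow> c \<in> null"
  unfolding tensor_null_def by (rule generate.incl)

lemma null_subset:
  assumes "subgroup K G" "tensor_relations R M N \<subseteq> K"
  shows "null \<subseteq> K"
  unfolding tensor_null_def N_simps
  by (rule group.generate_subgroup_incl[OF group_free_Abelian_group assms(2,1)])

lemma null_closed:
  "0 \<in> null" "\<lbrakk>a \<in> null; b \<in> null\<rbrakk> \<Longrightarrow> a + b \<in> null" "a \<in> null \<Longrightarrow> a \<in> carrier G"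
  "a \<in> null \<Longrightarrow> - a \<in> null"
proof -
  show "a \<in> null \<Longrightarrow> a \<in> carrier G"
    by (rule subgroup.mem_carrier[OF null_subgroup])
  then show "a \<in> null \<Longrightarrow> - a \<in> null"
    using subgroup.m_inv_closed[OF null_subgroup, of a]
    by (simp add: carrier_free_Abelian_group_iff)
qed (use subgroup.one_closed[OF null_subgroup] subgroup.m_closed[OF null_subgroup, of a b] in simp_all)

lemma cls_eq_iff: "cls a = cls b \<longleftrightarrow> a - b \<in> null"
proof -
  have cls: "cls c = (\<lambda>h. h + c) ` null" for c
    by (auto simp: tensor_class_def r_coset_def)
  have "a \<in> cls a"
    using null_closed(1) by (auto simp: cls intro: exI[of _ 0])
  then have "a - b \<in> null" if "cls a = cls b"
    using that by (auto simp: cls)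
  moreover have "cls a \<subseteq> cls b" if ab: "a - b \<in> null" for a b
  proof
    fix c assume "c \<in> cls a"
    then obtain h where "h \<in> null" "c = h + a"
      by (auto simp: cls)
    then have "h + (a - b) \<in> null" "c = (h + (a - b)) + b"
      using null_closed(2)[of h "a - b"] ab by simp_all
    then show "c \<in> cls b"
      unfolding cls by blast
  qed
  moreover have "b - a \<in> null" if "a - b \<in> null"
    using null_closed(4)[OF that] by simp
  ultimately show ?thesis
    by blast
qed

lemma T_simps:
  "carrier T = {cls c |c. c \<in> carrier G}" "\<zero>\<^bsub>T\<^esub> = cls 0"
  "\<lbrakk>a \<in> carrier G; b \<in> carrier G\<rbrakk> \<Longrightarrow> cls a \<oplus>\<^bsub>T\<^esub> cls b = cls (a + b)"
proof -
  show "carrier T = {cls c |c. c \<in> carrier G}"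
    by (auto simp: tensor_rmodule_def tensor_group_def FactGroup_def RCOSETS_def tensor_class_def)
  have "null #>\<^bsub>G\<^esub> 0 = null"
    by (auto simp: r_coset_def)
  then show "\<zero>\<^bsub>T\<^esub> = cls 0"
    by (simp add: tensor_rmodule_def tensor_group_def tensor_class_def)
  show "\<lbrakk>a \<in> carrier G; b \<in> carrier G\<rbrakk> \<Longrightarrow> cls a \<oplus>\<^bsub>T\<^esub> cls b = cls (a + b)"
    using normal.rcos_sum[OF null_normal, of a b]
    by (simp add: tensor_rmodule_def tensor_group_def tensor_class_def)
qed

lemma cls_closed: "c \<in> carrier G \<Longrightarrow> cls c \<in> carrier T"
  by (auto simp: T_simps)

lemma abelian_group_T: "abelian_group T"
proof -
  interpret FG: comm_group "tensor_group R M N"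
    unfolding tensor_group_def N_simps
    by (rule comm_group.abelian_FactGroup[OF abelian_free_Abelian_group null_subgroup])
  have T: "carrier T = carrier (tensor_group R M N)" "add T = monoid.mult (tensor_group R M N)"
    "\<zero>\<^bsub>T\<^esub> = \<one>\<^bsub>tensor_group R M N\<^esub>"
    by (simp_all add: tensor_rmodule_def)
  show ?thesis
  proof (rule abelian_groupI)
    fix x assume "x \<in> carrier T"
    then show "\<exists>y\<in>carrier T. y \<oplus>\<^bsub>T\<^esub> x = \<zero>\<^bsub>T\<^esub>"
      unfolding T by (metis FG.inv_closed FG.l_inv)
  qed (simp_all add: T FG.m_assoc, simp add: FG.m_comm)
qed

interpretation T: abelian_group T
  by (rule abelian_group_T)

lemma tens_closed [simp]: "\<lbrakk>m \<in> carrier M; s \<in> carrier S\<rbrakk> \<Longrightarrow> tens m s \<in> carrier T"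
  unfolding tensor_def by (rule cls_closed) simp

text \<open>
  The tensors generate \<open>T\<close> as a group; closure under differences covers sums and negatives.
\<close>

lemma T_induct [consumes 1, case_names zero minus tens]:
  assumes C: "C \<in> carrier T" and zero: "P \<zero>\<^bsub>T\<^esub>"
    and minus: "\<And>A B. \<lbrakk>A \<in> carrier T; B \<in> carrier T; P A; P B\<rbrakk> \<Longrightarrow> P (A \<ominus>\<^bsub>T\<^esub> B)"
    and tens: "\<And>m s. \<lbrakk>m \<in> carrier M; s \<in> carrier S\<rbrakk> \<Longrightarrow> P (tens m s)"
  shows "P C"
proof -
  obtain c where c: "Poly_Mapping.keys c \<subseteq> carrier M \<times> carrier S" "C = cls c"
    using C by (auto simp: T_simps carrier_free_Abelian_group_iff)
  have "P (cls c)"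
  proof (rule free_Abelian_group_induct[OF c(1)])
    show "P (cls 0)"
      using zero by (simp add: T_simps)
    show "P (cls (frag_of x))" if "x \<in> carrier M \<times> carrier S" for x
      using that tens by (auto simp: tensor_def)
  next
    fix a b :: "('m \<times> 's) \<Rightarrow>\<^sub>0 int"
    assume 2: "Poly_Mapping.keys a \<subseteq> carrier M \<times> carrier S"
      "Poly_Mapping.keys b \<subseteq> carrier M \<times> carrier S" "P (cls a)" "P (cls b)"
    have ab: "a \<in> carrier G" "b \<in> carrier G" "a - b \<in> carrier G"
      using 2 G_diff_closed[of a b] by (simp_all add: carrier_free_Abelian_group_iff)
    have "cls a = cls (a - b) \<oplus>\<^bsub>T\<^esub> cls b"
      using ab by (simp add: T_simps)
    then have "cls (a - b) = cls a \<ominus>\<^bsub>T\<^esub> cls b"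
      using ab[THEN cls_closed] by (simp add: T.minus_eq T.a_assoc T.r_neg)
    then show "P (cls (a - b))"
      using 2 ab[THEN cls_closed] minus by simp
  qed
  then show ?thesis
    by (simp add: c)
qed

text \<open>
  The universal property. The homomorphism from the free abelian group given by \<open>f\<close> kills the defining
  relations, hence factors through the quotient.
\<close>

lemma tens_lift:
  assumes H: "abelian_group H"
    and f: "\<And>m s. \<lbrakk>m \<in> carrier M; s \<in> carrier S\<rbrakk> \<Longrightarrow> f m s \<in> carrier H"
    and add_left: "\<And>m n s. \<lbrakk>m \<in> carrier M; n \<in> carrier M; s \<in> carrier S\<rbrakk>
        \<Longrightarrow> f (m \<oplus>\<^bsub>M\<^esub> n) s = f m s \<oplus>\<^bsub>H\<^esub> f n s"
    and add_right: "\<And>m s t. \<lbrakk>m \<in> carrier M; s \<in> carrier S; t \<in> carrier S\<rbrakk>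
        \<Longrightarrow> f m (s \<oplus>\<^bsub>S\<^esub> t) = f m s \<oplus>\<^bsub>H\<^esub> f m t"
    and balanced: "\<And>m r s. \<lbrakk>m \<in> carrier M; r \<in> carrier R; s \<in> carrier S\<rbrakk>
        \<Longrightarrow> f (m \<cdot>\<^bsub>M\<^esub> r) s = f m (\<alpha> r \<otimes>\<^bsub>S\<^esub> s)"
  obtains g where "g \<in> carrier T \<rightarrow> carrier H"
    "\<And>x y. \<lbrakk>x \<in> carrier T; y \<in> carrier T\<rbrakk> \<Longrightarrow> g (x \<oplus>\<^bsub>T\<^esub> y) = g x \<oplus>\<^bsub>H\<^esub> g y"
    "\<And>m s. \<lbrakk>m \<in> carrier M; s \<in> carrier S\<rbrakk> \<Longrightarrow> g (tens m s) = f m s"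
proof -
  interpret H: abelian_group H by (rule H)
  obtain h where h: "h \<in> hom G (add_monoid H)"
    and h_of: "\<And>x. x \<in> carrier M \<times> carrier S \<Longrightarrow> h (frag_of x) = case_prod f x"
    by (rule comm_group.free_Abelian_group_universal[OF H.a_comm_group,
          where f = "case_prod f" and S = "carrier M \<times> carrier S"]) (use f in auto)
  interpret h: group_hom G "add_monoid H" h
    by (rule group_hom.intro)
      (use h in \<open>simp_all add: group_hom_axioms_def H.a_group\<close>)
  have h_frag [simp]: "h (frag_of (m, s)) = f m s" if "m \<in> carrier M" "s \<in> carrier S" for m s
    using h_of[of "(m, s)"] that by simp
  have h_add: "h (a + b) = h a \<oplus>\<^bsub>H\<^esub> h b" if "a \<in> carrier G" "b \<in> carrier G" for a b
    using h.hom_mult[OF that] by simp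
  have kernelI: "a - b \<in> kernel G (add_monoid H) h"
    if "a \<in> carrier G" "b \<in> carrier G" "h a = h b" for a b
  proof -
    have ab: "a - b \<in> carrier G"
      by (rule G_diff_closed[OF that(1,2)])
    then have "h (a - b) \<oplus>\<^bsub>H\<^esub> h b = h b"
      using h_add[OF ab that(2)] that(3) by simp
    moreover have "h (a - b) \<in> carrier H" "h b \<in> carrier H"
      using h.hom_closed[OF ab] h.hom_closed[OF that(2)] by simp_all
    ultimately have "h (a - b) = \<zero>\<^bsub>H\<^esub>"
      using H.add.r_cancel_one[of "h b" "h (a - b)"] by simp
    then show ?thesis
      using ab by (simp add: kernel_def)
  qed
  have "tensor_relations R M N \<subseteq> kernel G (add_monoid H) h"
  proof
    fix c assume "c \<in> tensor_relations R M N"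
    then consider
      (left) m n s where "m \<in> carrier M" "n \<in> carrier M" "s \<in> carrier S"
        "c = frag_of (m \<oplus>\<^bsub>M\<^esub> n, s) - (frag_of (m, s) + frag_of (n, s))"
      | (right) m s t where "m \<in> carrier M" "s \<in> carrier S" "t \<in> carrier S"
        "c = frag_of (m, s \<oplus>\<^bsub>S\<^esub> t) - (frag_of (m, s) + frag_of (m, t))"
      | (balanced) m r s where "m \<in> carrier M" "r \<in> carrier R" "s \<in> carrier S"
        "c = frag_of (m \<cdot>\<^bsub>M\<^esub> r, s) - frag_of (m, \<alpha> r \<otimes>\<^bsub>S\<^esub> s)"
      by (auto simp: tensor_relations_def diff_diff_eq)
    then show "c \<in> kernel G (add_monoid H) h"
    proof cases
      case left
      have "frag_of (m, s) + frag_of (n, s) \<in> carrier G"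
        using left by (intro G_add_closed) simp_all
      then show ?thesis
        unfolding left(4) using left(1-3)
        by (intro kernelI) (simp_all add: h_add add_left)
    next
      case right
      have "frag_of (m, s) + frag_of (m, t) \<in> carrier G"
        using right by (intro G_add_closed) simp_all
      then show ?thesis
        unfolding right(4) using right(1-3)
        by (intro kernelI) (simp_all add: h_add add_right)
    next
      case balanced
      then show ?thesis
        unfolding balanced(4)
        by (intro kernelI)
          (simp_all add: assms(5) M.ract_closed)
    qed
  qed
  then have "null \<subseteq> kernel G (add_monoid H) h"
    by (intro null_subset h.subgroup_kernel)
  then obtain g where g: "g \<in> hom (G Mod null) (add_monoid H)"
    and g_cls: "\<And>c. c \<in> carrier G \<Longrightarrow> g (null #>\<^bsub>G\<^esub> c) = h c"
    using h.FactGroup_universal_kernel[OF null_normal] by blast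
  show thesis
  proof (rule that[of g])
    show "g \<in> carrier T \<rightarrow> carrier H"
      using g by (auto simp: hom_def tensor_rmodule_def tensor_group_def)
    show "g (x \<oplus>\<^bsub>T\<^esub> y) = g x \<oplus>\<^bsub>H\<^esub> g y" if "x \<in> carrier T" "y \<in> carrier T" for x y
      using g that by (auto simp: hom_def tensor_rmodule_def tensor_group_def)
    show "g (tens m s) = f m s" if "m \<in> carrier M" "s \<in> carrier S" for m s
      using g_cls[of "frag_of (m, s)"] that by (simp add: tensor_def tensor_class_def)
  qed
qed

definition right_multiply :: "'s \<Rightarrow> (('m \<times> 's) \<Rightarrow>\<^sub>0 int) \<Rightarrow> (('m \<times> 's) \<Rightarrow>\<^sub>0 int)" where
  "right_multiply t = frag_extend (\<lambda>(m, s). frag_of (m, s \<otimes>\<^bsub>S\<^esub> t))"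

lemma right_multiply_closed:
  assumes "c \<in> carrier G" "t \<in> carrier S"
  shows "right_multiply t c \<in> carrier G"
  using assms keys_frag_extend[of "\<lambda>(m, s). frag_of (m, s \<otimes>\<^bsub>S\<^esub> t)" c]
  by (fastforce simp: right_multiply_def carrier_free_Abelian_group_iff)

text \<open>
  Right multiplication maps each defining relation to one of the same kind, so it is well defined on
  classes.
\<close>

lemma right_multiply_null:
  assumes c: "c \<in> null" and t: "t \<in> carrier S"
  shows "right_multiply t c \<in> null"
proof -
  let ?K = "{c \<in> carrier G. right_multiply t c \<in> null}"
  have "subgroup ?K G"
  proof (rule group.subgroupI[OF group_free_Abelian_group])
    show "?K \<noteq> {}"
      using null_closed(1) null_closed(3)[OF null_closed(1)]
      by (auto simp: right_multiply_def intro!: exI[of _ 0])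
  next
    fix a assume "a \<in> ?K"
    then show "inv\<^bsub>G\<^esub> a \<in> ?K"
      using null_closed(4)
      by (auto simp: right_multiply_def frag_extend_minus carrier_free_Abelian_group_iff)
  next
    fix a b assume "a \<in> ?K" "b \<in> ?K"
    then show "a \<otimes>\<^bsub>G\<^esub> b \<in> ?K"
      using null_closed(2) G_add_closed[of a b]
      by (auto simp: right_multiply_def frag_extend_add)
  qed auto
  moreover have "tensor_relations R M N \<subseteq> ?K"
  proof
    fix c assume rel: "c \<in> tensor_relations R M N"
    have "right_multiply t c \<in> tensor_relations R M N"
    proof -
      consider
        (left) m n s where "m \<in> carrier M" "n \<in> carrier M" "s \<in> carrier S"
          "c = frag_of (m \<oplus>\<^bsub>M\<^esub> n, s) - frag_of (m, s) - frag_of (n, s)"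
        | (right) m s u where "m \<in> carrier M" "s \<in> carrier S" "u \<in> carrier S"
          "c = frag_of (m, s \<oplus>\<^bsub>S\<^esub> u) - frag_of (m, s) - frag_of (m, u)"
        | (balanced) m r s where "m \<in> carrier M" "r \<in> carrier R" "s \<in> carrier S"
          "c = frag_of (m \<cdot>\<^bsub>M\<^esub> r, s) - frag_of (m, \<alpha> r \<otimes>\<^bsub>S\<^esub> s)"
        using rel by (auto simp: tensor_relations_def)
      then show ?thesis
      proof cases
        case left
        then have "right_multiply t c = frag_of (m \<oplus>\<^bsub>M\<^esub> n, s \<otimes>\<^bsub>S\<^esub> t)
            - frag_of (m, s \<otimes>\<^bsub>S\<^esub> t) - frag_of (n, s \<otimes>\<^bsub>S\<^esub> t)"
          by (simp add: right_multiply_def frag_extend_diff)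
        then show ?thesis
          using left t S.m_closed[of s t] unfolding tensor_relations_def N_simps by blast
      next
        case right
        then have "right_multiply t c = frag_of (m, s \<otimes>\<^bsub>S\<^esub> t \<oplus>\<^bsub>S\<^esub> u \<otimes>\<^bsub>S\<^esub> t)
            - frag_of (m, s \<otimes>\<^bsub>S\<^esub> t) - frag_of (m, u \<otimes>\<^bsub>S\<^esub> t)"
          using t by (simp add: right_multiply_def frag_extend_diff S.l_distr)
        then show ?thesis
          using right t S.m_closed[of s t] S.m_closed[of u t]
          unfolding tensor_relations_def N_simps by blast
      next
        case balanced
        then have "right_multiply t c = frag_of (m \<cdot>\<^bsub>M\<^esub> r, s \<otimes>\<^bsub>S\<^esub> t)
            - frag_of (m, \<alpha> r \<otimes>\<^bsub>S\<^esub> (s \<otimes>\<^bsub>S\<^esub> t))"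
          using t by (simp add: right_multiply_def frag_extend_diff S.m_assoc)
        then show ?thesis
          using balanced t S.m_closed[of s t] unfolding tensor_relations_def N_simps by blast
      qed
    qed
    then show "c \<in> ?K"
      using rel relations_closed relation_in_null by blast
  qed
  ultimately show ?thesis
    using null_subset[of ?K] c by blast
qed

lemma T_ract_cls:
  assumes c: "c \<in> carrier G" and t: "t \<in> carrier S"
  shows "cls c \<cdot>\<^bsub>T\<^esub> t = cls (right_multiply t c)"
proof -
  have "cls (right_multiply t b) = cls (right_multiply t c)" if "b \<in> cls c" for b
  proof -
    have "b - c \<in> null"
      using that by (auto simp: tensor_class_def r_coset_def)
    then have "right_multiply t (b - c) \<in> null"
      by (rule right_multiply_null[OF _ t])
    then show ?thesis
      by (simp add: cls_eq_iff right_multiply_def frag_extend_diff)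
  qed
  moreover have "c \<in> cls c"
    using null_closed(1) by (auto simp: tensor_class_def r_coset_def intro: bexI[of _ 0])
  moreover have "cls c \<cdot>\<^bsub>T\<^esub> t = (\<Union>b\<in>cls c. cls (right_multiply t b))"
    by (simp add: tensor_rmodule_def right_multiply_def)
  ultimately show ?thesis
    by blast
qed

lemma tens_ract:
  assumes "m \<in> carrier M" "s \<in> carrier S" "t \<in> carrier S"
  shows "tens m s \<cdot>\<^bsub>T\<^esub> t = tens m (s \<otimes>\<^bsub>S\<^esub> t)"
  using assms T_ract_cls[of "frag_of (m, s)" t] by (simp add: tensor_def right_multiply_def)

lemma T_ract_closed:
  assumes "C \<in> carrier T" "t \<in> carrier S"
  shows "C \<cdot>\<^bsub>T\<^esub> t \<in> carrier T"
proof -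
  obtain c where "c \<in> carrier G" "C = cls c"
    using assms by (auto simp: T_simps)
  then show ?thesis
    using assms by (simp only: T_ract_cls right_multiply_closed cls_closed)
qed

lemma T_ract_add:
  assumes "B \<in> carrier T" "C \<in> carrier T" "t \<in> carrier S"
  shows "(B \<oplus>\<^bsub>T\<^esub> C) \<cdot>\<^bsub>T\<^esub> t = B \<cdot>\<^bsub>T\<^esub> t \<oplus>\<^bsub>T\<^esub> C \<cdot>\<^bsub>T\<^esub> t"
proof -
  obtain b c where bc: "b \<in> carrier G" "B = cls b" "c \<in> carrier G" "C = cls c"
    using assms by (auto simp: T_simps)
  moreover have "b + c \<in> carrier G"
    by (rule G_add_closed[OF bc(1,3)])
  moreover have "right_multiply t (b + c) = right_multiply t b + right_multiply t c"
    by (simp add: right_multiply_def frag_extend_add)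
  ultimately show ?thesis
    using assms by (simp only: T_ract_cls T_simps right_multiply_closed)
qed

text \<open>
  Additive maps are compared on tensors only, as these generate \<open>T\<close>.
\<close>

lemma additive_eqI:
  assumes H: "abelian_group H"
    and g: "g \<in> carrier T \<rightarrow> carrier H"
      "\<And>x y. \<lbrakk>x \<in> carrier T; y \<in> carrier T\<rbrakk> \<Longrightarrow> g (x \<oplus>\<^bsub>T\<^esub> y) = g x \<oplus>\<^bsub>H\<^esub> g y"
    and h: "h \<in> carrier T \<rightarrow> carrier H"
      "\<And>x y. \<lbrakk>x \<in> carrier T; y \<in> carrier T\<rbrakk> \<Longrightarrow> h (x \<oplus>\<^bsub>T\<^esub> y) = h x \<oplus>\<^bsub>H\<^esub> h y"
    and eq: "\<And>m s. \<lbrakk>m \<in> carrier M; s \<in> carrier S\<rbrakk> \<Longrightarrow> g (tens m s) = h (tens m s)"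
    and C: "C \<in> carrier T"
  shows "g C = h C"
  using C
proof (induction rule: T_induct)
  case zero
  show ?case
    using additive_zero[where f = g, OF abelian_group_T H g] additive_zero[where f = h, OF abelian_group_T H h] by simp
next
  case (minus A B)
  then show ?case
    using additive_minus[where f = g, OF abelian_group_T H g] additive_minus[where f = h, OF abelian_group_T H h] by simp
qed (rule eq)

lemma hom_tens:
  assumes "g \<in> rmodule_hom S T H" "m \<in> carrier M" "s \<in> carrier S"
  shows "g (tens m s) = g (tens m \<one>\<^bsub>S\<^esub>) \<cdot>\<^bsub>H\<^esub> s"
proof -
  have "g (tens m \<one>\<^bsub>S\<^esub> \<cdot>\<^bsub>T\<^esub> s) = g (tens m \<one>\<^bsub>S\<^esub>) \<cdot>\<^bsub>H\<^esub> s"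
    using assms by (simp add: rmodule_hom_def)
  then show ?thesis
    using assms by (simp add: tens_ract)
qed

text \<open>
  As \<open>m \<otimes> s = (m \<otimes> 1) s\<close>, an \<open>S\<close>-linear map is determined by its values on the tensors \<open>m \<otimes> 1\<close>.
\<close>

lemma hom_eqI:
  assumes H: "right_module S H"
    and g: "g \<in> rmodule_hom S T H" and h: "h \<in> rmodule_hom S T H"
    and eq: "\<And>m. m \<in> carrier M \<Longrightarrow> g (tens m \<one>\<^bsub>S\<^esub>) = h (tens m \<one>\<^bsub>S\<^esub>)"
    and C: "C \<in> carrier T"
  shows "g C = h C"
proof -
  interpret H: right_module S H by (rule H)
  show ?thesis
  proof (rule additive_eqI[where g = g and h = h, OF H.M.abelian_group_axioms _ _ _ _ _ C])
    fix m s assume "m \<in> carrier M" "s \<in> carrier S"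
    then show "g (tens m s) = h (tens m s)"
      using hom_tens[OF g] hom_tens[OF h] eq by metis
  qed (use g h in \<open>auto simp: rmodule_hom_def\<close>)
qed

lemma hom_exists:
  assumes H: "right_module S H" and f: "f \<in> carrier M \<rightarrow> carrier H"
    and f_add: "\<And>m n. \<lbrakk>m \<in> carrier M; n \<in> carrier M\<rbrakk> \<Longrightarrow> f (m \<oplus>\<^bsub>M\<^esub> n) = f m \<oplus>\<^bsub>H\<^esub> f n"
    and f_ract: "\<And>m r. \<lbrakk>m \<in> carrier M; r \<in> carrier R\<rbrakk> \<Longrightarrow> f (m \<cdot>\<^bsub>M\<^esub> r) = f m \<cdot>\<^bsub>H\<^esub> \<alpha> r"
  obtains g where "g \<in> rmodule_hom S T H"
    "\<And>m s. \<lbrakk>m \<in> carrier M; s \<in> carrier S\<rbrakk> \<Longrightarrow> g (tens m s) = f m \<cdot>\<^bsub>H\<^esub> s"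
proof -
  interpret H: right_module S H by (rule H)
  have f_closed: "f m \<in> carrier H" if "m \<in> carrier M" for m
    using f that by blast
  obtain g where g: "g \<in> carrier T \<rightarrow> carrier H"
    and g_add: "\<And>x y. \<lbrakk>x \<in> carrier T; y \<in> carrier T\<rbrakk> \<Longrightarrow> g (x \<oplus>\<^bsub>T\<^esub> y) = g x \<oplus>\<^bsub>H\<^esub> g y"
    and g_tens: "\<And>m s. \<lbrakk>m \<in> carrier M; s \<in> carrier S\<rbrakk> \<Longrightarrow> g (tens m s) = f m \<cdot>\<^bsub>H\<^esub> s"
    by (rule tens_lift[OF H.M.abelian_group_axioms, where f = "\<lambda>m s. f m \<cdot>\<^bsub>H\<^esub> s"])
      (simp_all add: f_closed f_add f_ract H.ract_closed H.ract_add_left H.ract_add_right H.ract_mult)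
  have "g (C \<cdot>\<^bsub>T\<^esub> t) = g C \<cdot>\<^bsub>H\<^esub> t" if C: "C \<in> carrier T" and t: "t \<in> carrier S" for C t
  proof (rule additive_eqI[where g = "\<lambda>C. g (C \<cdot>\<^bsub>T\<^esub> t)" and h = "\<lambda>C. g C \<cdot>\<^bsub>H\<^esub> t",
        OF H.M.abelian_group_axioms _ _ _ _ _ C])
    show "(\<lambda>C. g (C \<cdot>\<^bsub>T\<^esub> t)) \<in> carrier T \<rightarrow> carrier H" "(\<lambda>C. g C \<cdot>\<^bsub>H\<^esub> t) \<in> carrier T \<rightarrow> carrier H"
      using t by (auto intro!: T_ract_closed H.ract_closed Pi_mem[OF g])
  qed (use t in \<open>simp_all add: g_add T_ract_add T_ract_closed Pi_mem[OF g] H.ract_add_left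
      tens_ract g_tens f_closed H.ract_mult\<close>)
  then show thesis
    using that[of g] g g_add g_tens by (simp add: rmodule_hom_def)
qed

text \<open>
  Existence and uniqueness together give the value of the description that defines the canonical map.
  Restriction to the carrier turns any linear extension into the extensional one.
\<close>

lemma the_hom:
  fixes H :: "('s, 'h, 'k) rmodule_scheme" and f :: "'m \<Rightarrow> 'h"
  defines "\<Phi> \<equiv> THE \<Phi>. \<Phi> \<in> extensional (carrier T) \<and> \<Phi> \<in> rmodule_hom S T H \<and>
    (\<forall>m\<in>carrier M. f m = \<Phi> (tens m \<one>\<^bsub>S\<^esub>))"
  assumes H: "right_module S H" and f: "f \<in> carrier M \<rightarrow> carrier H"
    and f_add: "\<And>m n. \<lbrakk>m \<in> carrier M; n \<in> carrier M\<rbrakk> \<Longrightarrow> f (m \<oplus>\<^bsub>M\<^esub> n) = f m \<oplus>\<^bsub>H\<^esub> f n"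
    and f_ract: "\<And>m r. \<lbrakk>m \<in> carrier M; r \<in> carrier R\<rbrakk> \<Longrightarrow> f (m \<cdot>\<^bsub>M\<^esub> r) = f m \<cdot>\<^bsub>H\<^esub> \<alpha> r"
  shows "\<Phi> \<in> rmodule_hom S T H"
    and "\<lbrakk>m \<in> carrier M; s \<in> carrier S\<rbrakk> \<Longrightarrow> \<Phi> (tens m s) = f m \<cdot>\<^bsub>H\<^esub> s"
proof -
  interpret H: right_module S H by (rule H)
  interpret T: abelian_group T by (rule abelian_group_T)
  let ?P = "\<lambda>\<Phi>. \<Phi> \<in> extensional (carrier T) \<and> \<Phi> \<in> rmodule_hom S T H \<and>
    (\<forall>m\<in>carrier M. f m = \<Phi> (tens m \<one>\<^bsub>S\<^esub>))"
  obtain g where g: "g \<in> rmodule_hom S T H"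
    and g_tens: "\<And>m s. \<lbrakk>m \<in> carrier M; s \<in> carrier S\<rbrakk> \<Longrightarrow> g (tens m s) = f m \<cdot>\<^bsub>H\<^esub> s"
    using hom_exists[OF H f f_add f_ract] by blast
  have g': "?P (restrict g (carrier T))"
    using g by (auto simp: rmodule_hom_def T_ract_closed g_tens H.ract_one Pi_mem[OF f])
  have unique: "\<Psi> = restrict g (carrier T)" if \<Psi>: "?P \<Psi>" for \<Psi>
  proof (rule extensionalityI)
    fix C assume "C \<in> carrier T"
    then show "\<Psi> C = restrict g (carrier T) C"
    proof (rule hom_eqI[OF H, rotated -1])
      show "\<Psi> \<in> rmodule_hom S T H" "restrict g (carrier T) \<in> rmodule_hom S T H"
        using \<Psi> g' by simp_all
      fix m assume "m \<in> carrier M"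
      then have "f m = \<Psi> (tens m \<one>\<^bsub>S\<^esub>)" "f m = restrict g (carrier T) (tens m \<one>\<^bsub>S\<^esub>)"
        using \<Psi> g' by blast+
      then show "\<Psi> (tens m \<one>\<^bsub>S\<^esub>) = restrict g (carrier T) (tens m \<one>\<^bsub>S\<^esub>)"
        by simp
    qed
  qed (use \<Psi> in simp_all)
  have "\<exists>!\<Phi>. ?P \<Phi>"
    by (rule ex1I[of ?P, OF g' unique])
  then have \<Phi>: "?P \<Phi>"
    unfolding \<Phi>_def by (rule theI')
  then show "\<Phi> \<in> rmodule_hom S T H"
    by blast
  then show "\<Phi> (tens m s) = f m \<cdot>\<^bsub>H\<^esub> s" if "m \<in> carrier M" "s \<in> carrier S"
    using hom_tens that \<Phi> by metis
qed

end


section \<open>Construction of modules of quotients\<close>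

context right_module
begin

lemma submodule_abelian_subgroup:
  "right_submodule R N M \<Longrightarrow> abelian_subgroup N M"
  by (simp add: right_submodule_def abelian_subgroupI3 M.abelian_group_axioms)

lemma coset_eq_iff:
  assumes N: "right_submodule R N M" and x: "x \<in> carrier M"
  shows "N +>\<^bsub>M\<^esub> x = N \<longleftrightarrow> x \<in> N"
proof -
  interpret N: abelian_subgroup N M
    by (rule submodule_abelian_subgroup[OF N])
  show ?thesis
    using N.a_rcos_self[OF x] M.a_coset_join2[OF x N.a_subgroup] by auto
qed

text \<open>
  If \<open>y = h + x\<close> with \<open>h \<in> N\<close>, then \<open>y r\<close> and \<open>x r\<close> differ by \<open>h r \<in> N\<close>, so all cosets in the union that
  defines the action coincide.
\<close>

lemma quotient_rmodule_ract:
  assumes N: "right_submodule R N M" and x: "x \<in> carrier M" and r: "r \<in> carrier R"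
  shows "(N +>\<^bsub>M\<^esub> x) \<cdot>\<^bsub>quotient_rmodule M N\<^esub> r = N +>\<^bsub>M\<^esub> (x \<cdot>\<^bsub>M\<^esub> r)"
proof -
  interpret N: abelian_subgroup N M
    by (rule submodule_abelian_subgroup[OF N])
  note sub = right_submoduleD[OF N]
  have "N +>\<^bsub>M\<^esub> (y \<cdot>\<^bsub>M\<^esub> r) = N +>\<^bsub>M\<^esub> (x \<cdot>\<^bsub>M\<^esub> r)" if y: "y \<in> N +>\<^bsub>M\<^esub> x" for y
  proof -
    obtain h where h: "h \<in> N" "y = h \<oplus>\<^bsub>M\<^esub> x"
      using y by (auto simp: a_r_coset_def')
    then have "h \<in> carrier M"
      using sub(1) by blast
    then have "y \<cdot>\<^bsub>M\<^esub> r = h \<cdot>\<^bsub>M\<^esub> r \<oplus>\<^bsub>M\<^esub> x \<cdot>\<^bsub>M\<^esub> r"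
      using x r by (simp add: h ract_add_left)
    then have "y \<cdot>\<^bsub>M\<^esub> r \<in> N +>\<^bsub>M\<^esub> (x \<cdot>\<^bsub>M\<^esub> r)"
      using sub(5)[OF h(1) r] by (auto simp: a_r_coset_def')
    then show ?thesis
      using M.a_repr_independence[OF _ _ N.a_subgroup] ract_closed[OF x r] by metis
  qed
  then have "(\<Union>y\<in>N +>\<^bsub>M\<^esub> x. N +>\<^bsub>M\<^esub> (y \<cdot>\<^bsub>M\<^esub> r)) = (\<Union>y\<in>N +>\<^bsub>M\<^esub> x. N +>\<^bsub>M\<^esub> (x \<cdot>\<^bsub>M\<^esub> r))"
    by (rule SUP_cong[OF refl])
  also have "\<dots> = N +>\<^bsub>M\<^esub> (x \<cdot>\<^bsub>M\<^esub> r)"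
    using N.a_rcos_self[OF x] by blast
  finally show ?thesis
    by (simp add: quotient_rmodule_def)
qed

lemma quotient_annihilator:
  assumes N: "right_submodule R N M" and x: "x \<in> carrier M"
  shows "annihilator R (quotient_rmodule M N) (N +>\<^bsub>M\<^esub> x) = conductor R M N x"
proof -
  have zero: "\<zero>\<^bsub>quotient_rmodule M N\<^esub> = N"
    by (simp add: quotient_rmodule_def)
  have "(N +>\<^bsub>M\<^esub> x) \<cdot>\<^bsub>quotient_rmodule M N\<^esub> r = \<zero>\<^bsub>quotient_rmodule M N\<^esub> \<longleftrightarrow> x \<cdot>\<^bsub>M\<^esub> r \<in> N"
    if r: "r \<in> carrier R" for r
    unfolding zero quotient_rmodule_ract[OF N x r]
    by (rule coset_eq_iff[OF N ract_closed[OF x r]])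
  then show ?thesis
    unfolding annihilator_def conductor_def by blast
qed

lemma torsion_quotient_iff:
  assumes N: "right_submodule R N M"
  shows "torsion_module R F (quotient_rmodule M N) \<longleftrightarrow> (\<forall>x\<in>carrier M. conductor R M N x \<in> F)"
proof -
  have "carrier (quotient_rmodule M N) = (\<lambda>x. N +>\<^bsub>M\<^esub> x) ` carrier M"
    by (auto simp: quotient_rmodule_def A_RCOSETS_def')
  then show ?thesis
    by (simp add: torsion_module_def quotient_annihilator[OF N])
qed

end

context gabriel_ring
begin

text \<open>
  Preimage in \<open>M\<close> of the torsion submodule of \<open>M\<close> modulo \<open>N\<close>.
\<close>

lemma conductor_submodule:
  assumes M: "right_module R M" and N: "right_submodule R N M"
  shows "right_submodule R {x \<in> carrier M. conductor R M N x \<in> F} M"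
proof -
  interpret M: right_module R M by (rule M)
  note sub = M.right_submoduleD[OF N]
  have "conductor R M N \<zero>\<^bsub>M\<^esub> = carrier R"
    using sub(2) by (auto simp: conductor_def)
  then have zero: "conductor R M N \<zero>\<^bsub>M\<^esub> \<in> F"
    by (simp add: carrier_in_filter)
  have add: "conductor R M N (x \<oplus>\<^bsub>M\<^esub> y) \<in> F"
    if "x \<in> carrier M" "y \<in> carrier M" "conductor R M N x \<in> F" "conductor R M N y \<in> F" for x y
  proof (rule filter_mono[OF filter_Int[OF that(3,4)]])
    show "conductor R M N x \<inter> conductor R M N y \<subseteq> conductor R M N (x \<oplus>\<^bsub>M\<^esub> y)"
      using that sub(3) by (auto simp: conductor_def M.ract_add_left)
  qed (use that N in \<open>simp add: M.conductor_right_ideal\<close>)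
  have "conductor R M N (x \<cdot>\<^bsub>M\<^esub> r) \<in> F"
    if "x \<in> carrier M" "r \<in> carrier R" "conductor R M N x \<in> F" for x r
    using filter_colon[OF that(3,2)] by (simp add: M.colon_conductor that)
  then show ?thesis
    using zero add by (intro M.right_submoduleI) (auto simp: M.ract_closed)
qed

lemma torsion_part_submodule:
  assumes M: "right_module R M"
  shows "right_submodule R (torsion_part R F M) M"
  using conductor_submodule[OF M right_module.zero_submodule[OF M]]
  by (simp add: torsion_part_def annihilator_eq_conductor)

end

locale quotient_construction = gabriel_ring R F + M: right_module R M
  for R :: "('r, 'x) ring_scheme" (structure) and F :: "'r set set"
    and M :: "('r, 'm, 'y) rmodule_scheme" +
  fixes E :: "('r, 'e) rmodule" and \<iota> :: "'m set \<Rightarrow> 'e"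
  assumes envelope: "injective_envelope R (torsion_quotient R F M) E \<iota>"
begin

abbreviation \<tau> :: "'m set" where
  "\<tau> \<equiv> torsion_part R F M"

abbreviation \<phi> :: "'m \<Rightarrow> 'e" where
  "\<phi> \<equiv> quotients_map R F M \<iota>"

abbreviation image :: "'e set" where
  "image \<equiv> \<phi> ` carrier M"

lemma injective_E: "injective_rmodule R E"
  using envelope by (simp add: injective_envelope_def)

lemma E_right_module: "right_module R E"
  using injective_E by (simp add: injective_rmodule_def)

end

sublocale quotient_construction \<subseteq> E: right_module R E
  by (rule E_right_module)

context quotient_construction
begin

lemma \<tau>_submodule: "right_submodule R \<tau> M"
  by (rule torsion_part_submodule[OF M.right_module_axioms])

lemma carrier_torsion_quotient:
  "carrier (torsion_quotient R F M) = (\<lambda>m. \<tau> +>\<^bsub>M\<^esub> m) ` carrier M"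
  by (auto simp: torsion_quotient_def quotient_rmodule_def A_RCOSETS_def')

lemma image_eq: "\<iota> ` carrier (torsion_quotient R F M) = image"
  by (simp add: carrier_torsion_quotient image_image quotients_map_def)

lemma \<iota>_hom: "\<iota> \<in> rmodule_hom R (torsion_quotient R F M) E"
  and \<iota>_inj: "inj_on \<iota> (carrier (torsion_quotient R F M))"
  and image_essential: "essential_submodule R image E"
  using envelope by (simp_all add: injective_envelope_def image_eq)

lemma image_submodule: "right_submodule R image E"
  using image_essential by (simp add: essential_submodule_def)

lemma \<phi>_closed [simp]: "m \<in> carrier M \<Longrightarrow> \<phi> m \<in> carrier E"
  using E.right_submoduleD(1)[OF image_submodule] by blast

lemma \<phi>_add:
  assumes "m \<in> carrier M" "n \<in> carrier M"
  shows "\<phi> (m \<oplus>\<^bsub>M\<^esub> n) = \<phi> m \<oplus>\<^bsub>E\<^esub> \<phi> n"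
proof -
  interpret T: abelian_subgroup \<tau> M
    by (rule M.submodule_abelian_subgroup[OF \<tau>_submodule])
  have "\<iota> ((\<tau> +>\<^bsub>M\<^esub> m) \<oplus>\<^bsub>torsion_quotient R F M\<^esub> (\<tau> +>\<^bsub>M\<^esub> n)) = \<phi> m \<oplus>\<^bsub>E\<^esub> \<phi> n"
    using \<iota>_hom assms by (auto simp: rmodule_hom_def carrier_torsion_quotient quotients_map_def)
  then show ?thesis
    using assms T.a_rcos_sum[of m n]
    by (simp add: torsion_quotient_def quotient_rmodule_def quotients_map_def)
qed

lemma \<phi>_ract:
  assumes "m \<in> carrier M" "r \<in> carrier R"
  shows "\<phi> (m \<cdot>\<^bsub>M\<^esub> r) = \<phi> m \<cdot>\<^bsub>E\<^esub> r"
proof -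
  have "\<iota> ((\<tau> +>\<^bsub>M\<^esub> m) \<cdot>\<^bsub>torsion_quotient R F M\<^esub> r) = \<phi> m \<cdot>\<^bsub>E\<^esub> r"
    using \<iota>_hom assms by (auto simp: rmodule_hom_def carrier_torsion_quotient quotients_map_def)
  then show ?thesis
    using M.quotient_rmodule_ract[OF \<tau>_submodule assms]
    by (simp add: torsion_quotient_def quotients_map_def)
qed

lemma \<phi>_eq_zero_iff:
  assumes m: "m \<in> carrier M"
  shows "\<phi> m = \<zero>\<^bsub>E\<^esub> \<longleftrightarrow> m \<in> \<tau>"
proof -
  have "\<phi> \<zero>\<^bsub>M\<^esub> = \<zero>\<^bsub>E\<^esub>"
    using \<phi>_ract[of "\<zero>\<^bsub>M\<^esub>" \<zero>] by simp
  then have "\<phi> m = \<zero>\<^bsub>E\<^esub> \<longleftrightarrow> \<tau> +>\<^bsub>M\<^esub> m = \<tau> +>\<^bsub>M\<^esub> \<zero>\<^bsub>M\<^esub>"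
    using inj_on_eq_iff[OF \<iota>_inj, of "\<tau> +>\<^bsub>M\<^esub> m" "\<tau> +>\<^bsub>M\<^esub> \<zero>\<^bsub>M\<^esub>"] m
    by (auto simp: quotients_map_def carrier_torsion_quotient)
  also have "\<tau> +>\<^bsub>M\<^esub> \<zero>\<^bsub>M\<^esub> = \<tau>"
    using M.right_submoduleD(2)[OF \<tau>_submodule] by (simp add: M.coset_eq_iff[OF \<tau>_submodule])
  finally show ?thesis
    by (simp add: M.coset_eq_iff[OF \<tau>_submodule m])
qed

text \<open>
  A quotient by the torsion submodule is torsion-free. If \<open>r\<close> annihilates the class of \<open>m\<close>, then \<open>m r\<close>
  is torsion; so every colon ideal of the annihilator of \<open>m\<close> at such an \<open>r\<close> lies in the filter, and the
  second axiom of Gabriel filters applies.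
\<close>

lemma image_torsion_free:
  assumes m: "m \<in> carrier M" and tors: "annihilator R E (\<phi> m) \<in> F"
  shows "\<phi> m = \<zero>\<^bsub>E\<^esub>"
proof -
  have "annihilator R M m \<in> F"
  proof (rule filter_local[OF tors M.annihilator_right_ideal[OF m]])
    fix r assume "r \<in> annihilator R E (\<phi> m)"
    then have r: "r \<in> carrier R" "\<phi> (m \<cdot>\<^bsub>M\<^esub> r) = \<zero>\<^bsub>E\<^esub>"
      using m by (simp_all add: annihilator_def \<phi>_ract)
    then have "m \<cdot>\<^bsub>M\<^esub> r \<in> \<tau>"
      using \<phi>_eq_zero_iff[of "m \<cdot>\<^bsub>M\<^esub> r"] m M.ract_closed by simp
    then show "colon R (annihilator R M m) r \<in> F"
      using m r by (simp add: torsion_part_def annihilator_eq_conductor M.colon_conductor)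
  qed
  then show ?thesis
    using m by (simp add: \<phi>_eq_zero_iff torsion_part_def)
qed

text \<open>
  The torsion submodule of \<open>E\<close> meets the image of \<open>M\<close> trivially and vanishes because the image is
  essential.
\<close>

lemma E_torsion_free:
  assumes "x \<in> carrier E" "annihilator R E x \<in> F"
  shows "x = \<zero>\<^bsub>E\<^esub>"
proof -
  have sub: "right_submodule R (torsion_part R F E) E"
    by (rule torsion_part_submodule[OF E_right_module])
  have "torsion_part R F E \<inter> image \<subseteq> {\<zero>\<^bsub>E\<^esub>}"
    using image_torsion_free by (auto simp: torsion_part_def)
  moreover have "\<zero>\<^bsub>E\<^esub> \<in> torsion_part R F E \<inter> image"
    using E.right_submoduleD(2)[OF sub] E.right_submoduleD(2)[OF image_submodule] by blast
  ultimately have "torsion_part R F E \<inter> image = {\<zero>\<^bsub>E\<^esub>}"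
    by blast
  then have "torsion_part R F E = {\<zero>\<^bsub>E\<^esub>}"
    using image_essential sub by (auto simp: essential_submodule_def)
  then show ?thesis
    using assms by (auto simp: torsion_part_def)
qed

text \<open>
  The explicit form of the module of quotients as a submodule of \<open>E\<close>.
\<close>

definition torsion_closure :: "'e set" where
  "torsion_closure = {x \<in> carrier E. conductor R E image x \<in> F}"

lemma torsion_closure_submodule: "right_submodule R torsion_closure E"
  unfolding torsion_closure_def by (rule conductor_submodule[OF E_right_module image_submodule])

lemma torsion_extension_iff:
  "torsion_extension R F M E \<iota> N \<longleftrightarrow> right_submodule R N E \<and> image \<subseteq> N \<and> N \<subseteq> torsion_closure"
proof (cases "right_submodule R N E \<and> image \<subseteq> N")
  case True
  then have N: "right_submodule R N E" and image: "image \<subseteq> N"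
    by auto
  interpret N: right_module R "E\<lparr>carrier := N\<rparr>"
    by (rule E.submodule_right_module[OF N])
  have "right_submodule R image (E\<lparr>carrier := N\<rparr>)"
    using image E.right_submoduleD[OF image_submodule] by (intro N.right_submoduleI) auto
  then have "torsion_module R F (quotient_rmodule (E\<lparr>carrier := N\<rparr>) image)
      \<longleftrightarrow> (\<forall>x\<in>N. conductor R E image x \<in> F)"
    by (simp add: N.torsion_quotient_iff conductor_def)
  moreover have "N \<subseteq> carrier E"
    by (rule E.right_submoduleD(1)[OF N])
  ultimately show ?thesis
    using True by (auto simp: torsion_extension_def image_eq torsion_closure_def)
qed (auto simp: torsion_extension_def image_eq)

lemma image_subset_torsion_closure: "image \<subseteq> torsion_closure"
proof
  fix x assume x: "x \<in> image"
  then have "conductor R E image x = carrier R"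
    using E.right_submoduleD(5)[OF image_submodule] by (auto simp: conductor_def)
  then show "x \<in> torsion_closure"
    using x carrier_in_filter by (auto simp: torsion_closure_def)
qed

lemma module_of_quotients_eq: "module_of_quotients R F M E \<iota> = E\<lparr>carrier := torsion_closure\<rparr>"
proof -
  have "(THE N. torsion_extension R F M E \<iota> N \<and>
      (\<forall>N'. torsion_extension R F M E \<iota> N' \<longrightarrow> N' \<subseteq> N)) = torsion_closure"
    using torsion_closure_submodule image_subset_torsion_closure
    by (intro the_equality) (auto simp: torsion_extension_iff)
  then show ?thesis
    by (simp add: module_of_quotients_def)
qed

text \<open>
  Injectivity of \<open>E\<close> extends \<open>f\<close> to a map \<open>h\<close> on \<open>R\<close>, and \<open>h 1\<close> is the required element. It lies in the
  torsion closure because its products with the members of \<open>I\<close> do.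
\<close>

lemma extend_from_filter:
  assumes I: "I \<in> F" and f: "f \<in> I \<rightarrow> torsion_closure"
    and add: "\<And>r s. \<lbrakk>r \<in> I; s \<in> I\<rbrakk> \<Longrightarrow> f (r \<oplus> s) = f r \<oplus>\<^bsub>E\<^esub> f s"
    and mult: "\<And>r s. \<lbrakk>r \<in> I; s \<in> carrier R\<rbrakk> \<Longrightarrow> f (r \<otimes> s) = f r \<cdot>\<^bsub>E\<^esub> s"
  shows "\<exists>x\<in>torsion_closure. \<forall>r\<in>I. f r = x \<cdot>\<^bsub>E\<^esub> r"
proof -
  interpret RR: right_module R "regular_rmodule R"
    by (rule regular_right_module)
  have I_ideal: "right_ideal R I"
    by (rule filter_right_ideal[OF I])
  note ideal = right_idealD[OF I_ideal]
  let ?A = "(regular_rmodule R)\<lparr>carrier := I\<rparr>"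
  have A: "right_module R ?A"
    using I_ideal by (simp add: RR.submodule_right_module right_ideal_iff_submodule)
  have "(\<lambda>r. r) \<in> rmodule_hom R ?A (regular_rmodule R)" "inj_on (\<lambda>r. r) (carrier ?A)"
    using ideal(1) by (auto simp: rmodule_hom_def)
  moreover have "f \<in> rmodule_hom R ?A E"
    using f add mult by (auto simp: rmodule_hom_def torsion_closure_def)
  ultimately have "\<exists>h\<in>rmodule_hom R (regular_rmodule R) E. \<forall>r\<in>carrier ?A. h r = f r"
    using injective_E[unfolded injective_rmodule_def, THEN conjunct2, rule_format,
        of ?A "regular_rmodule R" "\<lambda>r. r" f] A RR.right_module_axioms
    by blast
  then obtain h where h: "h \<in> rmodule_hom R (regular_rmodule R) E" "\<forall>r\<in>I. h r = f r"
    by auto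
  have x: "h \<one> \<in> carrier E"
    using h(1) by (auto simp: rmodule_hom_def)
  have fx: "f r = h \<one> \<cdot>\<^bsub>E\<^esub> r" if r: "r \<in> I" for r
  proof -
    have "r \<in> carrier R"
      using ideal(1) r by blast
    then have "h (\<one> \<otimes> r) = h \<one> \<cdot>\<^bsub>E\<^esub> r"
      using h(1) one_closed unfolding rmodule_hom_def regular_rmodule_simps by blast
    then show ?thesis
      using h(2) r \<open>r \<in> carrier R\<close> by simp
  qed
  have "conductor R E image (h \<one>) \<in> F"
  proof (rule filter_local[OF I E.conductor_right_ideal[OF image_submodule x]])
    fix r assume r: "r \<in> I"
    then have "conductor R E image (f r) \<in> F"
      using f by (auto simp: torsion_closure_def)
    then show "colon R (conductor R E image (h \<one>)) r \<in> F"
      using r ideal(1) x by (auto simp: E.colon_conductor fx)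
  qed
  then show ?thesis
    using x fx by (auto simp: torsion_closure_def)
qed

lemma module_of_quotients: "quotient_module R F M (module_of_quotients R F M E \<iota>) \<phi>"
  unfolding module_of_quotients_eq
proof (intro quotient_module.intro quotient_module_axioms.intro)
  show "gabriel_ring R F" "right_module R M"
    by unfold_locales
  show "right_module R (E\<lparr>carrier := torsion_closure\<rparr>)"
    by (rule E.submodule_right_module[OF torsion_closure_submodule])
  show "\<phi> \<in> rmodule_hom R M (E\<lparr>carrier := torsion_closure\<rparr>)"
    using image_subset_torsion_closure by (auto simp: rmodule_hom_def \<phi>_add \<phi>_ract)
  show "x = \<zero>\<^bsub>E\<lparr>carrier := torsion_closure\<rparr>\<^esub>"
    if "x \<in> carrier (E\<lparr>carrier := torsion_closure\<rparr>)" "annihilator R (E\<lparr>carrier := torsion_closure\<rparr>) x \<in> F" for x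
    using that E_torsion_free[of x] by (simp add: torsion_closure_def annihilator_def)
  show "annihilator R M m \<in> F" if "m \<in> carrier M" "\<phi> m = \<zero>\<^bsub>E\<lparr>carrier := torsion_closure\<rparr>\<^esub>" for m
    using that by (simp add: \<phi>_eq_zero_iff torsion_part_def)
  show "conductor R (E\<lparr>carrier := torsion_closure\<rparr>) image x \<in> F"
    if "x \<in> carrier (E\<lparr>carrier := torsion_closure\<rparr>)" for x
    using that by (simp add: torsion_closure_def conductor_def)
  show "\<exists>x\<in>carrier (E\<lparr>carrier := torsion_closure\<rparr>). \<forall>r\<in>I. f r = x \<cdot>\<^bsub>E\<lparr>carrier := torsion_closure\<rparr>\<^esub> r"
    if "I \<in> F" "f \<in> I \<rightarrow> carrier (E\<lparr>carrier := torsion_closure\<rparr>)"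
      "\<And>r s. \<lbrakk>r \<in> I; s \<in> I\<rbrakk> \<Longrightarrow> f (r \<oplus> s) = f r \<oplus>\<^bsub>E\<lparr>carrier := torsion_closure\<rparr>\<^esub> f s"
      "\<And>r s. \<lbrakk>r \<in> I; s \<in> carrier R\<rbrakk> \<Longrightarrow> f (r \<otimes> s) = f r \<cdot>\<^bsub>E\<lparr>carrier := torsion_closure\<rparr>\<^esub> s"
    for I f
    using extend_from_filter[of I f] that by simp
qed

end


section \<open>The formula for the extended derivation\<close>

text \<open>
  The map \<open>\<Phi>\<close> stands for the canonical map from the tensor product, which is given here by its
  linearity and its values on tensors.
\<close>

locale perfect_derivation = quotient_action_derivation R F M Q \<phi> A \<alpha> \<delta> d
  for R :: "('r, 'x) ring_scheme" (structure) and F :: "'r set set"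
    and M :: "('r, 'm, 'y) rmodule_scheme" and Q :: "('r, 'e, 'z) rmodule_scheme"
    and \<phi> :: "'m \<Rightarrow> 'e" and A :: "('r, 'q, 'w) rmodule_scheme" and \<alpha> :: "'r \<Rightarrow> 'q"
    and \<delta> :: "'r \<Rightarrow> 'r" and d :: "'m \<Rightarrow> 'm" +
  fixes \<Phi> :: "(('m \<times> 'q) \<Rightarrow>\<^sub>0 int) set \<Rightarrow> 'e"
  assumes perfect: "I \<in> F \<Longrightarrow> extended_right_ideal (quotient_ring R A \<alpha>) \<alpha> I = carrier A"
    and \<Phi>_hom: "\<Phi> \<in> rmodule_hom (quotient_ring R A \<alpha>)
      (tensor_rmodule R M (left_module_via (quotient_ring R A \<alpha>) \<alpha>)) (over_quotient_ring R Q A \<alpha>)"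
    and \<Phi>_tens: "\<lbrakk>m \<in> carrier M; q \<in> carrier A\<rbrakk> \<Longrightarrow>
      \<Phi> (tensor R M (left_module_via (quotient_ring R A \<alpha>) \<alpha>) m q) = scalar_action R Q A \<alpha> (\<phi> m) q"
begin

abbreviation H :: "('q, 'e) rmodule" where
  "H \<equiv> over_quotient_ring R Q A \<alpha>"

abbreviation T where
  "T \<equiv> tensor_rmodule R M (left_module_via S \<alpha>)"

abbreviation tens where
  "tens \<equiv> tensor R M (left_module_via S \<alpha>)"

lemma tensor: "tensor_ring R M S \<alpha>"
  by (intro tensor_ring.intro tensor_ring_axioms.intro M.right_module_axioms quotient_ring
      \<alpha>_ring_hom)

lemma T_abelian_group: "abelian_group T"
  by (rule tensor_ring.abelian_group_T[OF tensor])

lemma tens_closed: "\<lbrakk>m \<in> carrier M; q \<in> carrier A\<rbrakk> \<Longrightarrow> tens m q \<in> carrier T"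
  using tensor_ring.tens_closed[OF tensor] by simp

lemma H_abelian_group: "abelian_group H"
  using over_quotient_ring by (simp add: right_module_def)

lemma \<Phi>_finsum:
  assumes "finite I" "g \<in> I \<rightarrow> carrier T"
  shows "\<Phi> (\<Oplus>\<^bsub>T\<^esub>i\<in>I. g i) = (\<Oplus>\<^bsub>H\<^esub>i\<in>I. \<Phi> (g i))"
  by (rule additive_finsum[OF T_abelian_group H_abelian_group _ _ assms])
    (use \<Phi>_hom in \<open>auto simp: rmodule_hom_def\<close>)

text \<open>
  Perfection says that a member \<open>I\<close> of the filter generates the unit ideal of the ring of quotients.
\<close>

lemma unit_decomposition:
  assumes "I \<in> F"
  obtains k :: nat and r p where "r \<in> {..<k} \<rightarrow> I" "p \<in> {..<k} \<rightarrow> carrier A"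
    "(\<Oplus>\<^bsub>S\<^esub>j\<in>{..<k}. \<alpha> (r j) \<otimes>\<^bsub>S\<^esub> p j) = \<one>\<^bsub>S\<^esub>"
proof -
  have "\<one>\<^bsub>S\<^esub> \<in> extended_right_ideal S \<alpha> I"
    using perfect[OF assms] by simp
  then obtain k :: nat and r p where *: "\<one>\<^bsub>S\<^esub> = (\<Oplus>\<^bsub>S\<^esub>j\<in>{..<k}. \<alpha> (r j) \<otimes>\<^bsub>S\<^esub> p j)"
    "r \<in> {..<k} \<rightarrow> I" "p \<in> {..<k} \<rightarrow> carrier S"
    unfolding extended_right_ideal_def by blast
  show thesis
    by (rule that[OF *(2) _ *(1)[symmetric]]) (use *(3) in simp)
qed

lemma fraction_exists:
  assumes q: "q \<in> carrier A"
  shows "\<exists>(k :: nat) r a p. r \<in> {..<k} \<rightarrow> carrier R \<and> a \<in> {..<k} \<rightarrow> carrier R \<and>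
    p \<in> {..<k} \<rightarrow> carrier S \<and> (\<forall>j<k. q \<otimes>\<^bsub>S\<^esub> \<alpha> (r j) = \<alpha> (a j)) \<and>
    (\<Oplus>\<^bsub>S\<^esub>j\<in>{..<k}. \<alpha> (r j) \<otimes>\<^bsub>S\<^esub> p j) = \<one>\<^bsub>S\<^esub>"
proof -
  obtain k :: nat and r p where r: "r \<in> {..<k} \<rightarrow> fractional q" and p: "p \<in> {..<k} \<rightarrow> carrier A"
    and unit: "(\<Oplus>\<^bsub>S\<^esub>j\<in>{..<k}. \<alpha> (r j) \<otimes>\<^bsub>S\<^esub> p j) = \<one>\<^bsub>S\<^esub>"
    by (rule unit_decomposition[OF fractional_filter[OF q]])
  have "\<exists>a\<in>carrier R. r j \<in> carrier R \<and> q \<otimes>\<^bsub>S\<^esub> \<alpha> (r j) = \<alpha> a" if "j < k" for j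
  proof -
    have "r j \<in> fractional q"
      using r that by blast
    then show ?thesis
      using q by (auto simp: conductor_def A.act_\<alpha>)
  qed
  then obtain a where "\<And>j. j < k \<Longrightarrow> a j \<in> carrier R \<and> r j \<in> carrier R \<and> q \<otimes>\<^bsub>S\<^esub> \<alpha> (r j) = \<alpha> (a j)"
    by metis
  then show ?thesis
    using p unit by (intro exI[of _ k] exI[of _ r] exI[of _ a] exI[of _ p]) simp
qed

text \<open>
  Write \<open>1 = \<Sum> \<alpha> r\<^sub>j p\<^sub>j\<close> with \<open>x r\<^sub>j = \<phi> m\<^sub>j\<close>. Then \<open>x = \<Sum> \<phi> m\<^sub>j p\<^sub>j\<close> is the image of \<open>\<Sum> m\<^sub>j \<otimes> p\<^sub>j\<close>.
\<close>

lemma \<Phi>_surjective: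
  assumes x: "x \<in> carrier Q"
  shows "\<exists>(n :: nat) m q. m \<in> {..<n} \<rightarrow> carrier M \<and> q \<in> {..<n} \<rightarrow> carrier S \<and>
    \<Phi> (\<Oplus>\<^bsub>T\<^esub>i\<in>{..<n}. tens (m i) (q i)) = x"
proof -
  interpret S: ring S by (rule quotient_ring)
  interpret H: abelian_group H by (rule H_abelian_group)
  obtain n :: nat and r p where r: "r \<in> {..<n} \<rightarrow> conductor R Q (\<phi> ` carrier M) x"
    and p: "p \<in> {..<n} \<rightarrow> carrier A"
    and unit: "(\<Oplus>\<^bsub>S\<^esub>j\<in>{..<n}. \<alpha> (r j) \<otimes>\<^bsub>S\<^esub> p j) = \<one>\<^bsub>S\<^esub>"
    by (rule unit_decomposition[OF cokernel_torsion[OF x]])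
  have "\<exists>m\<in>carrier M. r j \<in> carrier R \<and> x \<cdot>\<^bsub>Q\<^esub> r j = \<phi> m" if "j < n" for j
  proof -
    have "r j \<in> conductor R Q (\<phi> ` carrier M) x"
      using r that by blast
    then show ?thesis
      by (auto simp: conductor_def)
  qed
  then obtain m where m: "\<And>j. j < n \<Longrightarrow> m j \<in> carrier M \<and> r j \<in> carrier R \<and> x \<cdot>\<^bsub>Q\<^esub> r j = \<phi> (m j)"
    by metis
  have p_closed: "p j \<in> carrier A" if "j < n" for j
    using p that by blast
  have summand: "\<Phi> (tens (m j) (p j)) = act x (\<alpha> (r j) \<otimes>\<^bsub>S\<^esub> p j)" if "j < n" for j
    using m[OF that] p_closed[OF that] x
    by (simp add: \<Phi>_tens act_assoc act_\<alpha>)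
  have "\<Phi> (\<Oplus>\<^bsub>T\<^esub>j\<in>{..<n}. tens (m j) (p j)) = (\<Oplus>\<^bsub>H\<^esub>j\<in>{..<n}. \<Phi> (tens (m j) (p j)))"
    by (rule \<Phi>_finsum) (use m p_closed in \<open>auto simp: tens_closed\<close>)
  also have "\<dots> = (\<Oplus>\<^bsub>H\<^esub>j\<in>{..<n}. act x (\<alpha> (r j) \<otimes>\<^bsub>S\<^esub> p j))"
    by (rule H.finsum_cong') (use summand m p_closed x in auto)
  also have "\<dots> = act x (\<Oplus>\<^bsub>S\<^esub>j\<in>{..<n}. \<alpha> (r j) \<otimes>\<^bsub>S\<^esub> p j)"
    by (rule additive_finsum[OF S.abelian_group_axioms H_abelian_group, symmetric])
      (use x m p_closed in \<open>auto simp: act_add_right\<close>)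
  also have "\<dots> = x"
    using x by (simp add: unit[simplified] act_one)
  finally show ?thesis
    using m p by (intro exI[of _ n] exI[of _ m] exI[of _ p]) simp
qed

text \<open>
  By additivity it is enough to differentiate \<open>\<phi> m q\<close>, and the Leibniz rule over the ring of quotients
  turns this into \<open>\<phi> (d m) q + \<phi> m (\<delta> q)\<close>.
\<close>

lemma extension_\<Phi>:
  assumes closed: "\<And>i. i < n \<Longrightarrow> m i \<in> carrier M" "\<And>i. i < n \<Longrightarrow> q i \<in> carrier A"
    and D: "\<And>i. i < n \<Longrightarrow> D i = A.extension (q i)"
  shows "extension (\<Phi> (\<Oplus>\<^bsub>T\<^esub>i\<in>{..<n::nat}. tens (m i) (q i)))
    = \<Phi> (\<Oplus>\<^bsub>T\<^esub>i\<in>{..<n}. tens (d (m i)) (q i) \<oplus>\<^bsub>T\<^esub> tens (m i) (D i))"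
proof -
  interpret H: abelian_group H by (rule H_abelian_group)
  interpret T: abelian_group T by (rule T_abelian_group)
  have \<Phi>_closed: "\<Phi> x \<in> carrier H" if "x \<in> carrier T" for x
    using \<Phi>_hom that by (auto simp: rmodule_hom_def)
  have \<Phi>_add: "\<Phi> (x \<oplus>\<^bsub>T\<^esub> y) = \<Phi> x \<oplus>\<^bsub>H\<^esub> \<Phi> y" if "x \<in> carrier T" "y \<in> carrier T" for x y
    using \<Phi>_hom that by (auto simp: rmodule_hom_def)
  have summand: "extension (\<Phi> (tens (m i) (q i)))
      = \<Phi> (tens (d (m i)) (q i) \<oplus>\<^bsub>T\<^esub> tens (m i) (D i))" if "i < n" for i
    using closed[OF that] D[OF that]
    by (simp add: \<Phi>_add tens_closed \<Phi>_tens extension_act extension_\<phi>)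
  have summand_closed: "tens (d (m i)) (q i) \<oplus>\<^bsub>T\<^esub> tens (m i) (D i) \<in> carrier T" if "i < n" for i
    using closed[OF that] D[OF that] by (simp add: tens_closed)
  have "extension (\<Phi> (\<Oplus>\<^bsub>T\<^esub>i\<in>{..<n}. tens (m i) (q i)))
      = extension (\<Oplus>\<^bsub>H\<^esub>i\<in>{..<n}. \<Phi> (tens (m i) (q i)))"
    using closed by (intro arg_cong[where f = extension] \<Phi>_finsum) (auto simp: tens_closed)
  also have "\<dots> = (\<Oplus>\<^bsub>H\<^esub>i\<in>{..<n}. extension (\<Phi> (tens (m i) (q i))))"
    using closed \<Phi>_closed
    by (intro additive_finsum[OF H_abelian_group H_abelian_group])
      (auto simp: extension_add \<Phi>_tens)
  also have "\<dots> = (\<Oplus>\<^bsub>H\<^esub>i\<in>{..<n}. \<Phi> (tens (d (m i)) (q i) \<oplus>\<^bsub>T\<^esub> tens (m i) (D i)))"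
    using summand summand_closed \<Phi>_closed by (intro H.finsum_cong') (auto simp del: over_quotient_ring_simps)
  also have "\<dots> = \<Phi> (\<Oplus>\<^bsub>T\<^esub>i\<in>{..<n}. tens (d (m i)) (q i) \<oplus>\<^bsub>T\<^esub> tens (m i) (D i))"
    using summand_closed by (intro \<Phi>_finsum[symmetric]) auto
  finally show ?thesis .
qed

end

theorem corollary6:
  fixes R :: "('r, 'x) ring_scheme" and F :: "'r set set" and \<delta> :: "'r \<Rightarrow> 'r"
    and M :: "('r, 'm, 'y) rmodule_scheme" and d\<^sub>M :: "'m \<Rightarrow> 'm"
    and E\<^sub>R :: "('r, 'q) rmodule" and \<iota>\<^sub>R :: "'r set \<Rightarrow> 'q"
    and E\<^sub>M :: "('r, 'e) rmodule" and \<iota>\<^sub>M :: "'m set \<Rightarrow> 'e"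
  defines "S \<equiv> ring_of_quotients R F E\<^sub>R \<iota>\<^sub>R"
    and "\<phi>\<^sub>R \<equiv> quotients_map R F (regular_rmodule R) \<iota>\<^sub>R"
    and "M\<^sub>F \<equiv> module_of_quotients R F M E\<^sub>M \<iota>\<^sub>M"
    and "\<phi>\<^sub>M \<equiv> quotients_map R F M \<iota>\<^sub>M"
    and "T \<equiv> quotients_tensor_module R F E\<^sub>R \<iota>\<^sub>R M"
    and "tens \<equiv> quotients_tensor R F E\<^sub>R \<iota>\<^sub>R M"
    and "\<Phi>\<^sub>M \<equiv> canonical_map R F E\<^sub>R \<iota>\<^sub>R M E\<^sub>M \<iota>\<^sub>M"
  assumes "ring R"
    and "gabriel_filter R F"
    and "injective_envelope R (torsion_quotient R F (regular_rmodule R)) E\<^sub>R \<iota>\<^sub>R"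
    and "perfect_filter R F E\<^sub>R \<iota>\<^sub>R"
    and "derivation R \<delta>"
    and "right_module R M"
    and "module_derivation R \<delta> M d\<^sub>M"
    and "injective_envelope R (torsion_quotient R F M) E\<^sub>M \<iota>\<^sub>M"
  shows "\<exists>d. (module_derivation R \<delta> M\<^sub>F d \<and> (\<forall>m\<in>carrier M. d (\<phi>\<^sub>M m) = \<phi>\<^sub>M (d\<^sub>M m))) \<and>
      (\<forall>d'. module_derivation R \<delta> M\<^sub>F d' \<and> (\<forall>m\<in>carrier M. d' (\<phi>\<^sub>M m) = \<phi>\<^sub>M (d\<^sub>M m)) \<longrightarrow>
         (\<forall>x\<in>carrier M\<^sub>F. d' x = d x)) \<and>
      (\<forall>x\<in>carrier M\<^sub>F.
         (\<exists>(n :: nat) m q. m \<in> {..<n} \<rightarrow> carrier M \<and> q \<in> {..<n} \<rightarrow> carrier S \<and>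
            \<Phi>\<^sub>M (\<Oplus>\<^bsub>T\<^esub>i\<in>{..<n}. tens (m i) (q i)) = x)) \<and>
      (\<forall>q\<in>carrier S.
         (\<exists>(k :: nat) r a p. r \<in> {..<k} \<rightarrow> carrier R \<and> a \<in> {..<k} \<rightarrow> carrier R \<and>
            p \<in> {..<k} \<rightarrow> carrier S \<and>
            (\<forall>j<k. q \<otimes>\<^bsub>S\<^esub> \<phi>\<^sub>R (r j) = \<phi>\<^sub>R (a j)) \<and>
            (\<Oplus>\<^bsub>S\<^esub>j\<in>{..<k}. \<phi>\<^sub>R (r j) \<otimes>\<^bsub>S\<^esub> p j) = \<one>\<^bsub>S\<^esub>)) \<and>
      (\<forall>x\<in>carrier M\<^sub>F. \<forall>(n :: nat) m q (k :: nat \<Rightarrow> nat) r a p.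
         (\<forall>i<n. m i \<in> carrier M \<and> q i \<in> carrier S) \<and>
         \<Phi>\<^sub>M (\<Oplus>\<^bsub>T\<^esub>i\<in>{..<n}. tens (m i) (q i)) = x \<and>
         (\<forall>i<n. \<forall>j<k i. r i j \<in> carrier R \<and> a i j \<in> carrier R \<and> p i j \<in> carrier S \<and>
            q i \<otimes>\<^bsub>S\<^esub> \<phi>\<^sub>R (r i j) = \<phi>\<^sub>R (a i j)) \<and>
         (\<forall>i<n. (\<Oplus>\<^bsub>S\<^esub>j\<in>{..<k i}. \<phi>\<^sub>R (r i j) \<otimes>\<^bsub>S\<^esub> p i j) = \<one>\<^bsub>S\<^esub>) \<longrightarrow>
         d x = \<Phi>\<^sub>M (\<Oplus>\<^bsub>T\<^esub>i\<in>{..<n}.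
            tens (d\<^sub>M (m i)) (q i) \<oplus>\<^bsub>T\<^esub>
            tens (m i) (\<Oplus>\<^bsub>S\<^esub>j\<in>{..<k i}.
              \<phi>\<^sub>R (\<delta> (a i j)) \<otimes>\<^bsub>S\<^esub> p i j \<ominus>\<^bsub>S\<^esub>
              q i \<otimes>\<^bsub>S\<^esub> \<phi>\<^sub>R (\<delta> (r i j)) \<otimes>\<^bsub>S\<^esub> p i j)))"
proof -
  let ?A = "module_of_quotients R F (regular_rmodule R) E\<^sub>R \<iota>\<^sub>R"
  have gabriel: "gabriel_ring R F"
    using assms by (intro gabriel_ring.intro gabriel_ring_axioms.intro)
  have regular: "right_module R (regular_rmodule R)"
    by (rule ring.regular_right_module[OF \<open>ring R\<close>])
  have module_A: "quotient_module R F (regular_rmodule R) ?A \<phi>\<^sub>R"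
    unfolding \<phi>\<^sub>R_def
    by (intro quotient_construction.module_of_quotients quotient_construction.intro
        quotient_construction_axioms.intro gabriel regular assms)
  have module_M: "quotient_module R F M M\<^sub>F \<phi>\<^sub>M"
    unfolding \<phi>\<^sub>M_def M\<^sub>F_def
    by (intro quotient_construction.module_of_quotients quotient_construction.intro
        quotient_construction_axioms.intro gabriel assms)
  have action: "quotient_action R F M M\<^sub>F \<phi>\<^sub>M ?A \<phi>\<^sub>R"
    by (rule quotient_action.intro[OF module_M module_A])
  \<comment> \<open>Restricting the carrier keeps the action, so the products over \<open>E\<close> are those of the restriction.\<close>
  have ract: "ract (module_of_quotients R F N E \<iota>) = ract E" for N :: "('r, 'n, 'v) rmodule_scheme" and E \<iota>
    by (simp add: module_of_quotients_def)
  have S_eq: "S = quotient_ring R ?A \<phi>\<^sub>R"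
    unfolding S_def ring_of_quotients_def quotient_ring_def \<phi>\<^sub>R_def scalar_action_def
      quotients_action_def ract fun_eq_iff
    by (simp add: module_of_quotients_def)
  have H_eq: "module_over_quotients R F M E\<^sub>M \<iota>\<^sub>M E\<^sub>R \<iota>\<^sub>R = over_quotient_ring R M\<^sub>F ?A \<phi>\<^sub>R"
    unfolding module_over_quotients_def over_quotient_ring_def \<phi>\<^sub>R_def M\<^sub>F_def scalar_action_def
      quotients_action_def ract fun_eq_iff
    by (simp add: module_of_quotients_def)
  have T_eq: "T = tensor_rmodule R M (left_module_via (quotient_ring R ?A \<phi>\<^sub>R) \<phi>\<^sub>R)"
    unfolding T_def quotients_tensor_module_def S_eq[symmetric] unfolding S_def \<phi>\<^sub>R_def ..
  have tens_eq: "tens = tensor R M (left_module_via (quotient_ring R ?A \<phi>\<^sub>R) \<phi>\<^sub>R)"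
    unfolding tens_def quotients_tensor_def S_eq[symmetric] unfolding S_def \<phi>\<^sub>R_def ..
  interpret action: quotient_action R F M M\<^sub>F \<phi>\<^sub>M ?A \<phi>\<^sub>R
    by (rule action)
  have tensor: "tensor_ring R M (quotient_ring R ?A \<phi>\<^sub>R) \<phi>\<^sub>R"
    using assms action.quotient_ring action.\<alpha>_ring_hom
    by (intro tensor_ring.intro tensor_ring_axioms.intro)
  have \<Phi>: "\<Phi>\<^sub>M = (THE \<Phi>. \<Phi> \<in> extensional (carrier T) \<and>
      \<Phi> \<in> rmodule_hom S T (over_quotient_ring R M\<^sub>F ?A \<phi>\<^sub>R) \<and>
      (\<forall>m\<in>carrier M. \<phi>\<^sub>M m = \<Phi> (tens m \<one>\<^bsub>S\<^esub>)))"
    unfolding \<Phi>\<^sub>M_def canonical_map_def H_eq \<phi>\<^sub>M_def T_def tens_def S_def ..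
  note the_hom = tensor_ring.the_hom[OF tensor action.over_quotient_ring, of \<phi>\<^sub>M]
  have "perfect_derivation R F M M\<^sub>F \<phi>\<^sub>M ?A \<phi>\<^sub>R \<delta> d\<^sub>M \<Phi>\<^sub>M"
  proof (intro perfect_derivation.intro perfect_derivation_axioms.intro
      quotient_action_derivation.intro quotient_module_derivation.intro
      quotient_module_derivation_axioms.intro action module_M)
    show "derivation R \<delta>" "module_derivation R \<delta> M d\<^sub>M"
      by fact+
    show "extended_right_ideal (quotient_ring R ?A \<phi>\<^sub>R) \<phi>\<^sub>R I = carrier ?A" if "I \<in> F" for I
      using \<open>perfect_filter R F E\<^sub>R \<iota>\<^sub>R\<close> that
      by (auto simp: perfect_filter_def Let_def simp flip: S_def \<phi>\<^sub>R_def simp: S_eq)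
    show "\<Phi>\<^sub>M \<in> rmodule_hom (quotient_ring R ?A \<phi>\<^sub>R)
        (tensor_rmodule R M (left_module_via (quotient_ring R ?A \<phi>\<^sub>R) \<phi>\<^sub>R))
        (over_quotient_ring R M\<^sub>F ?A \<phi>\<^sub>R)"
      unfolding \<Phi> S_eq T_eq tens_eq
      by (rule the_hom) (auto simp: action.\<phi>_add action.\<phi>_ract action.act_\<alpha>)
    show "\<Phi>\<^sub>M (tensor R M (left_module_via (quotient_ring R ?A \<phi>\<^sub>R) \<phi>\<^sub>R) m q)
        = scalar_action R M\<^sub>F ?A \<phi>\<^sub>R (\<phi>\<^sub>M m) q" if "m \<in> carrier M" "q \<in> carrier ?A" for m q
      unfolding \<Phi> S_eq T_eq tens_eq
      by (subst the_hom) (use that in \<open>auto simp: action.\<phi>_add action.\<phi>_ract action.act_\<alpha>\<close>)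
  qed
  then interpret perfect_derivation R F M M\<^sub>F \<phi>\<^sub>M ?A \<phi>\<^sub>R \<delta> d\<^sub>M \<Phi>\<^sub>M .
  have formula: "extension x = \<Phi>\<^sub>M (\<Oplus>\<^bsub>T\<^esub>i\<in>{..<n}. tens (d\<^sub>M (m i)) (q i) \<oplus>\<^bsub>T\<^esub>
      tens (m i) (\<Oplus>\<^bsub>S\<^esub>j\<in>{..<k i}. \<phi>\<^sub>R (\<delta> (a i j)) \<otimes>\<^bsub>S\<^esub> p i j \<ominus>\<^bsub>S\<^esub>
        q i \<otimes>\<^bsub>S\<^esub> \<phi>\<^sub>R (\<delta> (r i j)) \<otimes>\<^bsub>S\<^esub> p i j))"
    if "\<forall>i<n. m i \<in> carrier M \<and> q i \<in> carrier S"
      and x: "\<Phi>\<^sub>M (\<Oplus>\<^bsub>T\<^esub>i\<in>{..<n}. tens (m i) (q i)) = x"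
      and "\<forall>i<n. \<forall>j<k i. r i j \<in> carrier R \<and> a i j \<in> carrier R \<and> p i j \<in> carrier S \<and>
        q i \<otimes>\<^bsub>S\<^esub> \<phi>\<^sub>R (r i j) = \<phi>\<^sub>R (a i j)"
      and "\<forall>i<n. (\<Oplus>\<^bsub>S\<^esub>j\<in>{..<k i}. \<phi>\<^sub>R (r i j) \<otimes>\<^bsub>S\<^esub> p i j) = \<one>\<^bsub>S\<^esub>"
    for x and n :: nat and m q and k :: "nat \<Rightarrow> nat" and r a p
    using that(1,3,4) unfolding x[symmetric] S_eq T_eq tens_eq
    by (intro extension_\<Phi> extension_formula[symmetric]) (simp_all del: quotient_ring_simps(5))
  show ?thesis
  proof (intro exI[of _ extension] conjI allI ballI impI)
    show "module_derivation R \<delta> M\<^sub>F extension"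
      by (rule extension_module_derivation)
    show "extension (\<phi>\<^sub>M m) = \<phi>\<^sub>M (d\<^sub>M m)" if "m \<in> carrier M" for m
      by (rule extension_\<phi>[OF that])
  qed (use derivation_eq_extension \<Phi>_surjective fraction_exists formula in
      \<open>auto simp: S_eq T_eq tens_eq\<close>)
qed

end
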